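(* Let $\Gamma \subset \mathsf{Homeo}(M)$ be a non-elementary convergence group and let $\sigma_0, \sigma_1 \colon \Gamma \times M \to \mathbb{R}$ be expanding coarse-cocycles with finite critical exponents $\delta_{\sigma_0}(\Gamma)= \delta_{\sigma_1}(\Gamma)=1$. For $0 < \lambda < 1$, let $\sigma_\lambda = \lambda \sigma_0 + (1-\lambda)\sigma_1$. Then $$\delta_{\sigma_\lambda}(\Gamma) \leq 1.$$ Moreover, if $\sum_{\gamma \in \Gamma} e^{-\delta_{\sigma_\lambda}(\Gamma) \|\gamma\|_{\sigma_\lambda}} = +\infty$, then the following are equivalent: (1) $\delta_{\sigma_\lambda}(\Gamma) = 1$. (2) $\sup_{\gamma \in \Gamma} \left| \|\gamma\|_{\sigma_0} - \|\gamma\|_{\sigma_1}\right| < +\infty$.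
   Context: Convergence groups. $M$ is a compact metrizable space. A subgroup $\Gamma\subset\mathsf{Homeo}(M)$ is a (discrete) convergence group if for every sequence $\{\gamma_n\}$ of distinct elements of $\Gamma$ there are $x,y\in M$ and a subsequence $\{\gamma_{n_j}\}$ such that $\gamma_{n_j}|_{M\smallsetminus\{y\}}$ converges locally uniformly to the constant $x$. The limit set $\Lambda(\Gamma)$ is the set of $x\in M$ for which there are $y\in M$ and a sequence $\{\gamma_n\}\subset\Gamma$ with $\gamma_n|_{M\smallsetminus\{y\}}\to x$ locally uniformly. $\Gamma$ is non-elementary if $\#\Lambda(\Gamma)\ge 3$. An element $\gamma$ is loxodromic if it has two fixed points $\gamma^+\ne\gamma^-$ in $\Lambda(\Gamma)$ such that $\gamma^{\pm n}|_{M\smallsetminus\{\gamma^{\mp}\}}$ converges locally uniformly to $\gamma^{\pm}$ as $n\to+\infty$. Compatible metrics. $\Gamma\sqcup M$ carries a unique compact metrizable topology for which the inclusions of $\Gamma$ (discrete) and of $M$ are embeddings and the natural action of $\Gamma$ (left multiplication on $\Gamma$) is a convergence group action. A compatible metric $\mathrm{d}$ is a metric on $\Gamma\sqcup M$ inducing this topology; fix one. Coarse-cocycles. For $\kappa\ge0$, $\sigma\colon\Gamma\times M\to\mathbb{R}$ is a $\kappa$-coarse-cocycle if (i) $\limsup_{x\to x_0}|\sigma(\gamma,x_0)-\sigma(\gamma,x)|\le\kappa$ for all $\gamma\in\Gamma$, $x_0\in M$, and (ii) $|\sigma(\gamma_1\gamma_2,x)-(\sigma(\gamma_1,\gamma_2x)+\sigma(\gamma_2,x))|\le\kappa$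 for all $\gamma_1,\gamma_2\in\Gamma$, $x\in M$. A coarse-cocycle is a $\kappa$-coarse-cocycle for some $\kappa$. It is proper if $\sigma(\gamma_n,\gamma_n^+)\to+\infty$ whenever $\{\gamma_n\}\subset\Gamma$ is a sequence of distinct loxodromic elements with $\liminf_n\mathrm{d}(\gamma_n^-,\gamma_n^+)>0$. It is expanding if it is proper and for each $\gamma\in\Gamma$ there is a number $\|\gamma\|_\sigma\in\mathbb{R}$ (the $\sigma$-magnitude) such that for every $\epsilon>0$ there is $C>0$ with $\|\gamma\|_\sigma-C\le\sigma(\gamma,x)\le\|\gamma\|_\sigma+C$ whenever $x\in M$, $\gamma\in\Gamma$ and $\mathrm{d}(x,\gamma^{-1})>\epsilon$ (here $\gamma^{-1}$ is a point of $\Gamma\sqcup M$). The magnitude function is any fixed choice; two choices differ by a bounded amount. A convex combination of expanding coarse-cocycles is an expanding coarse-cocycle, so $\|\cdot\|_{\sigma_\lambda}$ makes sense. Critical exponent: $\delta_\sigma(\Gamma)=\inf\{s>0:\sum_{\gamma\in\Gamma}e^{-s\|\gamma\|_\sigma}<+\infty\}\in[0,+\infty]$ for an expanding coarse-cocycle $\sigma$; neither it nor the divergence of the series at $s=\delta_\sigma(\Gamma)$ depends on the choice of magnitude. *)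

theory Defs
  imports "HOL-Analysis.Analysis"
begin

(* Uniform convergence on a set U to a constant map x says that f n ` U is eventually contained
   in every neighbourhood of x; on a compact metrizable space this is uniform convergence for
   any metric inducing the topology. *)
definition loc_unif_const ::
    "'x topology \<Rightarrow> (nat \<Rightarrow> 'x \<Rightarrow> 'x) \<Rightarrow> 'x \<Rightarrow> 'x \<Rightarrow> bool" where
  "loc_unif_const X f y x \<longleftrightarrow>
     (\<forall>z \<in> topspace X - {y}. \<exists>U. openin X U \<and> z \<in> U \<and> y \<notin> U \<and>
        (\<forall>V. openin X V \<and> x \<in> V \<longrightarrow> (\<forall>\<^sub>F n in sequentially. f n ` U \<subseteq> V)))"

definition convergence_action ::
    "'x topology \<Rightarrow> 'g set \<Rightarrow> ('g \<Rightarrow> 'x \<Rightarrow> 'x) \<Rightarrow> bool" where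
  "convergence_action X \<Gamma> act \<longleftrightarrow>
     (\<forall>\<gamma>\<in>\<Gamma>. homeomorphic_map X X (act \<gamma>)) \<and>
     (\<forall>g :: nat \<Rightarrow> 'g. inj g \<and> range g \<subseteq> \<Gamma> \<longrightarrow>
        (\<exists>x\<in>topspace X. \<exists>y\<in>topspace X. \<exists>r :: nat \<Rightarrow> nat. strict_mono r \<and>
           loc_unif_const X (\<lambda>j. act (g (r j))) y x))"

definition convergence_group :: "('m::topological_space \<Rightarrow> 'm) set \<Rightarrow> bool" where
  "convergence_group \<Gamma> \<longleftrightarrow>
     id \<in> \<Gamma> \<and> (\<forall>\<gamma>\<in>\<Gamma>. \<forall>\<eta>\<in>\<Gamma>. \<gamma> \<circ> \<eta> \<in> \<Gamma>) \<and> (\<forall>\<gamma>\<in>\<Gamma>. inv \<gamma> \<in> \<Gamma>) \<and>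
     convergence_action euclidean \<Gamma> (\<lambda>\<gamma>. \<gamma>)"

definition limit_set :: "('m::topological_space \<Rightarrow> 'm) set \<Rightarrow> 'm set" where
  "limit_set \<Gamma> = {x. \<exists>y. \<exists>g :: nat \<Rightarrow> 'm \<Rightarrow> 'm. range g \<subseteq> \<Gamma> \<and> loc_unif_const euclidean g y x}"

definition nonelementary :: "('m::topological_space \<Rightarrow> 'm) set \<Rightarrow> bool" where
  "nonelementary \<Gamma> \<longleftrightarrow> infinite (limit_set \<Gamma>) \<or> card (limit_set \<Gamma>) \<ge> 3"

(* gamma is loxodromic with attracting point p = gamma^+ and repelling point q = gamma^-;
   when M has at least three points, gamma determines p and q. *)
definition loxodromic ::
    "('m::topological_space \<Rightarrow> 'm) set \<Rightarrow> ('m \<Rightarrow> 'm) \<Rightarrow> 'm \<Rightarrow> 'm \<Rightarrow> bool" where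
  "loxodromic \<Gamma> \<gamma> p q \<longleftrightarrow>
     \<gamma> \<in> \<Gamma> \<and> p \<in> limit_set \<Gamma> \<and> q \<in> limit_set \<Gamma> \<and> p \<noteq> q \<and> \<gamma> p = p \<and> \<gamma> q = q \<and>
     loc_unif_const euclidean (\<lambda>n. \<gamma> ^^ n) q p \<and>
     loc_unif_const euclidean (\<lambda>n. inv \<gamma> ^^ n) p q"

(* The disjoint union of Gamma and M is carried by Inl ` Gamma \<union> range Inr. *)
fun sum_act :: "('m \<Rightarrow> 'm) \<Rightarrow> ('m \<Rightarrow> 'm) + 'm \<Rightarrow> ('m \<Rightarrow> 'm) + 'm" where
  "sum_act \<gamma> (Inl \<eta>) = Inl (\<gamma> \<circ> \<eta>)"
| "sum_act \<gamma> (Inr x) = Inr (\<gamma> x)"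

definition compactification ::
    "('m::topological_space \<Rightarrow> 'm) set \<Rightarrow> (('m \<Rightarrow> 'm) + 'm) topology \<Rightarrow> bool" where
  "compactification \<Gamma> X \<longleftrightarrow>
     topspace X = Inl ` \<Gamma> \<union> range Inr \<and> compact_space X \<and> metrizable_space X \<and>
     embedding_map (discrete_topology \<Gamma>) X Inl \<and> embedding_map euclidean X Inr \<and>
     convergence_action X \<Gamma> sum_act"

(* The compactification topology is unique, so a compatible metric is one whose induced topology
   has the properties that characterise it. *)
definition compatible_metric ::
    "('m::topological_space \<Rightarrow> 'm) set \<Rightarrow> (('m \<Rightarrow> 'm) + 'm \<Rightarrow> ('m \<Rightarrow> 'm) + 'm \<Rightarrow> real) \<Rightarrow> bool" where
  "compatible_metric \<Gamma> d \<longleftrightarrow>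
     Metric_space (Inl ` \<Gamma> \<union> range Inr) d \<and>
     compactification \<Gamma> (Metric_space.mtopology (Inl ` \<Gamma> \<union> range Inr) d)"

(* "at x0" excludes x0 itself, which is immaterial: the function vanishes at x0 and
   the Limsup along the trivial filter at an isolated point is -\<infinity>. *)
definition coarse_cocycle_const ::
    "real \<Rightarrow> ('m::topological_space \<Rightarrow> 'm) set \<Rightarrow> (('m \<Rightarrow> 'm) \<Rightarrow> 'm \<Rightarrow> real) \<Rightarrow> bool" where
  "coarse_cocycle_const \<kappa> \<Gamma> \<sigma> \<longleftrightarrow>
     (\<forall>\<gamma>\<in>\<Gamma>. \<forall>x0. Limsup (at x0) (\<lambda>x. ereal \<bar>\<sigma> \<gamma> x0 - \<sigma> \<gamma> x\<bar>) \<le> ereal \<kappa>) \<and>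
     (\<forall>\<gamma>1\<in>\<Gamma>. \<forall>\<gamma>2\<in>\<Gamma>. \<forall>x. \<bar>\<sigma> (\<gamma>1 \<circ> \<gamma>2) x - (\<sigma> \<gamma>1 (\<gamma>2 x) + \<sigma> \<gamma>2 x)\<bar> \<le> \<kappa>)"

definition coarse_cocycle ::
    "('m::topological_space \<Rightarrow> 'm) set \<Rightarrow> (('m \<Rightarrow> 'm) \<Rightarrow> 'm \<Rightarrow> real) \<Rightarrow> bool" where
  "coarse_cocycle \<Gamma> \<sigma> \<longleftrightarrow> (\<exists>\<kappa>\<ge>0. coarse_cocycle_const \<kappa> \<Gamma> \<sigma>)"

definition proper_cocycle ::
    "('m::topological_space \<Rightarrow> 'm) set \<Rightarrow> (('m \<Rightarrow> 'm) + 'm \<Rightarrow> ('m \<Rightarrow> 'm) + 'm \<Rightarrow> real) \<Rightarrow>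
      (('m \<Rightarrow> 'm) \<Rightarrow> 'm \<Rightarrow> real) \<Rightarrow> bool" where
  "proper_cocycle \<Gamma> d \<sigma> \<longleftrightarrow>
     (\<forall>(g :: nat \<Rightarrow> 'm \<Rightarrow> 'm) p q. inj g \<and> (\<forall>n. loxodromic \<Gamma> (g n) (p n) (q n)) \<and>
        liminf (\<lambda>n. ereal (d (Inr (q n)) (Inr (p n)))) > 0 \<longrightarrow>
        filterlim (\<lambda>n. \<sigma> (g n) (p n)) at_top sequentially)"

(* mag is an admissible choice of the function gamma \<mapsto> ||gamma||_sigma. *)
definition magnitude ::
    "('m::topological_space \<Rightarrow> 'm) set \<Rightarrow> (('m \<Rightarrow> 'm) + 'm \<Rightarrow> ('m \<Rightarrow> 'm) + 'm \<Rightarrow> real) \<Rightarrow>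
      (('m \<Rightarrow> 'm) \<Rightarrow> 'm \<Rightarrow> real) \<Rightarrow> (('m \<Rightarrow> 'm) \<Rightarrow> real) \<Rightarrow> bool" where
  "magnitude \<Gamma> d \<sigma> mag \<longleftrightarrow>
     (\<forall>\<epsilon>>0. \<exists>C>0. \<forall>\<gamma>\<in>\<Gamma>. \<forall>x. d (Inr x) (Inl (inv \<gamma>)) > \<epsilon> \<longrightarrow>
        mag \<gamma> - C \<le> \<sigma> \<gamma> x \<and> \<sigma> \<gamma> x \<le> mag \<gamma> + C)"

definition expanding ::
    "('m::topological_space \<Rightarrow> 'm) set \<Rightarrow> (('m \<Rightarrow> 'm) + 'm \<Rightarrow> ('m \<Rightarrow> 'm) + 'm \<Rightarrow> real) \<Rightarrow>
      (('m \<Rightarrow> 'm) \<Rightarrow> 'm \<Rightarrow> real) \<Rightarrow> bool" where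
  "expanding \<Gamma> d \<sigma> \<longleftrightarrow>
     coarse_cocycle \<Gamma> \<sigma> \<and> proper_cocycle \<Gamma> d \<sigma> \<and> (\<exists>mag. magnitude \<Gamma> d \<sigma> mag)"

(* The critical exponent of an expanding coarse-cocycle is that of any of its magnitude functions.
   Since the terms are positive, summability means that the series is finite; the infimum of the
   empty set is \<infinity>. *)
definition critical_exponent :: "'g set \<Rightarrow> ('g \<Rightarrow> real) \<Rightarrow> ereal" where
  "critical_exponent \<Gamma> mag =
     Inf {ereal s |s. s > 0 \<and> (\<lambda>\<gamma>. exp (- s * mag \<gamma>)) summable_on \<Gamma>}"

definition convex_comb ::
    "real \<Rightarrow> ('g \<Rightarrow> 'm \<Rightarrow> real) \<Rightarrow> ('g \<Rightarrow> 'm \<Rightarrow> real) \<Rightarrow> 'g \<Rightarrow> 'm \<Rightarrow> real" where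
  "convex_comb t \<sigma>0 \<sigma>1 = (\<lambda>\<gamma> x. t * \<sigma>0 \<gamma> x + (1 - t) * \<sigma>1 \<gamma> x)"

(* In particular, convex combinations of expanding coarse-cocycles have magnitude functions. *)
lemma magnitude_convex_comb:
  assumes "0 < t" "t < 1" "magnitude \<Gamma> d \<sigma>0 m0" "magnitude \<Gamma> d \<sigma>1 m1"
  shows "magnitude \<Gamma> d (convex_comb t \<sigma>0 \<sigma>1) (\<lambda>\<gamma>. t * m0 \<gamma> + (1 - t) * m1 \<gamma>)"
  unfolding magnitude_def
proof (intro allI impI)
  fix \<epsilon> :: real assume e: "\<epsilon> > 0"
  obtain C0 where C0: "C0 > 0" "\<And>\<gamma> x. \<gamma> \<in> \<Gamma> \<Longrightarrow> d (Inr x) (Inl (inv \<gamma>)) > \<epsilon> \<Longrightarrow>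
      m0 \<gamma> - C0 \<le> \<sigma>0 \<gamma> x \<and> \<sigma>0 \<gamma> x \<le> m0 \<gamma> + C0"
    using assms(3) e unfolding magnitude_def by meson
  obtain C1 where C1: "C1 > 0" "\<And>\<gamma> x. \<gamma> \<in> \<Gamma> \<Longrightarrow> d (Inr x) (Inl (inv \<gamma>)) > \<epsilon> \<Longrightarrow>
      m1 \<gamma> - C1 \<le> \<sigma>1 \<gamma> x \<and> \<sigma>1 \<gamma> x \<le> m1 \<gamma> + C1"
    using assms(4) e unfolding magnitude_def by meson
  show "\<exists>C>0. \<forall>\<gamma>\<in>\<Gamma>. \<forall>x. d (Inr x) (Inl (inv \<gamma>)) > \<epsilon> \<longrightarrow>
      t * m0 \<gamma> + (1 - t) * m1 \<gamma> - C \<le> convex_comb t \<sigma>0 \<sigma>1 \<gamma> x \<and>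
      convex_comb t \<sigma>0 \<sigma>1 \<gamma> x \<le> t * m0 \<gamma> + (1 - t) * m1 \<gamma> + C"
  proof (intro exI[of _ "t * C0 + (1 - t) * C1"] conjI ballI allI impI)
    show "0 < t * C0 + (1 - t) * C1"
      using assms C0 C1 by (simp add: add_pos_pos)
  next
    fix \<gamma> x assume g: "\<gamma> \<in> \<Gamma>" "d (Inr x) (Inl (inv \<gamma>)) > \<epsilon>"
    have "t * (m0 \<gamma> - C0) \<le> t * \<sigma>0 \<gamma> x" "(1 - t) * (m1 \<gamma> - C1) \<le> (1 - t) * \<sigma>1 \<gamma> x"
      using C0(2)[OF g] C1(2)[OF g] assms by (auto intro!: mult_left_mono)
    then show "t * m0 \<gamma> + (1 - t) * m1 \<gamma> - (t * C0 + (1 - t) * C1) \<le> convex_comb t \<sigma>0 \<sigma>1 \<gamma> x"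
      by (simp add: convex_comb_def algebra_simps)
  next
    fix \<gamma> x assume g: "\<gamma> \<in> \<Gamma>" "d (Inr x) (Inl (inv \<gamma>)) > \<epsilon>"
    have "t * \<sigma>0 \<gamma> x \<le> t * (m0 \<gamma> + C0)" "(1 - t) * \<sigma>1 \<gamma> x \<le> (1 - t) * (m1 \<gamma> + C1)"
      using C0(2)[OF g] C1(2)[OF g] assms by (auto intro!: mult_left_mono)
    then show "convex_comb t \<sigma>0 \<sigma>1 \<gamma> x \<le> t * m0 \<gamma> + (1 - t) * m1 \<gamma> + (t * C0 + (1 - t) * C1)"
      by (simp add: convex_comb_def algebra_simps)
  qed
qed

end

theory Submission
  imports Defs
begin

text \<open>
  Let \<open>u = m0 - m1\<close> and \<open>m = t * m0 + (1 - t) * m1\<close>. The measures on boundaries of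
  Patterson--Sullivan theory are replaced by the finite measures on \<open>\<Gamma>\<close> with density
  \<open>exp (- s * m \<gamma>)\<close>, normalised by their total mass, with all estimates uniform in
  \<open>1 < s \<le> 2\<close>. A discrete shadow of \<open>\<gamma>\<close> has mass comparable to \<open>exp (- s * m \<gamma>)\<close>, and
  likewise for \<open>m0\<close> and \<open>m1\<close>. Where \<open>\<bar>u\<bar> > R\<close>, \<open>m\<close> exceeds \<open>m0\<close> or \<open>m1\<close> by a multiple of
  \<open>R\<close>, so a Vitali covering shows that the shadows of such elements cover a set of mass
  \<open>O(exp (- c * R))\<close>. For a suitable \<open>R\<close>, the set \<open>G\<close> of elements lying in no such shadow
  thus carries at least three quarters of the mass.

  If \<open>\<bar>u\<bar>\<close> were much larger than \<open>R\<close> at some \<open>\<zeta>\<close>, no element of \<open>G\<close> could have the pattern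
  \<open>\<zeta>\<close> along the way to it. Hence \<open>a \<in> G\<close> is determined, up to finitely many choices, by the
  product \<open>a \<circ> f \<circ> \<zeta> \<circ> f' \<circ> b\<close>, where \<open>f\<close> and \<open>f'\<close> come from a finite set and make the
  product aligned. The Poincare series \<open>P\<close> of \<open>m\<close> then satisfies \<open>P(s)^2 = O(P(s))\<close>, so it
  stays bounded as \<open>s\<close> decreases to \<open>1\<close> and converges at \<open>1\<close>. So divergence at \<open>1\<close> forces
  \<open>u\<close> to be bounded.
\<close>

section \<open>Dynamics on the compactification\<close>

text \<open>Products \<open>a \<circ> b\<close> alone cannot give the quadratic estimate: an element
  \<open>v\<close> has an aligned factorisation for roughly every element along the way to
  \<open>v\<close>, and their number is unbounded. Inserting \<open>\<zeta>\<close> with huge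
  \<open>\<bar>u \<zeta>\<bar>\<close> marks the place where \<open>a\<close> ends. As
  \<open>u\<close> is nearly additive on aligned products, it jumps by more than
  \<open>2 * R\<close> between \<open>a\<close> and \<open>a \<circ> f \<circ> \<zeta>\<close>. If
  another factorisation of \<open>v\<close> starts with a longer \<open>a'\<close> in
  \<open>G\<close>, then, up to finitely many relative positions, \<open>a'\<close> lies in the
  shadows of both elements, where \<open>\<bar>u\<bar> \<le> R\<close> is known. The argument has to
  run at \<open>s > 1\<close>, because a divergent series at \<open>s = 1\<close> cannot be
  normalised; hence all constants must be independent of \<open>s\<close>. The bound
  \<open>s \<le> 2\<close> controls factors \<open>exp (s * C)\<close>, and \<open>1 \<le> s\<close>
  preserves the gain \<open>exp (- c * R)\<close>. The magnitudes can be compared over one covering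
  because shadows depend on the metric only.\<close>

locale convergence_compactification =
  fixes \<Gamma> :: "('m::metric_space \<Rightarrow> 'm) set"
    and d :: "('m \<Rightarrow> 'm) + 'm \<Rightarrow> ('m \<Rightarrow> 'm) + 'm \<Rightarrow> real"
  assumes conv_group: "convergence_group \<Gamma>"
    and compat: "compatible_metric \<Gamma> d"
    and compact_space_M: "compact (UNIV :: 'm set)"
    and three_points: "\<exists>p q r :: 'm. p \<noteq> q \<and> p \<noteq> r \<and> q \<noteq> r"
begin

abbreviation X :: "(('m \<Rightarrow> 'm) + 'm) set" where
  "X \<equiv> Inl ` \<Gamma> \<union> range Inr"

sublocale Metric_space X d
  using compat by (simp add: compatible_metric_def)

abbreviation converges :: "(nat \<Rightarrow> ('m \<Rightarrow> 'm) + 'm) \<Rightarrow> ('m \<Rightarrow> 'm) + 'm \<Rightarrow> bool" where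
  "converges z p \<equiv> limitin mtopology z p sequentially"

lemma compactif: "compactification \<Gamma> mtopology"
  using compat by (simp add: compatible_metric_def)

section \<open>Group operations and their action on the compactification\<close>

lemma id_in [simp]: "id \<in> \<Gamma>"
  and comp_in [simp]: "\<gamma> \<in> \<Gamma> \<Longrightarrow> \<eta> \<in> \<Gamma> \<Longrightarrow> \<gamma> \<circ> \<eta> \<in> \<Gamma>"
  and inv_in [simp]: "\<gamma> \<in> \<Gamma> \<Longrightarrow> inv \<gamma> \<in> \<Gamma>"
  using conv_group by (auto simp: convergence_group_def)

lemma bij_elem: "\<gamma> \<in> \<Gamma> \<Longrightarrow> bij \<gamma>"
  using conv_group homeomorphic_imp_injective_map[of euclidean euclidean \<gamma>]
    homeomorphic_imp_surjective_map[of euclidean euclidean \<gamma>]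
  unfolding convergence_group_def convergence_action_def bij_def by simp

lemma inv_comp_self [simp]: "\<gamma> \<in> \<Gamma> \<Longrightarrow> inv \<gamma> \<circ> \<gamma> = id"
  and comp_inv_self [simp]: "\<gamma> \<in> \<Gamma> \<Longrightarrow> \<gamma> \<circ> inv \<gamma> = id"
  and inv_inv [simp]: "\<gamma> \<in> \<Gamma> \<Longrightarrow> inv (inv \<gamma>) = \<gamma>"
  and inv_apply [simp]: "\<gamma> \<in> \<Gamma> \<Longrightarrow> inv \<gamma> (\<gamma> x) = x"
  and apply_inv [simp]: "\<gamma> \<in> \<Gamma> \<Longrightarrow> \<gamma> (inv \<gamma> x) = x"
  using bij_elem[of \<gamma>]
  by (auto simp: bij_def surj_iff inv_inv_eq bij_is_inj surj_f_inv_f)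

lemma inv_comp: "\<gamma> \<in> \<Gamma> \<Longrightarrow> \<eta> \<in> \<Gamma> \<Longrightarrow> inv (\<gamma> \<circ> \<eta>) = inv \<eta> \<circ> inv \<gamma>"
  by (simp add: bij_elem o_inv_distrib)

lemma inv_comp_cancel [simp]: "\<gamma> \<in> \<Gamma> \<Longrightarrow> inv \<gamma> \<circ> (\<gamma> \<circ> \<eta>) = \<eta>"
  and comp_inv_cancel [simp]: "\<gamma> \<in> \<Gamma> \<Longrightarrow> \<gamma> \<circ> (inv \<gamma> \<circ> \<eta>) = \<eta>"
  by (simp_all add: comp_assoc[symmetric])

lemma act_in [simp]: "\<gamma> \<in> \<Gamma> \<Longrightarrow> p \<in> X \<Longrightarrow> sum_act \<gamma> p \<in> X"
  by (cases p) auto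

lemma act_inv [simp]: "\<gamma> \<in> \<Gamma> \<Longrightarrow> sum_act (inv \<gamma>) (sum_act \<gamma> p) = p"
  by (cases p) auto

lemma act_inj: "\<gamma> \<in> \<Gamma> \<Longrightarrow> sum_act \<gamma> p = sum_act \<gamma> q \<longleftrightarrow> p = q"
  by (metis act_inv)

section \<open>Sequential convergence in the compactification\<close>

lemma subseq_converges:
  assumes "\<And>n. z n \<in> X"
  shows "\<exists>p\<in>X. \<exists>r :: nat \<Rightarrow> nat. strict_mono r \<and> converges (z \<circ> r) p"
proof -
  have "compactin mtopology X"
    using compactif by (simp add: compactification_def compact_space_def)
  then show ?thesis
    using assms unfolding compactin_sequentially by (metis image_subset_iff)
qed

lemma converges_subseq: "converges z p \<Longrightarrow> strict_mono r \<Longrightarrow> converges (z \<circ> r) p"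
  by (rule limitin_subsequence)

lemma converges_in: "converges z p \<Longrightarrow> p \<in> X"
  by (simp add: limitin_metric)

lemma converges_unique: "converges z p \<Longrightarrow> converges z q \<Longrightarrow> p = q"
  by (rule limitin_metric_unique) auto

lemma converges_const: "p \<in> X \<Longrightarrow> converges (\<lambda>n. p) p"
  by (simp add: limitin_metric)

lemma converges_act:
  assumes "\<gamma> \<in> \<Gamma>" "converges z p"
  shows "converges (\<lambda>n. sum_act \<gamma> (z n)) (sum_act \<gamma> p)"
proof -
  have "homeomorphic_map mtopology mtopology (sum_act \<gamma>)"
    using compactif assms(1) by (auto simp: compactification_def convergence_action_def)
  then show ?thesis
    using continuous_map_limit[OF homeomorphic_imp_continuous_map assms(2)]
    by (simp add: o_def)
qed

lemma dist_diff_le: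
  assumes "p \<in> X" "q \<in> X" "p' \<in> X" "q' \<in> X"
  shows "\<bar>d p q - d p' q'\<bar> \<le> d p p' + d q q'"
  using assms triangle[of p p' q] triangle[of p' q' q] triangle[of p' p q'] triangle[of p q q']
    commute[of p p'] commute[of q q'] by linarith

lemma converges_iff_dist:
  assumes "p \<in> X" "\<And>n. z n \<in> X"
  shows "converges z p \<longleftrightarrow> (\<lambda>n. d (z n) p) \<longlonglongrightarrow> 0"
  using assms by (auto simp: limitin_metric tendsto_iff)

lemma converges_dist:
  assumes "converges z p" "converges w q" "\<And>n. z n \<in> X" "\<And>n. w n \<in> X"
  shows "(\<lambda>n. d (z n) (w n)) \<longlonglongrightarrow> d p q"
proof -
  have pq: "p \<in> X" "q \<in> X"
    by (rule converges_in, rule assms)+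
  have "(\<lambda>n. d (z n) p) \<longlonglongrightarrow> 0"
    using converges_iff_dist[OF pq(1), of z] assms(1,3) by blast
  moreover have "(\<lambda>n. d (w n) q) \<longlonglongrightarrow> 0"
    using converges_iff_dist[OF pq(2), of w] assms(2,4) by blast
  ultimately have sum: "(\<lambda>n. d (z n) p + d (w n) q) \<longlonglongrightarrow> 0"
    using tendsto_add by fastforce
  have "\<bar>d (z n) (w n) - d p q\<bar> \<le> d (z n) p + d (w n) q" for n
    by (rule dist_diff_le) (rule assms pq)+
  then have "(\<lambda>n. d (z n) (w n) - d p q) \<longlonglongrightarrow> 0"
    by (intro Lim_null_comparison[OF _ sum] always_eventually allI) (metis real_norm_def)
  then show ?thesis by (rule LIM_zero_cancel)
qed

text \<open>\<open>M\<close> is compact and the ambient space is Hausdorff. Hence limits of points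
  of \<open>M\<close> stay in \<open>M\<close>, and the copy of \<Gamma> is open, which makes its
  elements isolated.\<close>

lemma closedin_range_Inr: "closedin mtopology (range Inr)"
proof -
  have "embedding_map euclidean mtopology (Inr :: 'm \<Rightarrow> _)"
    using compactif by (simp add: compactification_def)
  then have "continuous_map euclidean mtopology (Inr :: 'm \<Rightarrow> _)"
    unfolding embedding_map_def
    using homeomorphic_imp_continuous_map continuous_map_in_subtopology by blast
  moreover have "compactin euclidean (UNIV :: 'm set)"
    using compact_space_M by simp
  ultimately have "compactin mtopology (range Inr)"
    using image_compactin by blast
  then show ?thesis
    using compactin_imp_closedin Hausdorff_space_mtopology by blast
qed

lemma converges_Inr_closed:
  assumes "converges (\<lambda>n. Inr (x n)) p"
  shows "p \<in> range Inr"
proof -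
  have "\<forall>\<sigma> l. range \<sigma> \<subseteq> range Inr \<and> converges \<sigma> l \<longrightarrow> l \<in> range Inr"
    using closedin_range_Inr metric_closedin_iff_sequentially_closed by metis
  then show ?thesis using assms by (metis image_subset_iff rangeI)
qed

lemma converges_Inr:
  assumes "x \<longlonglongrightarrow> a"
  shows "converges (\<lambda>n. Inr (x n)) (Inr a)"
proof -
  have "embedding_map euclidean mtopology (Inr :: 'm \<Rightarrow> _)"
    using compactif by (simp add: compactification_def)
  then have "continuous_map euclidean mtopology (Inr :: 'm \<Rightarrow> _)"
    unfolding embedding_map_def
    using homeomorphic_imp_continuous_map continuous_map_in_subtopology by blast
  from continuous_map_limit[OF this, of x a sequentially] assms show ?thesis
    by (simp add: o_def)
qed

lemma openin_singleton_Inl: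
  assumes "\<gamma> \<in> \<Gamma>"
  shows "openin mtopology {Inl \<gamma>}"
proof -
  have "embedding_map (discrete_topology \<Gamma>) mtopology Inl"
    using compactif by (simp add: compactification_def)
  then have "homeomorphic_map (discrete_topology \<Gamma>) (subtopology mtopology (Inl ` \<Gamma>)) Inl"
    by (simp add: embedding_map_def)
  from homeomorphic_map_openness[OF this, of "{\<gamma>}"] assms
  have "openin (subtopology mtopology (Inl ` \<Gamma>)) {Inl \<gamma>}" by simp
  moreover have "X - range Inr = Inl ` \<Gamma>" by auto
  then have "openin mtopology (Inl ` \<Gamma>)"
    using closedin_range_Inr openin_diff[OF openin_topspace closedin_range_Inr] by simp
  ultimately show ?thesis by (rule openin_trans_full)
qed

lemma isolated_Inl:
  assumes "\<gamma> \<in> \<Gamma>"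
  obtains \<epsilon> where "\<epsilon> > 0" "\<And>p. p \<in> X \<Longrightarrow> p \<noteq> Inl \<gamma> \<Longrightarrow> d (Inl \<gamma>) p > \<epsilon>"
proof -
  obtain r where r: "r > 0" "mball (Inl \<gamma>) r \<subseteq> {Inl \<gamma>}"
    using openin_singleton_Inl[OF assms] unfolding openin_mtopology by blast
  show ?thesis
  proof (rule that[of "r/2"])
    fix p assume p: "p \<in> X" "p \<noteq> Inl \<gamma>"
    then have "\<not> d (Inl \<gamma>) p < r" using r(2) assms by (auto simp: mball_def)
    then show "d (Inl \<gamma>) p > r/2" using r(1) by linarith
  qed (use r in simp)
qed

text \<open>Eventually \<open>z n\<close> lies in a neighbourhood of \<open>p\<close> that
  \<open>f n\<close> maps close to \<open>x\<close> as a whole. The compactness arguments need this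
  form, in which the point moves with \<open>n\<close>.\<close>

lemma loc_unif_converges:
  assumes "loc_unif_const mtopology f y x" "converges z p" "p \<noteq> y" "x \<in> X"
  shows "converges (\<lambda>n. f n (z n)) x"
  unfolding limitin_def
proof (intro conjI allI impI)
  show "x \<in> topspace mtopology" using assms by simp
  fix V assume V: "openin mtopology V \<and> x \<in> V"
  have "p \<in> topspace mtopology - {y}"
    using assms converges_in by auto
  then obtain U where U: "openin mtopology U" "p \<in> U" "\<forall>\<^sub>F n in sequentially. f n ` U \<subseteq> V"
    using assms(1) V unfolding loc_unif_const_def by blast
  have "\<forall>\<^sub>F n in sequentially. z n \<in> U"
    using assms(2) U unfolding limitin_def by blast
  with U(3) show "\<forall>\<^sub>F n in sequentially. f n (z n) \<in> V"
    by eventually_elim auto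
qed

lemma two_points_avoiding:
  fixes y :: "('m \<Rightarrow> 'm) + 'm"
  obtains p q :: 'm where "p \<noteq> q" "Inr p \<noteq> y" "Inr q \<noteq> y"
proof -
  obtain p q r :: 'm where "p \<noteq> q" "p \<noteq> r" "q \<noteq> r" using three_points by blast
  then show ?thesis using that[of p q] that[of p r] that[of q r] by auto
qed

lemma loc_unif_const_subseq:
  assumes "loc_unif_const T f y x" "strict_mono s"
  shows "loc_unif_const T (\<lambda>n. f (s n)) y x"
  unfolding loc_unif_const_def
proof
  fix z assume "z \<in> topspace T - {y}"
  then obtain U where U: "openin T U" "z \<in> U" "y \<notin> U"
      "\<And>V. openin T V \<and> x \<in> V \<Longrightarrow> \<forall>\<^sub>F n in sequentially. f n ` U \<subseteq> V"
    using assms(1) unfolding loc_unif_const_def by blast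
  show "\<exists>U. openin T U \<and> z \<in> U \<and> y \<notin> U \<and>
      (\<forall>V. openin T V \<and> x \<in> V \<longrightarrow> (\<forall>\<^sub>F n in sequentially. f (s n) ` U \<subseteq> V))"
    using U eventually_subseq[OF assms(2)] by blast
qed

text \<open>The convergence property on the whole compactification, with both exceptional points
  located in \<open>M\<close> and identified as limits of \<open>g\<close> and of its inverses;
  evaluation at \<open>Inl id\<close> gives the first limit. The extra \<open>s\<close> in the last
  clause leaves room for a further subsequence.\<close>

lemma convergence_sequence:
  fixes g :: "nat \<Rightarrow> 'm \<Rightarrow> 'm"
  assumes "inj g" "\<And>n. g n \<in> \<Gamma>"
  obtains x y :: 'm and r :: "nat \<Rightarrow> nat" where "strict_mono r"
    "converges (\<lambda>n. Inl (g (r n))) (Inr x)"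
    "converges (\<lambda>n. Inl (inv (g (r n)))) (Inr y)"
    "\<And>s z p. strict_mono s \<Longrightarrow> converges z p \<Longrightarrow> p \<noteq> Inr y \<Longrightarrow>
      converges (\<lambda>n. sum_act (g (r (s n))) (z n)) (Inr x)"
proof -
  have "convergence_action mtopology \<Gamma> sum_act"
    using compactif by (simp add: compactification_def)
  moreover have "inj g \<and> range g \<subseteq> \<Gamma>" using assms by auto
  ultimately obtain x y r0 where r0: "strict_mono r0" "x \<in> X" "y \<in> X"
      "loc_unif_const mtopology (\<lambda>j. sum_act (g (r0 j))) y x"
    unfolding convergence_action_def topspace_mtopology by blast
  have g: "g n \<in> \<Gamma>" for n by (rule assms)
  obtain q s1 where s1: "strict_mono s1" "converges ((\<lambda>n. Inl (inv (g (r0 n)))) \<circ> s1) q"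
    using subseq_converges[of "\<lambda>n. Inl (inv (g (r0 n)))"] g by auto
  obtain p1 p2 :: 'm where p12: "p1 \<noteq> p2" "Inr p1 \<noteq> y" "Inr p2 \<noteq> y"
    by (rule two_points_avoiding)
  define r1 where "r1 = r0 \<circ> s1"
  have r1: "strict_mono r1" using r0 s1 by (auto simp: r1_def intro: strict_mono_o)
  have lc: "loc_unif_const mtopology (\<lambda>j. sum_act (g (r1 j))) y x"
    using loc_unif_const_subseq[OF r0(4) s1(1)] by (simp add: r1_def)
  have lu: "converges (\<lambda>n. sum_act (g (r1 n)) (z n)) x" if "converges z p" "p \<noteq> y" for z p
    using loc_unif_converges[OF lc that r0(2)] .
  have "converges (\<lambda>n. Inr (g (r1 n) p1)) x"
    using lu[OF converges_const, of "Inr p1"] p12 by simp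
  then have "x \<in> range Inr" by (rule converges_Inr_closed)
  then obtain x' where x': "x = Inr x'" by auto
  \<comment> \<open>If \<open>y\<close> were outside \<open>M\<close>, the points
    \<open>inv (g n) q\<close> would accumulate at a point of \<open>M\<close>, hence away from
    \<open>y\<close>. Applying \<open>g n\<close> would then make the constant sequence
    \<open>q\<close> tend to \<open>x\<close>.\<close>
  have "y \<in> range Inr"
  proof (rule ccontr)
    assume y: "y \<notin> range Inr"
    have "p1 \<noteq> x' \<or> p2 \<noteq> x'" using p12(1) by blast
    then obtain q where "q \<noteq> x'" by blast
    then have q: "Inr q \<noteq> x" using x' by simp
    obtain p s where s: "strict_mono s" "converges ((\<lambda>n. Inr (inv (g (r1 n)) q)) \<circ> s) p"
      using subseq_converges[of "\<lambda>n. Inr (inv (g (r1 n)) q)", OF UnI2[OF rangeI]] by metis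
    have "p \<noteq> y" using converges_Inr_closed[of "\<lambda>n. inv (g (r1 (s n))) q" p] s(2) y unfolding o_def by blast
    from loc_unif_converges[OF loc_unif_const_subseq[OF lc s(1)] s(2) this r0(2)]
    have "converges (\<lambda>n. Inr q) x" using g by simp
    then show False using q converges_const[of "Inr q"] converges_unique by blast
  qed
  then obtain y' where y': "y = Inr y'" by auto
  \<comment> \<open>If the inverses accumulated away from \<open>y\<close>, \<open>g\<close> would
    push them to \<open>x\<close>, but \<open>g\<close> sends each of them to \<open>id\<close>,
    which is not in \<open>M\<close>.\<close>
  have "q = y"
  proof (rule ccontr)
    assume "q \<noteq> y"
    from loc_unif_converges[OF lc s1(2) this r0(2)] have "converges (\<lambda>n. Inl id) x"
      using g by (simp add: r1_def)
    from converges_unique[OF this converges_const[of "Inl id"]] x' show False by simp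
  qed
  show ?thesis
  proof (rule that[of r1 x' y'])
    show "strict_mono r1" by (rule r1)
    show "converges (\<lambda>n. Inl (g (r1 n))) (Inr x')"
      using lu[OF converges_const, of "Inl id"] y' x' by simp
    show "converges (\<lambda>n. Inl (inv (g (r1 n)))) (Inr y')"
      using s1(2) \<open>q = y\<close> y' by (simp add: r1_def o_def)
    show "converges (\<lambda>n. sum_act (g (r1 (s n))) (z n)) (Inr x')"
      if "strict_mono s" "converges z p" "p \<noteq> Inr y'" for s z p
      using loc_unif_converges[OF loc_unif_const_subseq[OF lc that(1)] that(2)] that(3) r0(2) x' y'
      by simp
  qed
qed

text \<open>\<open>Inl \<gamma>\<close> and \<open>Inl (inv \<gamma>)\<close> stand in for the
  attracting and the repelling point of \<open>\<gamma>\<close>. For infinitely many offenders, the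
  witnesses \<open>z\<close> would accumulate at distance at least \<open>\<epsilon>\<close> from
  the repelling limit \<open>y\<close>, so \<open>g\<close> and the images of the witnesses would
  share the limit \<open>x\<close>.\<close>

lemma finite_noncontracting:
  assumes "\<epsilon> > 0"
  shows "finite {\<gamma>\<in>\<Gamma>. \<exists>z\<in>X. d z (Inl (inv \<gamma>)) > \<epsilon> \<and> \<epsilon> \<le> d (sum_act \<gamma> z) (Inl \<gamma>)}"
    (is "finite ?B")
proof (rule ccontr)
  assume "infinite ?B"
  then obtain g :: "nat \<Rightarrow> 'm \<Rightarrow> 'm" where g: "inj g" "range g \<subseteq> ?B"
    using infinite_countable_subset by blast
  then have g_in: "g n \<in> \<Gamma>" for n by auto
  from g have "\<forall>n. \<exists>z\<in>X. d z (Inl (inv (g n))) > \<epsilon> \<and> \<epsilon> \<le> d (sum_act (g n) z) (Inl (g n))"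
    by auto
  then obtain z where z: "\<And>n. z n \<in> X" "\<And>n. d (z n) (Inl (inv (g n))) > \<epsilon>"
      "\<And>n. \<epsilon> \<le> d (sum_act (g n) (z n)) (Inl (g n))"
    by metis
  obtain x y r where r: "strict_mono r" "converges (\<lambda>n. Inl (g (r n))) (Inr x)"
    "converges (\<lambda>n. Inl (inv (g (r n)))) (Inr y)"
    and conv: "\<And>s z p. strict_mono s \<Longrightarrow> converges z p \<Longrightarrow> p \<noteq> Inr y \<Longrightarrow>
      converges (\<lambda>n. sum_act (g (r (s n))) (z n)) (Inr x)"
    by (rule convergence_sequence[OF g(1) g_in]) (rule that; assumption)
  obtain p s where s: "p \<in> X" "strict_mono s" "converges ((\<lambda>n. z (r n)) \<circ> s) p"
    using subseq_converges[of "\<lambda>n. z (r n)"] z(1) by blast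
  have zs: "converges (\<lambda>n. z (r (s n))) p" using s(3) by (simp add: o_def)
  have gs: "converges (\<lambda>n. Inl (g (r (s n)))) (Inr x)"
    "converges (\<lambda>n. Inl (inv (g (r (s n))))) (Inr y)"
    using converges_subseq[OF r(2) s(2)] converges_subseq[OF r(3) s(2)] by (simp_all add: o_def)
  have "(\<lambda>n. d (z (r (s n))) (Inl (inv (g (r (s n)))))) \<longlonglongrightarrow> d p (Inr y)"
    by (rule converges_dist[OF zs gs(2)]) (rule z(1), simp add: g_in)
  then have "\<epsilon> \<le> d p (Inr y)"
    by (rule LIMSEQ_le_const) (use z(2) less_imp_le in blast)
  then have "p \<noteq> Inr y" using assms by auto
  from conv[OF s(2) zs this]
  have "(\<lambda>n. d (sum_act (g (r (s n))) (z (r (s n)))) (Inl (g (r (s n))))) \<longlonglongrightarrow> d (Inr x) (Inr x)"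
    by (rule converges_dist[OF _ gs(1)]) (rule act_in[OF g_in z(1)], simp add: g_in)
  then have "\<epsilon> \<le> d (Inr x) (Inr x)"
    by (rule LIMSEQ_le_const) (use z(3) in blast)
  then show False using assms by simp
qed

lemma contracting_outside_finite:
  assumes "\<epsilon> > 0"
  obtains \<Phi> where "finite \<Phi>" "\<Phi> \<subseteq> \<Gamma>"
    "\<And>\<gamma> z. \<gamma> \<in> \<Gamma> \<Longrightarrow> \<gamma> \<notin> \<Phi> \<Longrightarrow> z \<in> X \<Longrightarrow> d z (Inl (inv \<gamma>)) > \<epsilon> \<Longrightarrow> d (sum_act \<gamma> z) (Inl \<gamma>) < \<epsilon>"
    "\<And>\<gamma> z. \<gamma> \<in> \<Gamma> \<Longrightarrow> \<gamma> \<notin> \<Phi> \<Longrightarrow> z \<in> X \<Longrightarrow> d z (Inl \<gamma>) > \<epsilon> \<Longrightarrow>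
      d (sum_act (inv \<gamma>) z) (Inl (inv \<gamma>)) < \<epsilon>"
proof -
  define B where "B = {\<gamma>\<in>\<Gamma>. \<exists>z\<in>X. d z (Inl (inv \<gamma>)) > \<epsilon> \<and> \<epsilon> \<le> d (sum_act \<gamma> z) (Inl \<gamma>)}"
  have fin: "finite B" unfolding B_def by (rule finite_noncontracting[OF assms])
  have B: "d (sum_act \<gamma> z) (Inl \<gamma>) < \<epsilon>"
    if "\<gamma> \<in> \<Gamma>" "\<gamma> \<notin> B" "z \<in> X" "d z (Inl (inv \<gamma>)) > \<epsilon>" for \<gamma> z
    using that unfolding B_def by force
  have sub: "B \<subseteq> \<Gamma>" by (auto simp: B_def)
  show ?thesis
  \<comment> \<open>Adding the inverses makes the exceptional set symmetric, so outside of it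
    \<open>\<gamma>\<close> and \<open>inv \<gamma>\<close> both contract.\<close>
  proof (rule that[of "B \<union> inv ` B"])
    fix \<gamma> z assume *: "\<gamma> \<in> \<Gamma>" "\<gamma> \<notin> B \<union> inv ` B" "z \<in> X" "d z (Inl \<gamma>) > \<epsilon>"
    have "inv \<gamma> \<notin> B"
    proof
      assume "inv \<gamma> \<in> B"
      then have "inv (inv \<gamma>) \<in> inv ` B" by blast
      with * show False by simp
    qed
    with B[of "inv \<gamma>" z] * show "d (sum_act (inv \<gamma>) z) (Inl (inv \<gamma>)) < \<epsilon>" by simp
  qed (use fin B sub in auto)
qed

text \<open>Compactness and injectivity: a limit of violating pairs would consist of two distinct
  points with the same image.\<close>

lemma uniformly_separating:
  assumes "\<gamma> \<in> \<Gamma>" "\<epsilon> > 0"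
  shows "\<exists>\<delta>>0. \<forall>p\<in>X. \<forall>q\<in>X. d p q > \<epsilon> \<longrightarrow> d (sum_act \<gamma> p) (sum_act \<gamma> q) > \<delta>"
proof (rule ccontr)
  assume neg: "\<not> ?thesis"
  have "\<exists>p\<in>X. \<exists>q\<in>X. d p q > \<epsilon> \<and> d (sum_act \<gamma> p) (sum_act \<gamma> q) \<le> inverse (real (Suc n))" for n
  proof -
    have "inverse (real (Suc n)) > 0" by simp
    then show ?thesis using neg by (meson not_less)
  qed
  then obtain p q where pq: "\<And>n. p n \<in> X" "\<And>n. q n \<in> X" "\<And>n. d (p n) (q n) > \<epsilon>"
    "\<And>n. d (sum_act \<gamma> (p n)) (sum_act \<gamma> (q n)) \<le> inverse (real (Suc n))"
    by metis
  obtain a r where r: "a \<in> X" "strict_mono r" "converges (p \<circ> r) a"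
    using subseq_converges[of p] pq(1) by blast
  obtain b s where s: "b \<in> X" "strict_mono s" "converges ((\<lambda>n. q (r n)) \<circ> s) b"
    using subseq_converges[of "\<lambda>n. q (r n)"] pq(2) by blast
  have a: "converges (\<lambda>n. p (r (s n))) a"
    using converges_subseq[OF r(3) s(2)] by (simp add: o_def)
  have b: "converges (\<lambda>n. q (r (s n))) b"
    using s(3) by (simp add: o_def)
  have "(\<lambda>n. d (p (r (s n))) (q (r (s n)))) \<longlonglongrightarrow> d a b"
    by (rule converges_dist[OF a b]) (rule pq)+
  then have "\<epsilon> \<le> d a b"
    by (rule LIMSEQ_le_const) (use pq(3) less_imp_le in blast)
  have "strict_mono (r \<circ> s)" using r s by (auto intro: strict_mono_o)
  then have "(\<lambda>n. inverse (real (Suc (r (s n))))) \<longlonglongrightarrow> 0"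
    using LIMSEQ_subseq_LIMSEQ[OF LIMSEQ_inverse_real_of_nat] by (simp add: o_def)
  moreover have "(\<lambda>n. d (sum_act \<gamma> (p (r (s n)))) (sum_act \<gamma> (q (r (s n)))))
      \<longlonglongrightarrow> d (sum_act \<gamma> a) (sum_act \<gamma> b)"
    by (rule converges_dist[OF converges_act[OF assms(1) a] converges_act[OF assms(1) b]])
       (rule act_in[OF assms(1)], rule pq)+
  ultimately have "d (sum_act \<gamma> a) (sum_act \<gamma> b) \<le> 0"
    using pq(4) by (intro LIMSEQ_le) blast+
  then have "sum_act \<gamma> a = sum_act \<gamma> b"
    using zero[of "sum_act \<gamma> a" "sum_act \<gamma> b"] nonneg[of "sum_act \<gamma> a" "sum_act \<gamma> b"]
      act_in[OF assms(1) r(1)] act_in[OF assms(1) s(1)] by linarith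
  then have "a = b" using act_inj assms(1) by blast
  then have "d a b = 0" using r(1) zero by simp
  with \<open>\<epsilon> \<le> d a b\<close> assms(2) show False by linarith
qed

lemma uniformly_separating_finite:
  assumes "finite \<Phi>" "\<Phi> \<subseteq> \<Gamma>" "\<epsilon> > 0"
  shows "\<exists>\<delta>>0. \<forall>\<gamma>\<in>\<Phi>. \<forall>p\<in>X. \<forall>q\<in>X. d p q > \<epsilon> \<longrightarrow> d (sum_act \<gamma> p) (sum_act \<gamma> q) > \<delta>"
  using assms(1,2)
proof (induction \<Phi> rule: finite_induct)
  case empty
  show ?case by (auto intro: exI[of _ 1])
next
  case (insert \<gamma> \<Phi>)
  obtain \<delta>1 where \<delta>1: "\<delta>1 > 0" "\<forall>\<gamma>\<in>\<Phi>. \<forall>p\<in>X. \<forall>q\<in>X. d p q > \<epsilon> \<longrightarrow> d (sum_act \<gamma> p) (sum_act \<gamma> q) > \<delta>1"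
    using insert by blast
  obtain \<delta>2 where \<delta>2: "\<delta>2 > 0" "\<forall>p\<in>X. \<forall>q\<in>X. d p q > \<epsilon> \<longrightarrow> d (sum_act \<gamma> p) (sum_act \<gamma> q) > \<delta>2"
    using uniformly_separating[of \<gamma>] insert.prems assms(3) by blast
  show ?case
  proof (intro exI[of _ "min \<delta>1 \<delta>2"] conjI ballI impI)
    fix \<eta> p q assume *: "\<eta> \<in> insert \<gamma> \<Phi>" "p \<in> X" "q \<in> X" "d p q > \<epsilon>"
    show "min \<delta>1 \<delta>2 < d (sum_act \<eta> p) (sum_act \<eta> q)"
    proof (cases "\<eta> = \<gamma>")
      case True
      with \<delta>2(2) * have "d (sum_act \<eta> p) (sum_act \<eta> q) > \<delta>2" by blast
      then show ?thesis by linarith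
    next
      case False
      with \<delta>1(2) * have "d (sum_act \<eta> p) (sum_act \<eta> q) > \<delta>1" by blast
      then show ?thesis by linarith
    qed
  qed (use \<delta>1(1) \<delta>2(1) in auto)
qed

section \<open>Discrete shadows\<close>

text \<open>A discrete shadow: it consists of group elements rather than of points of \<open>M\<close>.\<close>

definition shadow :: "real \<Rightarrow> ('m \<Rightarrow> 'm) \<Rightarrow> ('m \<Rightarrow> 'm) set" where
  "shadow \<epsilon> \<gamma> = {\<eta>\<in>\<Gamma>. d (Inl (inv \<gamma> \<circ> \<eta>)) (Inl (inv \<gamma>)) > \<epsilon>}"

lemma shadow_mono: "\<delta> \<le> \<epsilon> \<Longrightarrow> shadow \<epsilon> \<gamma> \<subseteq> shadow \<delta> \<gamma>"
  by (auto simp: shadow_def)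

lemma shadow_comp_iff:
  "\<gamma> \<in> \<Gamma> \<Longrightarrow> \<eta> \<in> \<Gamma> \<Longrightarrow> \<gamma> \<circ> \<eta> \<in> shadow \<epsilon> \<gamma> \<longleftrightarrow> d (Inl \<eta>) (Inl (inv \<gamma>)) > \<epsilon>"
  by (simp add: shadow_def)

text \<open>\<open>\<phi>\<close> carries the two points compared in the shadow of
  \<open>\<gamma> \<circ> \<phi>\<close> to the two points compared in the shadow of
  \<open>\<gamma>\<close>, so uniform separation converts one size into the other.\<close>

lemma shadow_comp_finite:
  assumes "finite \<Phi>" "\<Phi> \<subseteq> \<Gamma>" "\<epsilon> > 0"
  obtains \<delta> where "\<delta> > 0" "\<And>\<gamma> \<phi>. \<gamma> \<in> \<Gamma> \<Longrightarrow> \<phi> \<in> \<Phi> \<Longrightarrow> shadow \<epsilon> (\<gamma> \<circ> \<phi>) \<subseteq> shadow \<delta> \<gamma>"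
proof -
  obtain \<delta> where \<delta>: "\<delta> > 0"
    "\<And>\<phi> p q. \<phi> \<in> \<Phi> \<Longrightarrow> p \<in> X \<Longrightarrow> q \<in> X \<Longrightarrow> d p q > \<epsilon> \<Longrightarrow> d (sum_act \<phi> p) (sum_act \<phi> q) > \<delta>"
    using uniformly_separating_finite[OF assms] by metis
  show ?thesis
  proof (rule that[OF \<delta>(1)], rule subsetI)
    fix \<gamma> \<phi> \<eta> assume *: "\<gamma> \<in> \<Gamma>" "\<phi> \<in> \<Phi>" "\<eta> \<in> shadow \<epsilon> (\<gamma> \<circ> \<phi>)"
    then have \<phi>: "\<phi> \<in> \<Gamma>" "\<eta> \<in> \<Gamma>" using assms(2) by (auto simp: shadow_def)
    have "d (Inl (inv (\<gamma> \<circ> \<phi>) \<circ> \<eta>)) (Inl (inv (\<gamma> \<circ> \<phi>))) > \<epsilon>"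
      using * by (simp add: shadow_def)
    from \<delta>(2)[OF *(2) _ _ this] show "\<eta> \<in> shadow \<delta> \<gamma>"
      using * \<phi> by (simp add: shadow_def inv_comp comp_assoc)
  qed
qed

text \<open>Let \<open>\<omega> = inv \<gamma> \<circ> \<gamma>'\<close>. Finitely many
  \<open>\<omega>\<close> amount to a bounded change of centre. Any other
  \<open>inv \<omega>\<close> contracts, and it sends \<open>inv \<gamma>\<close> to
  \<open>inv \<gamma>'\<close>, so \<open>inv \<gamma>'\<close> is near the repelling point of
  \<open>\<omega>\<close>. Whatever is far from \<open>inv \<gamma>'\<close> is thus sent by
  \<open>\<omega>\<close> close to \<open>\<omega>\<close>, which is far from
  \<open>inv \<gamma>\<close>.\<close>

lemma shadow_trans:
  assumes "\<epsilon> > 0"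
  obtains \<delta> where "\<delta> > 0"
    "\<And>\<gamma> \<gamma>'. \<gamma> \<in> \<Gamma> \<Longrightarrow> \<gamma>' \<in> shadow \<epsilon> \<gamma> \<Longrightarrow> shadow \<epsilon> \<gamma>' \<subseteq> shadow \<delta> \<gamma>"
proof -
  have e2: "\<epsilon>/2 > 0" using assms by simp
  obtain \<Phi> where \<Phi>: "finite \<Phi>" "\<Phi> \<subseteq> \<Gamma>"
    "\<And>\<gamma> z. \<gamma> \<in> \<Gamma> \<Longrightarrow> \<gamma> \<notin> \<Phi> \<Longrightarrow> z \<in> X \<Longrightarrow> d z (Inl (inv \<gamma>)) > \<epsilon>/2 \<Longrightarrow> d (sum_act \<gamma> z) (Inl \<gamma>) < \<epsilon>/2"
    "\<And>\<gamma> z. \<gamma> \<in> \<Gamma> \<Longrightarrow> \<gamma> \<notin> \<Phi> \<Longrightarrow> z \<in> X \<Longrightarrow> d z (Inl \<gamma>) > \<epsilon>/2 \<Longrightarrow>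
      d (sum_act (inv \<gamma>) z) (Inl (inv \<gamma>)) < \<epsilon>/2"
    using contracting_outside_finite[OF e2] by metis
  obtain \<delta> where \<delta>: "\<delta> > 0" "\<And>\<gamma> \<phi>. \<gamma> \<in> \<Gamma> \<Longrightarrow> \<phi> \<in> \<Phi> \<Longrightarrow> shadow \<epsilon> (\<gamma> \<circ> \<phi>) \<subseteq> shadow \<delta> \<gamma>"
    using shadow_comp_finite[OF \<Phi>(1,2) assms] by metis
  show ?thesis
  proof (rule that[of "min \<delta> (\<epsilon>/2)"])
    fix \<gamma> \<gamma>' assume \<gamma>: "\<gamma> \<in> \<Gamma>" and \<gamma>': "\<gamma>' \<in> shadow \<epsilon> \<gamma>"
    then have \<gamma>'_in: "\<gamma>' \<in> \<Gamma>" by (simp add: shadow_def)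
    define \<omega> where "\<omega> = inv \<gamma> \<circ> \<gamma>'"
    have \<omega>: "\<omega> \<in> \<Gamma>" "\<gamma> \<circ> \<omega> = \<gamma>'" "inv \<omega> = inv \<gamma>' \<circ> \<gamma>"
      using \<gamma> \<gamma>'_in by (simp_all add: \<omega>_def inv_comp)
    show "shadow \<epsilon> \<gamma>' \<subseteq> shadow (min \<delta> (\<epsilon>/2)) \<gamma>"
    proof (cases "\<omega> \<in> \<Phi>")
      case True
      then have "shadow \<epsilon> \<gamma>' \<subseteq> shadow \<delta> \<gamma>" using \<delta>(2)[OF \<gamma> True] \<omega> by simp
      then show ?thesis using shadow_mono[of "min \<delta> (\<epsilon>/2)" \<delta> \<gamma>] by auto
    next
      case False
      have d1: "d (Inl \<omega>) (Inl (inv \<gamma>)) > \<epsilon>" using \<gamma>' by (simp add: shadow_def \<omega>_def)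
      have "d (sum_act (inv \<omega>) (Inl (inv \<gamma>))) (Inl (inv \<omega>)) < \<epsilon>/2"
        using \<Phi>(4)[OF \<omega>(1) False, of "Inl (inv \<gamma>)"] d1 commute[of "Inl \<omega>" "Inl (inv \<gamma>)"] \<gamma> assms
        by simp
      then have d2: "d (Inl (inv \<gamma>')) (Inl (inv \<omega>)) < \<epsilon>/2"
        using \<omega> \<gamma> by (simp add: comp_assoc)
      show ?thesis
      proof
        fix \<eta> assume \<eta>: "\<eta> \<in> shadow \<epsilon> \<gamma>'"
        define \<beta> where "\<beta> = inv \<gamma>' \<circ> \<eta>"
        have in_\<Gamma>: "\<eta> \<in> \<Gamma>" "\<beta> \<in> \<Gamma>" using \<eta> \<gamma>'_in by (auto simp: shadow_def \<beta>_def)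
        have d3: "d (Inl \<beta>) (Inl (inv \<gamma>')) > \<epsilon>" using \<eta> by (simp add: shadow_def \<beta>_def)
        have "d (Inl \<beta>) (Inl (inv \<omega>)) > \<epsilon>/2"
          using triangle[of "Inl \<beta>" "Inl (inv \<omega>)" "Inl (inv \<gamma>')"] d2 d3 in_\<Gamma> \<omega>(1) \<gamma>'_in
            commute[of "Inl (inv \<omega>)" "Inl (inv \<gamma>')"] by simp
        then have d4: "d (Inl (\<omega> \<circ> \<beta>)) (Inl \<omega>) < \<epsilon>/2"
          using \<Phi>(3)[OF \<omega>(1) False, of "Inl \<beta>"] in_\<Gamma> by simp
        have "d (Inl (\<omega> \<circ> \<beta>)) (Inl (inv \<gamma>)) > \<epsilon>/2"
          using triangle[of "Inl \<omega>" "Inl (\<omega> \<circ> \<beta>)" "Inl (inv \<gamma>)"] d1 d4 in_\<Gamma> \<omega>(1) \<gamma>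
            commute[of "Inl \<omega>" "Inl (\<omega> \<circ> \<beta>)"] by simp
        moreover have "\<omega> \<circ> \<beta> = inv \<gamma> \<circ> \<eta>"
          using \<gamma>'_in by (simp add: \<omega>_def \<beta>_def comp_assoc)
        ultimately show "\<eta> \<in> shadow (min \<delta> (\<epsilon>/2)) \<gamma>"
          using in_\<Gamma> by (simp add: shadow_def)
      qed
    qed
  qed (use \<delta>(1) assms in simp)
qed

text \<open>As for subtrees of a tree, when two shadows meet, one centre lies in the shadow of the
  other, up to finitely many relative positions. What decides is whether \<open>\<beta>\<close>, the
  point \<open>\<eta>\<close> seen from \<open>\<gamma>'\<close>, is far from the repelling point of
  \<open>\<omega>\<close>. If it is, \<open>\<omega>\<close> is near
  \<open>\<omega> \<circ> \<beta>\<close>; if not, \<open>inv \<omega>\<close> is near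
  \<open>\<beta>\<close>.\<close>

lemma shadow_cases:
  assumes "\<epsilon> > 0"
  obtains \<Phi> where "finite \<Phi>" "\<Phi> \<subseteq> \<Gamma>"
    "\<And>\<gamma> \<gamma>' \<eta>. \<gamma> \<in> \<Gamma> \<Longrightarrow> \<gamma>' \<in> \<Gamma> \<Longrightarrow> \<eta> \<in> shadow \<epsilon> \<gamma> \<Longrightarrow> \<eta> \<in> shadow \<epsilon> \<gamma>' \<Longrightarrow>
      inv \<gamma> \<circ> \<gamma>' \<in> \<Phi> \<or> \<gamma>' \<in> shadow (\<epsilon>/2) \<gamma> \<or> \<gamma> \<in> shadow (\<epsilon>/2) \<gamma>'"
proof -
  have e2: "\<epsilon>/2 > 0" using assms by simp
  obtain \<Phi> where \<Phi>: "finite \<Phi>" "\<Phi> \<subseteq> \<Gamma>"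
    "\<And>\<gamma> z. \<gamma> \<in> \<Gamma> \<Longrightarrow> \<gamma> \<notin> \<Phi> \<Longrightarrow> z \<in> X \<Longrightarrow> d z (Inl (inv \<gamma>)) > \<epsilon>/2 \<Longrightarrow> d (sum_act \<gamma> z) (Inl \<gamma>) < \<epsilon>/2"
    using contracting_outside_finite[OF e2] by metis
  show ?thesis
  proof (rule that[OF \<Phi>(1,2)])
    fix \<gamma> \<gamma>' \<eta> assume *: "\<gamma> \<in> \<Gamma>" "\<gamma>' \<in> \<Gamma>" "\<eta> \<in> shadow \<epsilon> \<gamma>" "\<eta> \<in> shadow \<epsilon> \<gamma>'"
    define \<omega> where "\<omega> = inv \<gamma> \<circ> \<gamma>'"
    define \<beta> where "\<beta> = inv \<gamma>' \<circ> \<eta>"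
    have in_\<Gamma>: "\<omega> \<in> \<Gamma>" "\<beta> \<in> \<Gamma>" "\<eta> \<in> \<Gamma>" using * by (auto simp: shadow_def \<omega>_def \<beta>_def)
    have \<omega>\<beta>: "\<omega> \<circ> \<beta> = inv \<gamma> \<circ> \<eta>" using * by (simp add: \<omega>_def \<beta>_def comp_assoc)
    have d1: "d (Inl (\<omega> \<circ> \<beta>)) (Inl (inv \<gamma>)) > \<epsilon>" using *(3) \<omega>\<beta> by (simp add: shadow_def)
    have d2: "d (Inl \<beta>) (Inl (inv \<gamma>')) > \<epsilon>" using *(4) by (simp add: shadow_def \<beta>_def)
    have inv_\<omega>: "inv \<omega> = inv \<gamma>' \<circ> \<gamma>" using * by (simp add: \<omega>_def inv_comp)
    have "\<gamma>' \<in> shadow (\<epsilon>/2) \<gamma> \<or> \<gamma> \<in> shadow (\<epsilon>/2) \<gamma>'" if "\<omega> \<notin> \<Phi>"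
    proof (cases "d (Inl \<beta>) (Inl (inv \<omega>)) > \<epsilon>/2")
      case True
      then have "d (Inl (\<omega> \<circ> \<beta>)) (Inl \<omega>) < \<epsilon>/2"
        using \<Phi>(3)[OF in_\<Gamma>(1) that, of "Inl \<beta>"] in_\<Gamma> by simp
      then have "d (Inl \<omega>) (Inl (inv \<gamma>)) > \<epsilon>/2"
        using triangle[of "Inl (\<omega> \<circ> \<beta>)" "Inl \<omega>" "Inl (inv \<gamma>)"] d1 in_\<Gamma> * by simp
      then show ?thesis using * by (simp add: shadow_def \<omega>_def)
    next
      case False
      then have "d (Inl (inv \<omega>)) (Inl (inv \<gamma>')) > \<epsilon>/2"
        using triangle[of "Inl \<beta>" "Inl (inv \<omega>)" "Inl (inv \<gamma>')"] d2 in_\<Gamma> * by simp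
      then show ?thesis using * inv_\<omega> by (simp add: shadow_def)
    qed
    then show "inv \<gamma> \<circ> \<gamma>' \<in> \<Phi> \<or> \<gamma>' \<in> shadow (\<epsilon>/2) \<gamma> \<or> \<gamma> \<in> shadow (\<epsilon>/2) \<gamma>'"
      by (auto simp: \<omega>_def)
  qed
qed

end

section \<open>Magnitudes\<close>

lemma finite_superlevel_summable:
  fixes f :: "'a \<Rightarrow> real"
  assumes "f summable_on A" "\<And>x. x \<in> A \<Longrightarrow> 0 \<le> f x" "c > 0"
  shows "finite {x\<in>A. c \<le> f x}"
proof (rule ccontr)
  assume inf: "infinite {x\<in>A. c \<le> f x}"
  obtain k :: nat where k: "real k * c > infsum f A"
    using assms(3) reals_Archimedean3 by blast
  obtain B where B: "B \<subseteq> {x\<in>A. c \<le> f x}" "finite B" "card B = k"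
    using infinite_arbitrarily_large[OF inf] by blast
  have "real k * c = (\<Sum>x\<in>B. c)" using B by simp
  also have "\<dots> \<le> sum f B" using B by (intro sum_mono) auto
  also have "\<dots> \<le> infsum f A"
    using assms B by (intro finite_sum_le_infsum) auto
  finally show False using k by simp
qed

text \<open>A convergent series has only finitely many terms above a positive bound. Properness of
  the magnitudes is obtained from this.\<close>

lemma finite_sublevel_summable_exp:
  assumes "(\<lambda>\<gamma>. exp (- s * m \<gamma>)) summable_on A" "s > 0"
  shows "finite {\<gamma>\<in>A. m \<gamma> \<le> (K::real)}"
proof -
  have "{\<gamma>\<in>A. m \<gamma> \<le> K} \<subseteq> {\<gamma>\<in>A. exp (- s * K) \<le> exp (- s * m \<gamma>)}"
    using assms(2) by auto
  moreover have "finite {\<gamma>\<in>A. exp (- s * K) \<le> exp (- s * m \<gamma>)}"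
    by (rule finite_superlevel_summable[OF assms(1)]) auto
  ultimately show ?thesis by (rule finite_subset)
qed

lemma eventually_notin_of_inj:
  fixes g :: "nat \<Rightarrow> 'a"
  assumes "inj g" "finite S"
  shows "\<forall>\<^sub>F n in sequentially. g n \<notin> S"
proof -
  have "finite (g -` S)" using assms by (simp add: finite_vimageI)
  then obtain N where "\<forall>n\<in>g -` S. n < N" using finite_nat_set_iff_bounded by blast
  then show ?thesis unfolding eventually_sequentially by (metis not_less vimageI)
qed

lemma loc_unif_const_pointwise:
  assumes "loc_unif_const euclidean f y x" "z \<noteq> y"
  shows "(\<lambda>n. f n z) \<longlonglongrightarrow> x"
proof (rule topological_tendstoI)
  fix V assume V: "open V" "x \<in> V"
  obtain U where "z \<in> U" "\<forall>V. open V \<and> x \<in> V \<longrightarrow> (\<forall>\<^sub>F n in sequentially. f n ` U \<subseteq> V)"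
    using assms unfolding loc_unif_const_def by auto
  with V have "\<forall>\<^sub>F n in sequentially. f n ` U \<subseteq> V" by blast
  then show "\<forall>\<^sub>F n in sequentially. f n z \<in> V"
    by eventually_elim (use \<open>z \<in> U\<close> in auto)
qed

lemma nonelementary_limit_point:
  assumes "nonelementary \<Gamma>"
  obtains b where "b \<in> limit_set \<Gamma>" "b \<noteq> x" "b \<noteq> y"
proof -
  have "\<not> limit_set \<Gamma> \<subseteq> {x, y}"
  proof
    assume "limit_set \<Gamma> \<subseteq> {x, y}"
    then have "finite (limit_set \<Gamma>)" "card (limit_set \<Gamma>) \<le> card {x, y}"
      by (auto intro: finite_subset card_mono)
    moreover have "card {x, y} \<le> 2" by (simp add: card_insert_if)
    ultimately show False using assms by (auto simp: nonelementary_def)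
  qed
  then show ?thesis using that by blast
qed

context convergence_compactification
begin

text \<open>Each of \<open>a\<close> and \<open>b\<close> is within \<open>e\<close> of at most one
  of three points at mutual distance at least \<open>3 * e\<close>. Taking the points from a finite
  \<open>P\<close> also bounds \<open>\<sigma> \<phi> x\<close> over \<open>x \<in> P\<close> for
  fixed \<open>\<phi>\<close>.\<close>

lemma avoid_two:
  obtains P :: "'m set" and e where "finite P" "e > 0"
    "\<And>a b. a \<in> X \<Longrightarrow> b \<in> X \<Longrightarrow> \<exists>x\<in>P. d (Inr x) a > e \<and> d (Inr x) b > e"
proof -
  obtain p q r :: 'm where pqr: "p \<noteq> q" "p \<noteq> r" "q \<noteq> r" using three_points by blast
  have pos: "d (Inr p) (Inr q) > 0" "d (Inr p) (Inr r) > 0" "d (Inr q) (Inr r) > 0"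
    using pqr by (simp_all add: mdist_pos_less)
  define e where "e = Min {d (Inr p) (Inr q), d (Inr p) (Inr r), d (Inr q) (Inr r)} / 3"
  have e: "e > 0" "d (Inr p) (Inr q) \<ge> 3 * e" "d (Inr p) (Inr r) \<ge> 3 * e" "d (Inr q) (Inr r) \<ge> 3 * e"
    using pos by (auto simp: e_def)
  show ?thesis
  proof (rule that[of "{p, q, r}" e])
    fix a b assume ab: "a \<in> X" "b \<in> X"
    have *: "d (Inr x) c > e \<or> d (Inr y) c > e"
      if "d (Inr x) (Inr y) \<ge> 3 * e" "c \<in> X" for x y c
      using triangle[of "Inr x" c "Inr y"] commute[of "Inr y" c] that e(1) by auto
    show "\<exists>x\<in>{p, q, r}. d (Inr x) a > e \<and> d (Inr x) b > e"
      using *[OF e(2) ab(1)] *[OF e(2) ab(2)] *[OF e(3) ab(1)] *[OF e(3) ab(2)]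
        *[OF e(4) ab(1)] *[OF e(4) ab(2)] by blast
  qed (use e in auto)
qed

section \<open>Rough additivity of magnitudes\<close>

definition quasi_cocycle :: "real \<Rightarrow> (('m \<Rightarrow> 'm) \<Rightarrow> 'm \<Rightarrow> real) \<Rightarrow> bool" where
  "quasi_cocycle \<kappa> \<sigma> \<longleftrightarrow>
     (\<forall>\<gamma>\<in>\<Gamma>. \<forall>\<eta>\<in>\<Gamma>. \<forall>x. \<bar>\<sigma> (\<gamma> \<circ> \<eta>) x - (\<sigma> \<gamma> (\<eta> x) + \<sigma> \<eta> x)\<bar> \<le> \<kappa>)"

text \<open>The form in which magnitudes enter the estimates over shadows. It passes to linear
  combinations and so covers the difference \<open>m0 - m1\<close>, which need not be the magnitude
  of an expanding cocycle.\<close>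

definition roughly_additive :: "(('m \<Rightarrow> 'm) \<Rightarrow> real) \<Rightarrow> bool" where
  "roughly_additive m \<longleftrightarrow>
     (\<forall>\<epsilon>>0. \<exists>C. \<forall>\<gamma>\<in>\<Gamma>. \<forall>\<eta>\<in>\<Gamma>. d (Inl \<eta>) (Inl (inv \<gamma>)) > \<epsilon> \<longrightarrow>
        \<bar>m (\<gamma> \<circ> \<eta>) - m \<gamma> - m \<eta>\<bar> \<le> C) \<and>
     (\<forall>\<phi>\<in>\<Gamma>. \<exists>C. \<forall>\<gamma>\<in>\<Gamma>. \<bar>m (\<gamma> \<circ> \<phi>) - m \<gamma>\<bar> \<le> C)"

lemma expanding_quasi_cocycle:
  assumes "expanding \<Gamma> d \<sigma>"
  obtains \<kappa> where "quasi_cocycle \<kappa> \<sigma>"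
  using assms unfolding expanding_def coarse_cocycle_def coarse_cocycle_const_def quasi_cocycle_def
  by blast

lemma magnitudeD:
  assumes "magnitude \<Gamma> d \<sigma> m" "\<epsilon> > 0"
  obtains C where "C > 0"
    "\<And>\<gamma> x. \<gamma> \<in> \<Gamma> \<Longrightarrow> d (Inr x) (Inl (inv \<gamma>)) > \<epsilon> \<Longrightarrow> \<bar>\<sigma> \<gamma> x - m \<gamma>\<bar> \<le> C"
proof -
  obtain C where C: "C > 0" "\<forall>\<gamma>\<in>\<Gamma>. \<forall>x. d (Inr x) (Inl (inv \<gamma>)) > \<epsilon> \<longrightarrow>
        m \<gamma> - C \<le> \<sigma> \<gamma> x \<and> \<sigma> \<gamma> x \<le> m \<gamma> + C"
    using assms unfolding magnitude_def by blast
  show ?thesis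
  proof (rule that[OF C(1)])
    fix \<gamma> x assume "\<gamma> \<in> \<Gamma>" "d (Inr x) (Inl (inv \<gamma>)) > \<epsilon>"
    with C(2) have "m \<gamma> - C \<le> \<sigma> \<gamma> x \<and> \<sigma> \<gamma> x \<le> m \<gamma> + C" by blast
    then show "\<bar>\<sigma> \<gamma> x - m \<gamma>\<bar> \<le> C" by linarith
  qed
qed

lemma magnitude_unique_up_to_bounded:
  assumes "magnitude \<Gamma> d \<sigma> m" "magnitude \<Gamma> d \<sigma> m'"
  obtains C where "\<And>\<gamma>. \<gamma> \<in> \<Gamma> \<Longrightarrow> \<bar>m \<gamma> - m' \<gamma>\<bar> \<le> C"
proof -
  obtain P :: "'m set" and e where P: "finite P" "e > 0"
    "\<And>a b. a \<in> X \<Longrightarrow> b \<in> X \<Longrightarrow> \<exists>x\<in>P. d (Inr x) a > e \<and> d (Inr x) b > e"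
    using avoid_two by metis
  obtain C1 where C1: "\<And>\<gamma> x. \<gamma> \<in> \<Gamma> \<Longrightarrow> d (Inr x) (Inl (inv \<gamma>)) > e \<Longrightarrow> \<bar>\<sigma> \<gamma> x - m \<gamma>\<bar> \<le> C1"
    using magnitudeD[OF assms(1) P(2)] by metis
  obtain C2 where C2: "\<And>\<gamma> x. \<gamma> \<in> \<Gamma> \<Longrightarrow> d (Inr x) (Inl (inv \<gamma>)) > e \<Longrightarrow> \<bar>\<sigma> \<gamma> x - m' \<gamma>\<bar> \<le> C2"
    using magnitudeD[OF assms(2) P(2)] by metis
  show ?thesis
  proof (rule that[of "C1 + C2"])
    fix \<gamma> assume \<gamma>: "\<gamma> \<in> \<Gamma>"
    then obtain x where "d (Inr x) (Inl (inv \<gamma>)) > e"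
      using P(3)[of "Inl (inv \<gamma>)" "Inl (inv \<gamma>)"] by auto
    from C1[OF \<gamma> this] C2[OF \<gamma> this] show "\<bar>m \<gamma> - m' \<gamma>\<bar> \<le> C1 + C2" by linarith
  qed
qed

text \<open>The cocycle identity is evaluated at a point \<open>x\<close> of a finite set, far from
  \<open>inv (\<gamma> \<circ> \<phi>)\<close>. Since \<open>\<phi>\<close> maps
  \<open>inv (\<gamma> \<circ> \<phi>)\<close> to \<open>inv \<gamma>\<close>, the point
  \<open>\<phi> x\<close> is far from \<open>inv \<gamma>\<close>, and both cocycle values at stake
  are close to magnitudes.\<close>

lemma magnitude_shift:
  assumes coc: "quasi_cocycle \<kappa> \<sigma>" and mag: "magnitude \<Gamma> d \<sigma> m" and \<phi>: "\<phi> \<in> \<Gamma>"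
  shows "\<exists>C. \<forall>\<gamma>\<in>\<Gamma>. \<bar>m (\<gamma> \<circ> \<phi>) - m \<gamma>\<bar> \<le> C"
proof -
  obtain P :: "'m set" and e where P: "finite P" "e > 0"
    "\<And>a b. a \<in> X \<Longrightarrow> b \<in> X \<Longrightarrow> \<exists>x\<in>P. d (Inr x) a > e \<and> d (Inr x) b > e"
    using avoid_two by metis
  obtain \<delta> where \<delta>: "\<delta> > 0" "\<forall>p\<in>X. \<forall>q\<in>X. d p q > e \<longrightarrow> d (sum_act \<phi> p) (sum_act \<phi> q) > \<delta>"
    using uniformly_separating[OF \<phi> P(2)] by blast
  obtain C1 where C1: "\<And>\<gamma> x. \<gamma> \<in> \<Gamma> \<Longrightarrow> d (Inr x) (Inl (inv \<gamma>)) > e \<Longrightarrow> \<bar>\<sigma> \<gamma> x - m \<gamma>\<bar> \<le> C1"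
    using magnitudeD[OF mag P(2)] by metis
  obtain C2 where C2: "\<And>\<gamma> x. \<gamma> \<in> \<Gamma> \<Longrightarrow> d (Inr x) (Inl (inv \<gamma>)) > \<delta> \<Longrightarrow> \<bar>\<sigma> \<gamma> x - m \<gamma>\<bar> \<le> C2"
    using magnitudeD[OF mag \<delta>(1)] by metis
  define B where "B = (\<Sum>x\<in>P. \<bar>\<sigma> \<phi> x\<bar>)"
  have B: "\<bar>\<sigma> \<phi> x\<bar> \<le> B" if "x \<in> P" for x
    unfolding B_def using that P(1) by (intro member_le_sum) auto
  show ?thesis
  proof (intro exI ballI)
    fix \<gamma> assume \<gamma>: "\<gamma> \<in> \<Gamma>"
    obtain x where x: "x \<in> P" "d (Inr x) (Inl (inv (\<gamma> \<circ> \<phi>))) > e"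
      using P(3)[of "Inl (inv (\<gamma> \<circ> \<phi>))" "Inl (inv (\<gamma> \<circ> \<phi>))"] \<gamma> \<phi> by auto
    have "d (sum_act \<phi> (Inr x)) (sum_act \<phi> (Inl (inv (\<gamma> \<circ> \<phi>)))) > \<delta>"
      using \<delta>(2)[rule_format, of "Inr x" "Inl (inv (\<gamma> \<circ> \<phi>))"] x(2) \<gamma> \<phi> by simp
    then have "d (Inr (\<phi> x)) (Inl (inv \<gamma>)) > \<delta>"
      using \<gamma> \<phi> by (simp add: inv_comp)
    then have "\<bar>\<sigma> \<gamma> (\<phi> x) - m \<gamma>\<bar> \<le> C2" by (rule C2[OF \<gamma>])
    moreover have "\<bar>\<sigma> (\<gamma> \<circ> \<phi>) x - m (\<gamma> \<circ> \<phi>)\<bar> \<le> C1"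
      using C1[OF comp_in[OF \<gamma> \<phi>] x(2)] .
    moreover have "\<bar>\<sigma> (\<gamma> \<circ> \<phi>) x - (\<sigma> \<gamma> (\<phi> x) + \<sigma> \<phi> x)\<bar> \<le> \<kappa>"
      using coc \<gamma> \<phi> unfolding quasi_cocycle_def by blast
    ultimately show "\<bar>m (\<gamma> \<circ> \<phi>) - m \<gamma>\<bar> \<le> C1 + C2 + B + \<kappa>"
      using B[OF x(1)] by linarith
  qed
qed

text \<open>The cocycle identity is evaluated at a point \<open>x\<close> far from both
  \<open>inv \<eta>\<close> and \<open>inv (\<gamma> \<circ> \<eta>)\<close>. If
  \<open>\<eta>\<close> contracts, \<open>\<eta> x\<close> is near \<open>\<eta>\<close> and hence
  far from \<open>inv \<gamma>\<close>, so all three cocycle values are close to magnitudes. The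
  finitely many other \<open>\<eta>\<close> are handled as fixed right translations.\<close>

lemma magnitude_roughly_additive:
  assumes coc: "quasi_cocycle \<kappa> \<sigma>" and mag: "magnitude \<Gamma> d \<sigma> m"
  shows "roughly_additive m"
  unfolding roughly_additive_def
proof (intro conjI allI impI ballI)
  show "\<exists>C. \<forall>\<gamma>\<in>\<Gamma>. \<bar>m (\<gamma> \<circ> \<phi>) - m \<gamma>\<bar> \<le> C" if "\<phi> \<in> \<Gamma>" for \<phi>
    using magnitude_shift[OF coc mag that] .
next
  fix \<epsilon> :: real assume "\<epsilon> > 0"
  obtain P :: "'m set" and e where P: "finite P" "e > 0"
    "\<And>a b. a \<in> X \<Longrightarrow> b \<in> X \<Longrightarrow> \<exists>x\<in>P. d (Inr x) a > e \<and> d (Inr x) b > e"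
    using avoid_two by metis
  \<comment> \<open>\<open>e2 \<le> e\<close> makes the contraction of \<open>\<eta>\<close>
    available at \<open>x\<close>; \<open>e2 \<le> \<epsilon>/2\<close> keeps
    \<open>\<eta> x\<close> at distance more than \<open>e2/2\<close> from
    \<open>inv \<gamma>\<close>.\<close>
  define e2 where "e2 = min (\<epsilon>/2) e"
  have e2: "e2 > 0" "e2 \<le> \<epsilon>/2" "e2 \<le> e" using \<open>\<epsilon> > 0\<close> P(2) by (auto simp: e2_def)
  obtain C1 where C1: "\<And>\<gamma> x. \<gamma> \<in> \<Gamma> \<Longrightarrow> d (Inr x) (Inl (inv \<gamma>)) > e2/2 \<Longrightarrow> \<bar>\<sigma> \<gamma> x - m \<gamma>\<bar> \<le> C1"
    using magnitudeD[OF mag, of "e2/2"] e2(1) by (metis half_gt_zero)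
  obtain \<Phi> where \<Phi>: "finite \<Phi>" "\<Phi> \<subseteq> \<Gamma>"
    "\<And>\<gamma> z. \<gamma> \<in> \<Gamma> \<Longrightarrow> \<gamma> \<notin> \<Phi> \<Longrightarrow> z \<in> X \<Longrightarrow> d z (Inl (inv \<gamma>)) > e2 \<Longrightarrow> d (sum_act \<gamma> z) (Inl \<gamma>) < e2"
    using contracting_outside_finite[OF e2(1)] by metis
  have "\<forall>\<phi>\<in>\<Phi>. \<exists>C. \<forall>\<gamma>\<in>\<Gamma>. \<bar>m (\<gamma> \<circ> \<phi>) - m \<gamma>\<bar> \<le> C"
    using magnitude_shift[OF coc mag] \<Phi>(2) by blast
  then obtain c where c: "\<And>\<phi> \<gamma>. \<phi> \<in> \<Phi> \<Longrightarrow> \<gamma> \<in> \<Gamma> \<Longrightarrow> \<bar>m (\<gamma> \<circ> \<phi>) - m \<gamma>\<bar> \<le> c \<phi>" by metis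
  define B where "B = (\<Sum>\<phi>\<in>\<Phi>. \<bar>c \<phi>\<bar> + \<bar>m \<phi>\<bar>)"
  have B: "\<bar>c \<phi>\<bar> + \<bar>m \<phi>\<bar> \<le> B" if "\<phi> \<in> \<Phi>" for \<phi>
    unfolding B_def using that \<Phi>(1) by (intro member_le_sum) auto
  have "\<bar>m (\<gamma> \<circ> \<eta>) - m \<gamma> - m \<eta>\<bar> \<le> \<bar>B\<bar> + \<bar>3 * C1 + \<kappa>\<bar>"
    if \<gamma>: "\<gamma> \<in> \<Gamma>" and \<eta>: "\<eta> \<in> \<Gamma>" and sep: "d (Inl \<eta>) (Inl (inv \<gamma>)) > \<epsilon>" for \<gamma> \<eta>
  proof (cases "\<eta> \<in> \<Phi>")
    case True
    from c[OF True \<gamma>] B[OF True] show ?thesis by linarith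
  next
    case False
    obtain x where x: "d (Inr x) (Inl (inv \<eta>)) > e" "d (Inr x) (Inl (inv (\<gamma> \<circ> \<eta>))) > e"
      using P(3)[of "Inl (inv \<eta>)" "Inl (inv (\<gamma> \<circ> \<eta>))"] \<gamma> \<eta> by auto
    have "d (sum_act \<eta> (Inr x)) (Inl \<eta>) < e2"
      using \<Phi>(3)[OF \<eta> False, of "Inr x"] x e2 by auto
    then have "d (Inr (\<eta> x)) (Inl (inv \<gamma>)) > e2/2"
      using triangle[of "Inl \<eta>" "Inr (\<eta> x)" "Inl (inv \<gamma>)"] sep e2 \<gamma> \<eta>
        commute[of "Inl \<eta>" "Inr (\<eta> x)"] by simp
    then have "\<bar>\<sigma> \<gamma> (\<eta> x) - m \<gamma>\<bar> \<le> C1" by (rule C1[OF \<gamma>])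
    moreover have "\<bar>\<sigma> \<eta> x - m \<eta>\<bar> \<le> C1" using x e2 by (intro C1[OF \<eta>]) linarith
    moreover have "\<bar>\<sigma> (\<gamma> \<circ> \<eta>) x - m (\<gamma> \<circ> \<eta>)\<bar> \<le> C1"
      using x e2 \<gamma> \<eta> by (intro C1) (simp, linarith)
    moreover have "\<bar>\<sigma> (\<gamma> \<circ> \<eta>) x - (\<sigma> \<gamma> (\<eta> x) + \<sigma> \<eta> x)\<bar> \<le> \<kappa>"
      using coc \<gamma> \<eta> by (simp add: quasi_cocycle_def)
    ultimately show ?thesis by linarith
  qed
  then show "\<exists>C. \<forall>\<gamma>\<in>\<Gamma>. \<forall>\<eta>\<in>\<Gamma>. d (Inl \<eta>) (Inl (inv \<gamma>)) > \<epsilon> \<longrightarrow> \<bar>m (\<gamma> \<circ> \<eta>) - m \<gamma> - m \<eta>\<bar> \<le> C"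
    by blast
qed

lemma roughly_additive_comp:
  assumes "roughly_additive m" "\<epsilon> > 0"
  obtains C where "\<And>\<gamma> \<eta>. \<gamma> \<in> \<Gamma> \<Longrightarrow> \<eta> \<in> \<Gamma> \<Longrightarrow> d (Inl \<eta>) (Inl (inv \<gamma>)) > \<epsilon> \<Longrightarrow>
    \<bar>m (\<gamma> \<circ> \<eta>) - m \<gamma> - m \<eta>\<bar> \<le> C"
  using assms unfolding roughly_additive_def by metis

lemma roughly_additive_shadow:
  assumes "roughly_additive m" "\<epsilon> > 0"
  obtains C where "\<And>\<gamma> \<eta>. \<gamma> \<in> \<Gamma> \<Longrightarrow> \<eta> \<in> shadow \<epsilon> \<gamma> \<Longrightarrow> \<bar>m \<eta> - m \<gamma> - m (inv \<gamma> \<circ> \<eta>)\<bar> \<le> C"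
proof -
  obtain C where C: "\<And>\<gamma> \<eta>. \<gamma> \<in> \<Gamma> \<Longrightarrow> \<eta> \<in> \<Gamma> \<Longrightarrow> d (Inl \<eta>) (Inl (inv \<gamma>)) > \<epsilon> \<Longrightarrow>
    \<bar>m (\<gamma> \<circ> \<eta>) - m \<gamma> - m \<eta>\<bar> \<le> C"
    using roughly_additive_comp[OF assms] by metis
  show ?thesis
  proof (rule that[of C])
    fix \<gamma> \<eta> assume "\<gamma> \<in> \<Gamma>" "\<eta> \<in> shadow \<epsilon> \<gamma>"
    then show "\<bar>m \<eta> - m \<gamma> - m (inv \<gamma> \<circ> \<eta>)\<bar> \<le> C"
      using C[of \<gamma> "inv \<gamma> \<circ> \<eta>"] by (simp add: shadow_def)
  qed
qed

lemma roughly_additive_right: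
  assumes "roughly_additive m" "finite \<Phi>" "\<Phi> \<subseteq> \<Gamma>"
  obtains C where "\<And>\<gamma> \<phi>. \<gamma> \<in> \<Gamma> \<Longrightarrow> \<phi> \<in> \<Phi> \<Longrightarrow> \<bar>m (\<gamma> \<circ> \<phi>) - m \<gamma>\<bar> \<le> C"
proof -
  have "\<forall>\<phi>\<in>\<Phi>. \<exists>C. \<forall>\<gamma>\<in>\<Gamma>. \<bar>m (\<gamma> \<circ> \<phi>) - m \<gamma>\<bar> \<le> C"
    using assms unfolding roughly_additive_def by blast
  then obtain c where c: "\<And>\<phi> \<gamma>. \<phi> \<in> \<Phi> \<Longrightarrow> \<gamma> \<in> \<Gamma> \<Longrightarrow> \<bar>m (\<gamma> \<circ> \<phi>) - m \<gamma>\<bar> \<le> c \<phi>" by metis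
  show ?thesis
  proof (rule that[of "\<Sum>\<phi>\<in>\<Phi>. \<bar>c \<phi>\<bar>"])
    fix \<gamma> \<phi> assume *: "\<gamma> \<in> \<Gamma>" "\<phi> \<in> \<Phi>"
    have "\<bar>c \<phi>\<bar> \<le> (\<Sum>\<phi>\<in>\<Phi>. \<bar>c \<phi>\<bar>)"
      using * assms(2) by (intro member_le_sum) auto
    with c[OF *(2,1)] show "\<bar>m (\<gamma> \<circ> \<phi>) - m \<gamma>\<bar> \<le> (\<Sum>\<phi>\<in>\<Phi>. \<bar>c \<phi>\<bar>)" by linarith
  qed
qed

text \<open>Left translation by a fixed \<open>\<phi>\<close> is aligned because \<open>inv \<phi>\<close> is an isolated point of the
  compactification.\<close>

lemma roughly_additive_left:
  assumes "roughly_additive m" "finite \<Phi>" "\<Phi> \<subseteq> \<Gamma>"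
  obtains C where "\<And>\<gamma> \<phi>. \<gamma> \<in> \<Gamma> \<Longrightarrow> \<phi> \<in> \<Phi> \<Longrightarrow> \<bar>m (\<phi> \<circ> \<gamma>) - m \<gamma>\<bar> \<le> C"
proof -
  have "\<exists>C. \<forall>\<gamma>\<in>\<Gamma>. \<bar>m (\<phi> \<circ> \<gamma>) - m \<gamma>\<bar> \<le> C" if "\<phi> \<in> \<Phi>" for \<phi>
  proof -
    have \<phi>: "\<phi> \<in> \<Gamma>" using that assms(3) by blast
    then have "inv \<phi> \<in> \<Gamma>" by simp
    then obtain \<epsilon> where \<epsilon>: "\<epsilon> > 0" "\<And>p. p \<in> X \<Longrightarrow> p \<noteq> Inl (inv \<phi>) \<Longrightarrow> d (Inl (inv \<phi>)) p > \<epsilon>"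
      using isolated_Inl by metis
    obtain C where C: "\<And>\<gamma> \<eta>. \<gamma> \<in> \<Gamma> \<Longrightarrow> \<eta> \<in> \<Gamma> \<Longrightarrow> d (Inl \<eta>) (Inl (inv \<gamma>)) > \<epsilon> \<Longrightarrow>
      \<bar>m (\<gamma> \<circ> \<eta>) - m \<gamma> - m \<eta>\<bar> \<le> C"
      using roughly_additive_comp[OF assms(1) \<epsilon>(1)] by metis
    have "\<bar>m (\<phi> \<circ> \<gamma>) - m \<gamma>\<bar> \<le> \<bar>C\<bar> + \<bar>m \<phi>\<bar> + \<bar>m id - m (inv \<phi>)\<bar>" if \<gamma>: "\<gamma> \<in> \<Gamma>" for \<gamma>
    proof (cases "\<gamma> = inv \<phi>")
      case True
      then show ?thesis using \<phi> by simp
    next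
      case False
      then have "d (Inl \<gamma>) (Inl (inv \<phi>)) > \<epsilon>"
        using \<epsilon>(2)[of "Inl \<gamma>"] \<gamma> commute by simp
      from C[OF \<phi> \<gamma> this] show ?thesis by linarith
    qed
    then show ?thesis by blast
  qed
  then obtain c where c: "\<And>\<phi> \<gamma>. \<phi> \<in> \<Phi> \<Longrightarrow> \<gamma> \<in> \<Gamma> \<Longrightarrow> \<bar>m (\<phi> \<circ> \<gamma>) - m \<gamma>\<bar> \<le> c \<phi>" by metis
  show ?thesis
  proof (rule that[of "\<Sum>\<phi>\<in>\<Phi>. \<bar>c \<phi>\<bar>"])
    fix \<gamma> \<phi> assume *: "\<gamma> \<in> \<Gamma>" "\<phi> \<in> \<Phi>"
    have "\<bar>c \<phi>\<bar> \<le> (\<Sum>\<phi>\<in>\<Phi>. \<bar>c \<phi>\<bar>)"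
      using * assms(2) by (intro member_le_sum) auto
    with c[OF *(2,1)] show "\<bar>m (\<phi> \<circ> \<gamma>) - m \<gamma>\<bar> \<le> (\<Sum>\<phi>\<in>\<Phi>. \<bar>c \<phi>\<bar>)" by linarith
  qed
qed

lemma roughly_additive_lincomb:
  assumes "roughly_additive m" "roughly_additive m'"
  shows "roughly_additive (\<lambda>\<gamma>. a * m \<gamma> + b * m' \<gamma>)"
proof -
  have lin: "\<bar>(a * x + b * x') - (a * y + b * y') - (a * z + b * z')\<bar> \<le> \<bar>a\<bar> * C + \<bar>b\<bar> * C'"
    if "\<bar>x - y - z\<bar> \<le> C" "\<bar>x' - y' - z'\<bar> \<le> C'" for x y z x' y' z' C C' :: real
  proof -
    have "\<bar>a * (x - y - z) + b * (x' - y' - z')\<bar> \<le> \<bar>a\<bar> * \<bar>x - y - z\<bar> + \<bar>b\<bar> * \<bar>x' - y' - z'\<bar>"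
      by (metis abs_mult abs_triangle_ineq)
    also have "\<dots> \<le> \<bar>a\<bar> * C + \<bar>b\<bar> * C'"
      using that by (intro add_mono mult_left_mono) auto
    finally show ?thesis by (simp add: algebra_simps)
  qed
  show ?thesis
    unfolding roughly_additive_def
  proof (intro conjI allI impI ballI)
    fix \<epsilon> :: real assume "\<epsilon> > 0"
    then obtain C C' where
      "\<And>\<gamma> \<eta>. \<gamma> \<in> \<Gamma> \<Longrightarrow> \<eta> \<in> \<Gamma> \<Longrightarrow> d (Inl \<eta>) (Inl (inv \<gamma>)) > \<epsilon> \<Longrightarrow> \<bar>m (\<gamma> \<circ> \<eta>) - m \<gamma> - m \<eta>\<bar> \<le> C"
      "\<And>\<gamma> \<eta>. \<gamma> \<in> \<Gamma> \<Longrightarrow> \<eta> \<in> \<Gamma> \<Longrightarrow> d (Inl \<eta>) (Inl (inv \<gamma>)) > \<epsilon> \<Longrightarrow> \<bar>m' (\<gamma> \<circ> \<eta>) - m' \<gamma> - m' \<eta>\<bar> \<le> C'"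
      using assms roughly_additive_comp by metis
    then show "\<exists>C. \<forall>\<gamma>\<in>\<Gamma>. \<forall>\<eta>\<in>\<Gamma>. d (Inl \<eta>) (Inl (inv \<gamma>)) > \<epsilon> \<longrightarrow>
        \<bar>a * m (\<gamma> \<circ> \<eta>) + b * m' (\<gamma> \<circ> \<eta>) - (a * m \<gamma> + b * m' \<gamma>) - (a * m \<eta> + b * m' \<eta>)\<bar> \<le> C"
      using lin by blast
  next
    fix \<phi> assume "\<phi> \<in> \<Gamma>"
    then obtain C C' where C: "\<And>\<gamma>. \<gamma> \<in> \<Gamma> \<Longrightarrow> \<bar>m (\<gamma> \<circ> \<phi>) - m \<gamma>\<bar> \<le> C"
      "\<And>\<gamma>. \<gamma> \<in> \<Gamma> \<Longrightarrow> \<bar>m' (\<gamma> \<circ> \<phi>) - m' \<gamma>\<bar> \<le> C'"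
      using assms unfolding roughly_additive_def by metis
    show "\<exists>C. \<forall>\<gamma>\<in>\<Gamma>. \<bar>a * m (\<gamma> \<circ> \<phi>) + b * m' (\<gamma> \<circ> \<phi>) - (a * m \<gamma> + b * m' \<gamma>)\<bar> \<le> C"
      using lin[of "m (_ \<circ> \<phi>)" "m _" 0 C "m' (_ \<circ> \<phi>)" "m' _" 0 C'] C
      by (intro exI[of _ "\<bar>a\<bar> * C + \<bar>b\<bar> * C'"]) simp
  qed
qed

section \<open>Absence of global fixed points\<close>

lemma funpow_in: "\<gamma> \<in> \<Gamma> \<Longrightarrow> \<gamma> ^^ n \<in> \<Gamma>"
  by (induction n) (auto simp: comp_in[unfolded comp_def] simp del: comp_apply)

text \<open>A common fixed point other than the repelling limit \<open>y\<close> is its own limit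
  and so equals the attracting limit \<open>x\<close>.\<close>

lemma no_three_fixed_points:
  fixes g :: "nat \<Rightarrow> 'm \<Rightarrow> 'm"
  assumes "inj g" "\<And>n. g n \<in> \<Gamma>" "\<And>n. g n a = a" "\<And>n. g n b = b" "\<And>n. g n c = c"
  shows "a = b \<or> a = c \<or> b = c"
proof -
  obtain x y r where r: "strict_mono r" "converges (\<lambda>n. Inl (g (r n))) (Inr x)"
    "converges (\<lambda>n. Inl (inv (g (r n)))) (Inr y)"
    and conv: "\<And>s z p. strict_mono s \<Longrightarrow> converges z p \<Longrightarrow> p \<noteq> Inr y \<Longrightarrow>
      converges (\<lambda>n. sum_act (g (r (s n))) (z n)) (Inr x)"
    by (rule convergence_sequence[OF assms(1,2)]) (rule that; assumption)
  have "w = x" if "w \<noteq> y" "\<And>n. g n w = w" for w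
  proof -
    have "converges (\<lambda>n. sum_act (g (r n)) (Inr w)) (Inr x)"
      using conv[of "\<lambda>n. n", OF _ converges_const, of "Inr w"] that by (simp add: strict_mono_def)
    then have "converges (\<lambda>n. Inr w) (Inr x)" using that(2) by simp
    from converges_unique[OF this converges_const] show ?thesis by simp
  qed
  then show ?thesis using assms(3-5) by metis
qed

text \<open>If \<open>p\<close> is fixed by \<open>\<Gamma>\<close>, then \<open>\<lambda>\<gamma>. \<sigma> \<gamma> p\<close> is a quasi-homomorphism. It is bounded on the
  conjugates of \<open>f\<close> by the powers of an element \<open>\<gamma>\<close> repelling from \<open>p\<close>. If these conjugates
  were distinct, they would have to converge to \<open>p\<close> away from \<open>p\<close>, which is not so near the
  attracting point \<open>x\<close> of \<open>\<gamma>\<close>. Hence \<open>f\<close> commutes with a power of \<open>\<gamma>\<close> and fixes \<open>x\<close>. As \<open>f\<close>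
  is arbitrary, the limit set is contained in \<open>{p, x}\<close>.\<close>

lemma no_global_fixed_point:
  assumes ne: "nonelementary \<Gamma>" and coc: "quasi_cocycle \<kappa> \<sigma>" and mag: "magnitude \<Gamma> d \<sigma> m"
    and proper: "\<And>K. finite {\<gamma>\<in>\<Gamma>. m \<gamma> \<le> K}"
  shows "\<exists>\<gamma>\<in>\<Gamma>. \<gamma> p \<noteq> p"
proof (rule ccontr)
  assume "\<not> ?thesis"
  then have fixp: "\<gamma> p = p" if "\<gamma> \<in> \<Gamma>" for \<gamma> using that by blast
  define \<phi> where "\<phi> = (\<lambda>\<gamma>. \<sigma> \<gamma> p)"
  have quasi_hom: "\<bar>\<phi> (\<gamma> \<circ> \<eta>) - \<phi> \<gamma> - \<phi> \<eta>\<bar> \<le> \<kappa>" if "\<gamma> \<in> \<Gamma>" "\<eta> \<in> \<Gamma>" for \<gamma> \<eta>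
  proof -
    have "\<bar>\<sigma> (\<gamma> \<circ> \<eta>) p - (\<sigma> \<gamma> (\<eta> p) + \<sigma> \<eta> p)\<bar> \<le> \<kappa>"
      using coc that unfolding quasi_cocycle_def by blast
    then show ?thesis using fixp[OF that(2)] by (simp add: \<phi>_def)
  qed
  \<comment> \<open>Where \<open>inv \<gamma>\<close> stays away from \<open>p\<close>,
    \<open>\<phi> \<gamma>\<close> is within a constant of \<open>m \<gamma>\<close>, so it inherits
    properness.\<close>
  have finite_\<phi>: "finite {\<gamma>\<in>\<Gamma>. d (Inr p) (Inl (inv \<gamma>)) > \<epsilon> \<and> \<phi> \<gamma> \<le> K}" if "\<epsilon> > 0" for \<epsilon> K
  proof -
    obtain C where C: "\<And>\<gamma> x. \<gamma> \<in> \<Gamma> \<Longrightarrow> d (Inr x) (Inl (inv \<gamma>)) > \<epsilon> \<Longrightarrow> \<bar>\<sigma> \<gamma> x - m \<gamma>\<bar> \<le> C"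
      using magnitudeD[OF mag \<open>\<epsilon> > 0\<close>] by metis
    have "{\<gamma>\<in>\<Gamma>. d (Inr p) (Inl (inv \<gamma>)) > \<epsilon> \<and> \<phi> \<gamma> \<le> K} \<subseteq> {\<gamma>\<in>\<Gamma>. m \<gamma> \<le> K + C}"
    proof clarify
      fix \<gamma> assume *: "\<gamma> \<in> \<Gamma>" "d (Inr p) (Inl (inv \<gamma>)) > \<epsilon>" "\<phi> \<gamma> \<le> K"
      from C[OF *(1,2)] *(3) show "m \<gamma> \<le> K + C" by (simp add: \<phi>_def)
    qed
    then show ?thesis using proper finite_subset by blast
  qed

  obtain b where b: "b \<in> limit_set \<Gamma>" "b \<noteq> p"
    using nonelementary_limit_point[OF ne] by metis
  then obtain y0 and g :: "nat \<Rightarrow> 'm \<Rightarrow> 'm" where "range g \<subseteq> \<Gamma>" "loc_unif_const euclidean g y0 b"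
    unfolding limit_set_def by blast
  then have g: "\<And>n. g n \<in> \<Gamma>" "loc_unif_const euclidean g y0 b" by auto
  have pw: "(\<lambda>n. g n z) \<longlonglongrightarrow> b" if "z \<noteq> p" for z
  proof -
    \<comment> \<open>Otherwise the constant sequence \<open>g n p = p\<close> would tend to
      \<open>b\<close>.\<close>
    have "y0 = p"
    proof (rule ccontr)
      assume "y0 \<noteq> p"
      then have "(\<lambda>n. g n p) \<longlonglongrightarrow> b" using loc_unif_const_pointwise[OF g(2), of p] by simp
      then have "(\<lambda>n. p) \<longlonglongrightarrow> b" using fixp[OF g(1)] by simp
      then show False using b(2) LIMSEQ_const_iff by metis
    qed
    then show ?thesis using loc_unif_const_pointwise[OF g(2)] that by simp
  qed
  obtain z1 z2 where z12: "z1 \<noteq> z2" "z1 \<noteq> p" "z2 \<noteq> p"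
    by (rule two_points_avoiding[of "Inr p"]) auto
  define \<epsilon> where "\<epsilon> = Min {d (Inr z1) (Inr z2), d (Inr b) (Inr p), d (Inr z1) (Inr p), d (Inr z2) (Inr p)} / 10"
  have pos: "d (Inr x) (Inr y) > 0" if "x \<noteq> y" for x y
    using that by (simp add: mdist_pos_less)
  have \<epsilon>: "\<epsilon> > 0" "d (Inr z1) (Inr z2) \<ge> 10 * \<epsilon>" "d (Inr b) (Inr p) \<ge> 10 * \<epsilon>"
    "d (Inr z1) (Inr p) \<ge> 10 * \<epsilon>" "d (Inr z2) (Inr p) \<ge> 10 * \<epsilon>"
    using pos[OF z12(1)] pos[OF b(2)] pos[OF z12(2)] pos[OF z12(3)] by (auto simp: \<epsilon>_def)
  obtain \<Phi> where \<Phi>: "finite \<Phi>" "\<Phi> \<subseteq> \<Gamma>"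
    "\<And>\<gamma> z. \<gamma> \<in> \<Gamma> \<Longrightarrow> \<gamma> \<notin> \<Phi> \<Longrightarrow> z \<in> X \<Longrightarrow> d z (Inl (inv \<gamma>)) > \<epsilon> \<Longrightarrow> d (sum_act \<gamma> z) (Inl \<gamma>) < \<epsilon>"
    using contracting_outside_finite[OF \<epsilon>(1)] by metis
  \<comment> \<open>Avoiding \<open>\<Phi>\<close> makes \<open>\<gamma>\<close> contract. Avoiding
    the other set makes \<open>\<phi> (inv \<gamma>)\<close> exceed the defect
    \<open>\<kappa>\<close>, once \<open>\<gamma>\<close> is known to be far from
    \<open>p\<close>.\<close>
  define \<Psi> where "\<Psi> = \<Phi> \<union> inv ` {\<gamma>\<in>\<Gamma>. d (Inr p) (Inl (inv \<gamma>)) > \<epsilon> \<and> \<phi> \<gamma> \<le> \<kappa>}"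
  have fin\<Psi>: "finite \<Psi>" "\<Psi> \<subseteq> \<Gamma>" using \<Phi> finite_\<phi>[OF \<epsilon>(1)] by (auto simp: \<Psi>_def)
  have "\<forall>\<^sub>F n in sequentially. \<forall>\<gamma>\<in>\<Psi>. g n \<noteq> \<gamma>"
  proof (rule eventually_ball_finite[OF fin\<Psi>(1)], rule ballI)
    fix \<gamma> assume "\<gamma> \<in> \<Psi>"
    \<comment> \<open>A fixed injective map cannot send both \<open>z1\<close> and \<open>z2\<close>
      to \<open>b\<close>, the common limit of \<open>g n z1\<close> and \<open>g n z2\<close>; so
      \<open>g n\<close> eventually leaves any finite set.\<close>
    then have "\<gamma> z1 \<noteq> \<gamma> z2" using fin\<Psi>(2) z12(1) bij_elem[of \<gamma>] by (auto simp: bij_def inj_eq)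
    then obtain z where z: "z \<noteq> p" "b \<noteq> \<gamma> z" using z12 by metis
    show "\<forall>\<^sub>F n in sequentially. g n \<noteq> \<gamma>"
      using tendsto_imp_eventually_ne[OF pw[OF z(1)] z(2)] by eventually_elim auto
  qed
  moreover have near: "\<forall>\<^sub>F n in sequentially. d (Inr (g n z)) (Inr b) < \<epsilon>" if "z \<noteq> p" for z
    using converges_Inr[OF pw[OF that]] \<epsilon>(1) by (auto simp: limitin_metric elim: eventually_mono)
  ultimately have "\<forall>\<^sub>F n in sequentially. (\<forall>\<gamma>\<in>\<Psi>. g n \<noteq> \<gamma>) \<and>
      d (Inr (g n z1)) (Inr b) < \<epsilon> \<and> d (Inr (g n z2)) (Inr b) < \<epsilon>"
    using near[OF z12(2)] near[OF z12(3)] by (intro eventually_conj)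
  then obtain n where n: "g n \<notin> \<Psi>" "d (Inr (g n z1)) (Inr b) < \<epsilon>" "d (Inr (g n z2)) (Inr b) < \<epsilon>"
    using eventually_happens'[OF sequentially_bot] by blast
  define \<gamma> where "\<gamma> = g n"
  have \<gamma>: "\<gamma> \<in> \<Gamma>" "\<gamma> \<notin> \<Phi>" using g(1) n(1) by (auto simp: \<gamma>_def \<Psi>_def)
  have contr: "d (sum_act \<gamma> z) (Inl \<gamma>) < \<epsilon>" if "z \<in> X" "d z (Inl (inv \<gamma>)) > \<epsilon>" for z
    using \<Phi>(3)[OF \<gamma> that] .
  have \<gamma>_b: "d (Inl \<gamma>) (Inr b) < 2 * \<epsilon>"
  proof -
    have "d (Inr z1) (Inl (inv \<gamma>)) > \<epsilon> \<or> d (Inr z2) (Inl (inv \<gamma>)) > \<epsilon>"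
      using triangle[of "Inr z1" "Inl (inv \<gamma>)" "Inr z2"] commute[of "Inr z2" "Inl (inv \<gamma>)"]
        \<epsilon>(1,2) \<gamma> by auto
    then obtain z where z: "d (Inr z) (Inl (inv \<gamma>)) > \<epsilon>" "d (Inr (\<gamma> z)) (Inr b) < \<epsilon>"
      using n(2,3) by (auto simp: \<gamma>_def)
    have "d (Inr (\<gamma> z)) (Inl \<gamma>) < \<epsilon>" using contr[of "Inr z"] z(1) by simp
    then show ?thesis
      using triangle[of "Inl \<gamma>" "Inr (\<gamma> z)" "Inr b"] commute[of "Inl \<gamma>" "Inr (\<gamma> z)"] z(2) \<gamma> by simp
  qed
  have \<gamma>_p: "d (Inl \<gamma>) (Inr p) > 8 * \<epsilon>"
    using triangle[of "Inr b" "Inl \<gamma>" "Inr p"] commute[of "Inr b" "Inl \<gamma>"] \<gamma>_b \<epsilon>(3) \<gamma> by simp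
  have inv_p: "d (Inr p) (Inl (inv \<gamma>)) \<le> \<epsilon>"
  proof (rule ccontr)
    assume "\<not> ?thesis"
    then have "d (Inr p) (Inl \<gamma>) < \<epsilon>" using contr[of "Inr p"] fixp[OF \<gamma>(1)] by simp
    then show False using \<gamma>_p commute[of "Inl \<gamma>" "Inr p"] \<epsilon>(1) by simp
  qed
  \<comment> \<open>The complement of the ball of radius \<open>2 * \<epsilon>\<close> about
    \<open>p\<close> is mapped into itself, so positive powers of \<open>\<gamma>\<close> cannot
    attract to \<open>p\<close>.\<close>
  have away: "d (Inr (\<gamma> z)) (Inr p) > 2 * \<epsilon>" if "d (Inr z) (Inr p) > 2 * \<epsilon>" for z
  proof -
    have "d (Inr z) (Inl (inv \<gamma>)) > \<epsilon>"
      using triangle[of "Inr z" "Inl (inv \<gamma>)" "Inr p"] commute[of "Inr p" "Inl (inv \<gamma>)"]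
        that inv_p \<gamma> by simp
    then have "d (Inr (\<gamma> z)) (Inl \<gamma>) < \<epsilon>" using contr[of "Inr z"] by simp
    then show ?thesis
      using triangle[of "Inl \<gamma>" "Inr (\<gamma> z)" "Inr p"] commute[of "Inl \<gamma>" "Inr (\<gamma> z)"] \<gamma>_p \<epsilon>(1) \<gamma> by simp
  qed
  have pow_away: "d (Inr ((\<gamma> ^^ k) z)) (Inr p) > 2 * \<epsilon>" if "d (Inr z) (Inr p) > 2 * \<epsilon>" for k z
    using that by (induction k) (auto intro: away)
  have pow_in: "\<gamma> ^^ k \<in> \<Gamma>" "inv \<gamma> ^^ k \<in> \<Gamma>" for k using \<gamma>(1) by (auto intro: funpow_in)
  have inv_pow: "inv (\<gamma> ^^ k) = inv \<gamma> ^^ k" for k using inv_fn[OF bij_elem[OF \<gamma>(1)]] by simp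

  have "\<phi> (inv \<gamma>) > \<kappa>"
  proof (rule ccontr)
    assume "\<not> ?thesis"
    then have "inv \<gamma> \<in> {\<gamma>\<in>\<Gamma>. d (Inr p) (Inl (inv \<gamma>)) > \<epsilon> \<and> \<phi> \<gamma> \<le> \<kappa>}"
      using \<gamma>(1) \<gamma>_p \<epsilon>(1) commute[of "Inl \<gamma>" "Inr p"] by simp
    then have "inv (inv \<gamma>) \<in> \<Psi>" unfolding \<Psi>_def by blast
    then show False using n(1) \<gamma>(1) by (simp add: \<gamma>_def)
  qed
  \<comment> \<open>One more factor \<open>inv \<gamma>\<close> raises \<open>\<phi>\<close> by at
    least \<open>\<phi> (inv \<gamma>) - \<kappa> > 0\<close>; hence the powers are
    distinct.\<close>
  then have step: "\<phi> (inv \<gamma> ^^ k) < \<phi> (inv \<gamma> ^^ Suc k)" for k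
    using quasi_hom[OF _ pow_in(2), of "inv \<gamma>" k] \<gamma>(1) by simp
  have "strict_mono (\<lambda>k. \<phi> (inv \<gamma> ^^ k))"
    by (rule strict_monoI_Suc) (rule step)
  then have inj_inv: "inj (\<lambda>k. inv \<gamma> ^^ k)"
    by (metis (mono_tags, lifting) injI strict_mono_eq)
  then have inj_pow: "inj (\<lambda>k. \<gamma> ^^ k)"
    unfolding inj_def using inv_pow by metis

  obtain x y r where r: "strict_mono r" "converges (\<lambda>n. Inl (\<gamma> ^^ r n)) (Inr x)"
    "converges (\<lambda>n. Inl (inv (\<gamma> ^^ r n))) (Inr y)"
    and conv: "\<And>s z p. strict_mono s \<Longrightarrow> converges z p \<Longrightarrow> p \<noteq> Inr y \<Longrightarrow>
      converges (\<lambda>n. sum_act (\<gamma> ^^ r (s n)) (z n)) (Inr x)"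
    by (rule convergence_sequence[OF inj_pow pow_in(1)]) (rule that; assumption)
  have lim_pow0: "converges (\<lambda>n. Inr ((\<gamma> ^^ r n) z)) (Inr x)" if "z \<noteq> y" for z
    using conv[of "\<lambda>n. n", OF _ converges_const, of "Inr z"] that by (simp add: strict_mono_def)
  have "x \<noteq> p"
  proof -
    obtain z where z: "z \<noteq> y" "d (Inr z) (Inr p) \<ge> 10 * \<epsilon>" using z12(1) \<epsilon>(4,5) by metis
    have "(\<lambda>n. d (Inr ((\<gamma> ^^ r n) z)) (Inr p)) \<longlonglongrightarrow> d (Inr x) (Inr p)"
      by (rule converges_dist[OF lim_pow0[OF z(1)] converges_const]) auto
    moreover have "2 * \<epsilon> \<le> d (Inr ((\<gamma> ^^ r n) z)) (Inr p)" for n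
      using pow_away[of z "r n"] z(2) \<epsilon>(1) by simp
    ultimately have "2 * \<epsilon> \<le> d (Inr x) (Inr p)" by (intro LIMSEQ_le_const) auto
    then show ?thesis using \<epsilon>(1) by auto
  qed
  have "y = p"
  proof (rule ccontr)
    assume "y \<noteq> p"
    then have "converges (\<lambda>n. Inr p) (Inr x)" using lim_pow0[of p] fixp[OF pow_in(1)] by simp
    from converges_unique[OF this converges_const] show False using \<open>x \<noteq> p\<close> by simp
  qed
  then have lim_pow: "converges (\<lambda>n. Inr ((\<gamma> ^^ r n) z)) (Inr x)" if "z \<noteq> p" for z
    using lim_pow0 that by simp
  have inj_elem: "\<eta> z = \<eta> w \<longleftrightarrow> z = w" if "\<eta> \<in> \<Gamma>" for \<eta> z w
    using bij_elem[OF that] by (simp add: bij_def inj_eq)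
  have moves: "\<eta> z \<noteq> p" if "\<eta> \<in> \<Gamma>" "z \<noteq> p" for \<eta> z
    using inj_elem[OF that(1), of z p] fixp[OF that(1)] that(2) by simp
  have "\<gamma> x = x"
  proof -
    have "converges (\<lambda>n. sum_act \<gamma> (Inr ((\<gamma> ^^ r n) z1))) (sum_act \<gamma> (Inr x))"
      by (rule converges_act[OF \<gamma>(1) lim_pow[OF z12(2)]])
    then have "converges (\<lambda>n. Inr ((\<gamma> ^^ r n) (\<gamma> z1))) (Inr (\<gamma> x))"
      by (simp add: funpow_swap1)
    from converges_unique[OF this lim_pow[OF moves[OF \<gamma>(1) z12(2)]]] show ?thesis by simp
  qed
  then have pow_x: "(\<gamma> ^^ k) x = x" for k by (induction k) auto
  then have inv_pow_x: "(inv \<gamma> ^^ k) x = x" for k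
    using inv_pow[of k] inv_apply[OF pow_in(1)] by metis
  have fixed_pow: "w = p \<or> w = x" if "i > 0" "(\<gamma> ^^ i) w = w" for w i
  proof -
    have "inj (\<lambda>k. \<gamma> ^^ (i * k))"
    proof (rule injI)
      fix k l assume "\<gamma> ^^ (i * k) = \<gamma> ^^ (i * l)"
      then have "i * k = i * l" by (rule injD[OF inj_pow])
      then show "k = l" using that(1) by simp
    qed
    moreover have "(\<gamma> ^^ (i * k)) w = w" for k
      using that(2) by (induction k) (auto simp: funpow_add)
    ultimately show ?thesis
      using no_three_fixed_points[of "\<lambda>k. \<gamma> ^^ (i * k)" p x w] pow_in(1) fixp[OF pow_in(1)] pow_x \<open>x \<noteq> p\<close>
      by blast
  qed

  have all_fix_x: "f x = x" if f: "f \<in> \<Gamma>" for f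
  proof -
    define h where "h = (\<lambda>n. \<gamma> ^^ r n \<circ> (f \<circ> inv \<gamma> ^^ r n))"
    have h_in: "h n \<in> \<Gamma>" for n using f pow_in by (simp add: h_def)
    \<comment> \<open>Up to three defects \<open>\<kappa>\<close>, the contributions of
      \<open>\<gamma> ^^ k\<close> and \<open>inv \<gamma> ^^ k\<close> cancel, which leaves
      \<open>\<phi> e\<close> and \<open>\<phi> id\<close>.\<close>
    have bounded: "\<phi> (\<gamma> ^^ k \<circ> (e \<circ> inv \<gamma> ^^ k)) \<le> \<bar>\<phi> e\<bar> + \<bar>\<phi> id\<bar> + 3 * \<kappa>" if "e \<in> \<Gamma>" for e k
    proof -
      have "\<gamma> ^^ k \<circ> inv \<gamma> ^^ k = id"
        using comp_inv_self[OF pow_in(1)[of k]] inv_pow by simp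
      then have "\<phi> (\<gamma> ^^ k \<circ> inv \<gamma> ^^ k) = \<phi> id" by simp
      then show ?thesis
        using quasi_hom[OF pow_in(1)[of k] comp_in[OF that pow_in(2)[of k]]]
          quasi_hom[OF that pow_in(2)[of k]] quasi_hom[OF pow_in(1)[of k] pow_in(2)[of k]] by linarith
    qed
    have inv_h: "inv (h n) = \<gamma> ^^ r n \<circ> (inv f \<circ> inv \<gamma> ^^ r n)" for n
      using f pow_in[of "r n"] inv_pow[of "r n"] inv_inv[OF pow_in(1)[of "r n"]]
      by (simp add: h_def inv_comp comp_assoc)
    have "\<not> inj h"
    proof
      assume "inj h"
      obtain x2 y2 r2 where r2: "strict_mono r2" "converges (\<lambda>n. Inl (h (r2 n))) (Inr x2)"
        "converges (\<lambda>n. Inl (inv (h (r2 n)))) (Inr y2)"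
        and conv2: "\<And>s z p. strict_mono s \<Longrightarrow> converges z p \<Longrightarrow> p \<noteq> Inr y2 \<Longrightarrow>
          converges (\<lambda>n. sum_act (h (r2 (s n))) (z n)) (Inr x2)"
        by (rule convergence_sequence[OF \<open>inj h\<close> h_in]) (rule that; assumption)
      \<comment> \<open>If the inverses tended to a point other than \<open>p\<close>, infinitely
        many distinct \<open>k n\<close> would lie in a set that properness of \<open>\<phi>\<close>
        makes finite. This is applied to the conjugates and to their inverses.\<close>
      have only_p: "w = p"
        if lim: "converges (\<lambda>n. Inl (inv (k n))) (Inr w)" and k: "inj k" "\<And>n. k n \<in> \<Gamma>"
          and bd: "\<And>n. \<phi> (k n) \<le> B" for k w B
      proof (rule ccontr)
        assume "w \<noteq> p"
        define e where "e = d (Inr p) (Inr w) / 2"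
        have e: "e > 0" using pos[of p w] \<open>w \<noteq> p\<close> by (simp add: e_def)
        have "(\<lambda>n. d (Inr p) (Inl (inv (k n)))) \<longlonglongrightarrow> d (Inr p) (Inr w)"
          by (rule converges_dist[OF converges_const lim]) (auto simp: k)
        moreover have "e < d (Inr p) (Inr w)" using e by (simp add: e_def)
        ultimately have "\<forall>\<^sub>F n in sequentially. e < d (Inr p) (Inl (inv (k n)))"
          by (rule order_tendstoD)
        moreover have "\<forall>\<^sub>F n in sequentially. k n \<notin> {\<gamma>\<in>\<Gamma>. d (Inr p) (Inl (inv \<gamma>)) > e \<and> \<phi> \<gamma> \<le> B}"
          by (rule eventually_notin_of_inj[OF k(1) finite_\<phi>[OF e]])
        ultimately have "\<forall>\<^sub>F n in sequentially. False"
          by eventually_elim (use k bd in auto)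
        then show False by simp
      qed
      have inj_hr: "inj (\<lambda>n. h (r2 n))"
        using inj_compose[OF \<open>inj h\<close> strict_mono_imp_inj_on[OF r2(1)]] by (simp add: o_def)
      have "y2 = p"
        by (rule only_p[OF r2(3) inj_hr h_in]) (use bounded[OF f] in \<open>auto simp: h_def\<close>)
      moreover have "x2 = p"
      proof (rule only_p)
        show "converges (\<lambda>n. Inl (inv (inv (h (r2 n))))) (Inr x2)"
          using r2(2) h_in by simp
        show "inj (\<lambda>n. inv (h (r2 n)))"
          using inj_hr inv_inv[OF h_in] unfolding inj_def by metis
        show "inv (h (r2 n)) \<in> \<Gamma>" for n using h_in by simp
        show "\<phi> (inv (h (r2 n))) \<le> \<bar>\<phi> (inv f)\<bar> + \<bar>\<phi> id\<bar> + 3 * \<kappa>" for n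
          unfolding inv_h using bounded[of "inv f"] f by simp
      qed
      \<comment> \<open>The conjugates are tested on the moving points
        \<open>(\<gamma> ^^ r k) z1\<close>, which tend to \<open>x \<noteq> p\<close> and which
        \<open>h k\<close> sends to \<open>(\<gamma> ^^ r k) (f z1)\<close>. These images would tend
        to \<open>p\<close> by the dynamics of \<open>h\<close> and to \<open>x\<close> by that of
        \<open>\<gamma>\<close>.\<close>
      moreover have zc: "converges (\<lambda>n. Inr ((\<gamma> ^^ r (r2 n)) z)) (Inr x)" if "z \<noteq> p" for z
        using converges_subseq[OF lim_pow[OF that] r2(1)] by (simp add: o_def)
      ultimately have "converges (\<lambda>n. sum_act (h (r2 n)) (Inr ((\<gamma> ^^ r (r2 n)) z1))) (Inr p)"
        using conv2[of "\<lambda>n. n", OF _ zc[OF z12(2)]] \<open>x \<noteq> p\<close> by (simp add: strict_mono_def)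
      moreover have "h k ((\<gamma> ^^ r k) z1) = (\<gamma> ^^ r k) (f z1)" for k
        using inv_apply[OF pow_in(1)[of "r k"]] inv_pow[of "r k"] by (simp add: h_def)
      ultimately have "converges (\<lambda>n. Inr ((\<gamma> ^^ r (r2 n)) (f z1))) (Inr p)" by simp
      from converges_unique[OF this zc[OF moves[OF f z12(2)]]] \<open>x \<noteq> p\<close> show False by simp
    qed
    then obtain k l where "h k = h l" "k \<noteq> l" by (auto simp: inj_def)
    then have "h k x = h l x" "r k \<noteq> r l" using r(1) by (simp_all add: strict_mono_eq)
    then have eq: "(\<gamma> ^^ r k) (f x) = (\<gamma> ^^ r l) (f x)" by (simp add: h_def inv_pow_x)
    have "f x = p \<or> f x = x"
    proof -
      have *: "f x = p \<or> f x = x" if "a < c" "(\<gamma> ^^ a) (f x) = (\<gamma> ^^ c) (f x)" for a c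
      proof -
        have "(\<gamma> ^^ c) (f x) = (\<gamma> ^^ a) ((\<gamma> ^^ (c - a)) (f x))"
          using \<open>a < c\<close> funpow_add[of a "c - a" \<gamma>] by simp
        then have "(\<gamma> ^^ (c - a)) (f x) = f x"
          using that(2) inj_elem[OF pow_in(1)[of a]] by simp
        then show ?thesis using fixed_pow[of "c - a"] \<open>a < c\<close> by simp
      qed
      show ?thesis using *[of "r k" "r l"] *[of "r l" "r k"] eq \<open>r k \<noteq> r l\<close> by (metis nat_neq_iff)
    qed
    then show ?thesis using moves[OF f \<open>x \<noteq> p\<close>] by simp
  qed

  obtain b' where b': "b' \<in> limit_set \<Gamma>" "b' \<noteq> p" "b' \<noteq> x"
    using nonelementary_limit_point[OF ne] by metis
  then obtain y1 and g' :: "nat \<Rightarrow> 'm \<Rightarrow> 'm"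
    where "range g' \<subseteq> \<Gamma>" "loc_unif_const euclidean g' y1 b'"
    unfolding limit_set_def by blast
  then have g': "\<And>n. g' n \<in> \<Gamma>" "loc_unif_const euclidean g' y1 b'" by auto
  \<comment> \<open>At least one of the two global fixed points differs from the exceptional point
    \<open>y1\<close>, so its constant orbit would tend to \<open>b'\<close>.\<close>
  obtain w where w: "w \<in> {p, x}" "w \<noteq> y1" using \<open>x \<noteq> p\<close> by blast
  have "(\<lambda>n. g' n w) \<longlonglongrightarrow> b'" by (rule loc_unif_const_pointwise[OF g'(2) w(2)])
  moreover have "g' n w = w" for n using w(1) fixp all_fix_x g'(1) by auto
  ultimately have "(\<lambda>n. w) \<longlonglongrightarrow> b'" by simp
  then have "w = b'" using LIMSEQ_const_iff by metis
  then show False using w(1) b' by auto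
qed

text \<open>The sublevel sets of \<open>m\<close> exhaust \<Gamma> by finite sets. If all of them
  failed with margins tending to \<open>0\<close>, a limit of the bad pairs would be a point
  \<open>a0\<close> sent by every element to the same \<open>q0\<close>, hence fixed by \<Gamma>. It
  is not in \<open>M\<close>, which has no global fixed point, nor in \<Gamma>, where left
  multiplication is free and \<Gamma> is not trivial.\<close>

lemma finite_set_displacing_every_point:
  assumes ne: "nonelementary \<Gamma>" and coc: "quasi_cocycle \<kappa> \<sigma>" and mag: "magnitude \<Gamma> d \<sigma> m"
    and proper: "\<And>K. finite {\<gamma>\<in>\<Gamma>. m \<gamma> \<le> K}"
  obtains F e where "finite F" "F \<subseteq> \<Gamma>" "e > 0"
    "\<And>a q. a \<in> X \<Longrightarrow> q \<in> X \<Longrightarrow> \<exists>f\<in>F. d (sum_act f a) q > e"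
proof (rule ccontr)
  assume neg: "\<not> thesis"
  have "\<exists>a\<in>X. \<exists>q\<in>X. \<forall>f\<in>\<Gamma>. m f \<le> real n \<longrightarrow> d (sum_act f a) q \<le> inverse (real (Suc n))" for n
  proof (rule ccontr)
    assume *: "\<not> ?thesis"
    show False
    proof (rule neg[THEN notE], rule that[of "{f\<in>\<Gamma>. m f \<le> real n}" "inverse (real (Suc n))"])
      fix a q assume "a \<in> X" "q \<in> X"
      then have "\<not> (\<forall>f\<in>\<Gamma>. m f \<le> real n \<longrightarrow> d (sum_act f a) q \<le> inverse (real (Suc n)))"
        using * by blast
      then show "\<exists>f\<in>{f\<in>\<Gamma>. m f \<le> real n}. d (sum_act f a) q > inverse (real (Suc n))"
        unfolding not_le[symmetric] by blast
    qed (use proper in auto)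
  qed
  then obtain a q where aq: "\<And>n. a n \<in> X" "\<And>n. q n \<in> X"
    "\<And>n f. f \<in> \<Gamma> \<Longrightarrow> m f \<le> real n \<Longrightarrow> d (sum_act f (a n)) (q n) \<le> inverse (real (Suc n))"
    by metis
  obtain a0 r where r: "a0 \<in> X" "strict_mono r" "converges (a \<circ> r) a0"
    using subseq_converges[of a] aq(1) by blast
  obtain q0 s where s: "q0 \<in> X" "strict_mono s" "converges ((\<lambda>n. q (r n)) \<circ> s) q0"
    using subseq_converges[of "\<lambda>n. q (r n)"] aq(2) by blast
  define t where "t = (\<lambda>n. r (s n))"
  have t: "strict_mono t" using r(2) s(2) by (simp add: t_def strict_mono_def)
  have a: "converges (\<lambda>n. a (t n)) a0"
    using converges_subseq[OF r(3) s(2)] by (simp add: o_def t_def)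
  have q: "converges (\<lambda>n. q (t n)) q0" using s(3) by (simp add: o_def t_def)
  have lim0: "(\<lambda>n. inverse (real (Suc (t n)))) \<longlonglongrightarrow> 0"
    using LIMSEQ_subseq_LIMSEQ[OF LIMSEQ_inverse_real_of_nat t] by (simp add: o_def)
  have all: "sum_act f a0 = q0" if f: "f \<in> \<Gamma>" for f
  proof -
    have lim: "(\<lambda>n. d (sum_act f (a (t n))) (q (t n))) \<longlonglongrightarrow> d (sum_act f a0) q0"
      by (rule converges_dist[OF converges_act[OF f a] q]) (rule act_in[OF f aq(1)], rule aq(2))
    have "\<forall>\<^sub>F n in sequentially. d (sum_act f (a (t n))) (q (t n)) \<le> inverse (real (Suc (t n)))"
    proof -
      obtain N where N: "m f \<le> real N" using real_arch_simple by blast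
      have "m f \<le> real (t n)" if "n \<ge> N" for n
        using N that seq_suble[OF t, of n] by linarith
      then show ?thesis using aq(3)[OF f] unfolding eventually_sequentially by blast
    qed
    then have "d (sum_act f a0) q0 \<le> 0"
      by (intro tendsto_le[OF _ lim0 lim]) auto
    then show ?thesis
      using zero[OF act_in[OF f r(1)] s(1)] nonneg[of "sum_act f a0" q0] by linarith
  qed
  have fixed: "sum_act f a0 = a0" if "f \<in> \<Gamma>" for f
  proof -
    have "sum_act id a0 = a0" by (cases a0) auto
    then show ?thesis using all[OF that] all[OF id_in] by simp
  qed
  obtain p :: 'm where "a0 = Inr p \<or> (\<exists>\<eta>. a0 = Inl \<eta>)" by (cases a0) auto
  moreover obtain f where f: "f \<in> \<Gamma>" "f p \<noteq> p"
    using no_global_fixed_point[OF ne coc mag proper] by blast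
  ultimately obtain \<eta> where \<eta>: "a0 = Inl \<eta>" using fixed[OF f(1)] by auto
  then have "\<eta> \<in> \<Gamma>" using r(1) by auto
  have "f \<circ> \<eta> = \<eta>" using fixed[OF f(1)] \<eta> by simp
  then have "f \<circ> \<eta> \<circ> inv \<eta> = \<eta> \<circ> inv \<eta>" by simp
  then have "f = id" using \<open>\<eta> \<in> \<Gamma>\<close> by (simp add: comp_assoc)
  then show False using f by simp
qed

end

section \<open>Sums over shadows\<close>

lemma sum_le_of_finite_to_one:
  fixes w :: "'a \<Rightarrow> real" and v :: "'b \<Rightarrow> real"
  assumes "finite E" "f ` E \<subseteq> B" "v summable_on B" "\<And>b. b \<in> B \<Longrightarrow> 0 \<le> v b" "0 \<le> K"
    and le: "\<And>a. a \<in> E \<Longrightarrow> w a \<le> K * v (f a)"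
    and fibre: "\<And>b. b \<in> f ` E \<Longrightarrow> card {a\<in>E. f a = b} \<le> k"
  shows "sum w E \<le> K * real k * infsum v B"
proof -
  have "sum w E \<le> (\<Sum>a\<in>E. K * v (f a))" by (intro sum_mono le)
  also have "\<dots> = K * (\<Sum>a\<in>E. v (f a))" by (simp add: sum_distrib_left)
  also have "(\<Sum>a\<in>E. v (f a)) = (\<Sum>b\<in>f ` E. real (card {a\<in>E. f a = b}) * v b)"
  proof -
    have "(\<Sum>a\<in>E. v (f a)) = (\<Sum>b\<in>f ` E. \<Sum>a\<in>{a\<in>E. f a = b}. v (f a))"
      by (rule sum.image_gen[OF assms(1)])
    also have "\<dots> = (\<Sum>b\<in>f ` E. \<Sum>a\<in>{a\<in>E. f a = b}. v b)"
      by (intro sum.cong) auto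
    finally show ?thesis by simp
  qed
  also have "\<dots> \<le> (\<Sum>b\<in>f ` E. real k * v b)"
    using fibre assms(2,4) by (intro sum_mono mult_right_mono) auto
  also have "\<dots> = real k * (\<Sum>b\<in>f ` E. v b)" by (simp add: sum_distrib_left)
  also have "(\<Sum>b\<in>f ` E. v b) \<le> infsum v B"
    using assms by (intro finite_sum_le_infsum) auto
  finally show ?thesis
    using assms(5) by (simp add: mult_left_mono mult.assoc)
qed

text \<open>Greedy selection: an \<open>x\<close> of least rank is kept, every \<open>y\<close> with
  \<open>S y\<close> meeting \<open>S x\<close> is discarded because \<open>S' x\<close> contains
  \<open>S y\<close>, and the rest is treated in the same way. The rank will be the magnitude, small
  values of which mean large shadows.\<close>

lemma vitali_finite:
  fixes rank :: "'a \<Rightarrow> real"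
  assumes "finite B"
    and engulf: "\<And>x y. x \<in> B \<Longrightarrow> y \<in> B \<Longrightarrow> S x \<inter> S y \<noteq> {} \<Longrightarrow> rank x \<le> rank y \<Longrightarrow> S y \<subseteq> S' x"
  shows "\<exists>J\<subseteq>B. (\<forall>x\<in>J. \<forall>y\<in>J. x \<noteq> y \<longrightarrow> S x \<inter> S y = {}) \<and> (\<Union>x\<in>B. S x) \<subseteq> (\<Union>x\<in>J. S' x)"
  using assms
proof (induction B rule: finite_psubset_induct)
  case (psubset B)
  show ?case
  proof (cases "B = {}")
    case False
    define x where "x = arg_min_on rank B"
    have x: "x \<in> B" "\<And>y. y \<in> B \<Longrightarrow> rank x \<le> rank y"
      using arg_min_if_finite(1)[OF psubset.hyps(1) False] arg_min_least[OF psubset.hyps(1) False]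
      by (auto simp: x_def)
    define B' where "B' = {y\<in>B - {x}. S x \<inter> S y = {}}"
    have "B' \<subset> B" using x(1) by (auto simp: B'_def)
    then obtain J where J: "J \<subseteq> B'" "\<forall>x\<in>J. \<forall>y\<in>J. x \<noteq> y \<longrightarrow> S x \<inter> S y = {}"
      "(\<Union>x\<in>B'. S x) \<subseteq> (\<Union>x\<in>J. S' x)"
      using psubset.IH[of B'] psubset.prems by (metis (no_types, lifting) psubsetD)
    show ?thesis
    proof (intro exI[of _ "insert x J"] conjI ballI impI)
      show "insert x J \<subseteq> B" using J(1) x(1) by (auto simp: B'_def)
      show "S a \<inter> S b = {}" if "a \<in> insert x J" "b \<in> insert x J" "a \<noteq> b" for a b
        using that J(1,2) by (auto simp: B'_def)
      show "(\<Union>y\<in>B. S y) \<subseteq> (\<Union>y\<in>insert x J. S' y)"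
      proof
        fix z assume "z \<in> (\<Union>y\<in>B. S y)"
        then obtain y where y: "y \<in> B" "z \<in> S y" by blast
        show "z \<in> (\<Union>y\<in>insert x J. S' y)"
        proof (cases "S x \<inter> S y = {}")
          case True
          then have "y \<in> B'" using y by (auto simp: B'_def)
          then show ?thesis using J(3) y by blast
        next
          case False
          then show ?thesis using psubset.prems[OF x(1) y(1) False x(2)[OF y(1)]] y(2) by blast
        qed
      qed
    qed
  qed simp
qed

context convergence_compactification
begin

section \<open>Poincare series and the mass of shadows\<close>

definition proper :: "(('m \<Rightarrow> 'm) \<Rightarrow> real) \<Rightarrow> bool" where
  "proper m \<longleftrightarrow> (\<forall>K. finite {\<gamma>\<in>\<Gamma>. m \<gamma> \<le> K})"

lemma proper_bounded_below:
  assumes "proper m"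
  obtains L where "L \<ge> 0" "\<And>\<gamma>. \<gamma> \<in> \<Gamma> \<Longrightarrow> m \<gamma> \<ge> - L"
proof -
  have fin: "finite {\<gamma>\<in>\<Gamma>. m \<gamma> \<le> 0}" using assms by (simp add: proper_def)
  define L where "L = (\<Sum>\<gamma>\<in>{\<gamma>\<in>\<Gamma>. m \<gamma> \<le> 0}. \<bar>m \<gamma>\<bar>)"
  show ?thesis
  proof (rule that[of L])
    show "0 \<le> L" unfolding L_def by (intro sum_nonneg) auto
    fix \<gamma> assume \<gamma>: "\<gamma> \<in> \<Gamma>"
    show "m \<gamma> \<ge> - L"
    proof (cases "m \<gamma> \<le> 0")
      case True
      then have "\<bar>m \<gamma>\<bar> \<le> L"
        unfolding L_def using \<gamma> by (intro member_le_sum fin) auto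
      then show ?thesis by linarith
    qed (use \<open>0 \<le> L\<close> in linarith)
  qed
qed

text \<open>Without convergence \<open>infsum\<close> has the default value \<open>0\<close>, so the
  estimates below carry summability as a hypothesis.\<close>

definition poincare :: "(('m \<Rightarrow> 'm) \<Rightarrow> real) \<Rightarrow> real \<Rightarrow> real" where
  "poincare m s = infsum (\<lambda>\<gamma>. exp (- s * m \<gamma>)) \<Gamma>"

lemma poincare_pos:
  assumes "(\<lambda>\<gamma>. exp (- s * m \<gamma>)) summable_on \<Gamma>"
  shows "poincare m s > 0"
proof -
  have "0 < sum (\<lambda>\<gamma>. exp (- s * m \<gamma>)) {id}" by simp
  also have "\<dots> \<le> poincare m s"
    unfolding poincare_def using assms by (intro finite_sum_le_infsum) auto
  finally show ?thesis .
qed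

text \<open>The bound \<open>s \<le> 2\<close> is what frees the factor \<open>exp (2 * C)\<close>
  from \<open>s\<close>.\<close>

lemma exp_le_const:
  fixes s x y C :: real
  assumes "x \<le> y + C" "0 \<le> C" "0 \<le> s" "s \<le> 2"
  shows "exp (- s * y) \<le> exp (2 * C) * exp (- s * x)"
proof -
  have "s * x \<le> s * (y + C)" using assms by (intro mult_left_mono) auto
  moreover have "s * C \<le> 2 * C" using assms by (intro mult_right_mono) auto
  ultimately have "- s * y \<le> 2 * C + - s * x" by (simp add: algebra_simps)
  then show ?thesis by (simp add: exp_add[symmetric])
qed

text \<open>Left translation by \<open>inv \<gamma>\<close> embeds the shadow in \<Gamma> and lowers
  the magnitude by \<open>m \<gamma>\<close> up to a constant.\<close>

lemma shadow_sum_upper: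
  assumes "roughly_additive m" "\<epsilon> > 0"
  obtains C where "C > 0"
    "\<And>s \<gamma> E. 0 \<le> s \<Longrightarrow> s \<le> 2 \<Longrightarrow> (\<lambda>\<gamma>. exp (- s * m \<gamma>)) summable_on \<Gamma> \<Longrightarrow> \<gamma> \<in> \<Gamma> \<Longrightarrow> finite E \<Longrightarrow>
      E \<subseteq> shadow \<epsilon> \<gamma> \<Longrightarrow> (\<Sum>\<eta>\<in>E. exp (- s * m \<eta>)) \<le> C * exp (- s * m \<gamma>) * poincare m s"
proof -
  obtain C0 where C0: "\<And>\<gamma> \<eta>. \<gamma> \<in> \<Gamma> \<Longrightarrow> \<eta> \<in> shadow \<epsilon> \<gamma> \<Longrightarrow> \<bar>m \<eta> - m \<gamma> - m (inv \<gamma> \<circ> \<eta>)\<bar> \<le> C0"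
    using roughly_additive_shadow[OF assms] by metis
  define C where "C = \<bar>C0\<bar>"
  show ?thesis
  proof (rule that[of "exp (2 * C)"])
    fix s \<gamma> E
    assume s: "0 \<le> s" "s \<le> 2" and summ: "(\<lambda>\<gamma>. exp (- s * m \<gamma>)) summable_on \<Gamma>"
      and \<gamma>: "\<gamma> \<in> \<Gamma>" and E: "finite E" "E \<subseteq> shadow \<epsilon> \<gamma>"
    have in_\<Gamma>: "\<eta> \<in> \<Gamma>" if "\<eta> \<in> E" for \<eta> using that E by (auto simp: shadow_def)
    have "(\<Sum>\<eta>\<in>E. exp (- s * m \<eta>)) \<le> exp (2 * C) * exp (- s * m \<gamma>) * real 1 * infsum (\<lambda>\<gamma>. exp (- s * m \<gamma>)) \<Gamma>"
    proof (rule sum_le_of_finite_to_one[where f = "\<lambda>\<eta>. inv \<gamma> \<circ> \<eta>"])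
      show "(\<lambda>\<eta>. inv \<gamma> \<circ> \<eta>) ` E \<subseteq> \<Gamma>" using in_\<Gamma> \<gamma> by auto
      fix \<eta> assume \<eta>: "\<eta> \<in> E"
      have "exp (- s * m \<eta>) \<le> exp (2 * C) * exp (- s * (m \<gamma> + m (inv \<gamma> \<circ> \<eta>)))"
        using C0[OF \<gamma>, of \<eta>] \<eta> E s by (intro exp_le_const) (auto simp: C_def)
      also have "\<dots> = exp (2 * C) * exp (- s * m \<gamma>) * exp (- s * m (inv \<gamma> \<circ> \<eta>))"
        by (simp add: algebra_simps exp_add[symmetric])
      finally show "exp (- s * m \<eta>) \<le> \<dots>" .
    next
      fix b assume "b \<in> (\<lambda>\<eta>. inv \<gamma> \<circ> \<eta>) ` E"
      have "{a \<in> E. inv \<gamma> \<circ> a = b} \<subseteq> {\<gamma> \<circ> b}"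
        using in_\<Gamma> \<gamma> by auto
      then show "card {a \<in> E. inv \<gamma> \<circ> a = b} \<le> 1"
        using card_mono[of "{\<gamma> \<circ> b}"] by fastforce
    qed (use E summ in auto)
    then show "(\<Sum>\<eta>\<in>E. exp (- s * m \<eta>)) \<le> exp (2 * C) * exp (- s * m \<gamma>) * poincare m s"
      by (simp add: poincare_def)
  qed simp
qed

text \<open>The order of the magnitudes decides which shadow engulfs. If \<open>\<gamma>\<close>
  lies in the shadow of \<open>\<gamma>'\<close>, rough additivity and
  \<open>m \<gamma> \<le> m \<gamma>'\<close> bound
  \<open>m (inv \<gamma>' \<circ> \<gamma>)\<close>, so by properness this case is again one of
  finitely many relative positions. They enter \<open>\<Phi>'\<close> inverted.\<close>

lemma shadow_engulf:
  assumes "roughly_additive m" "proper m" "\<epsilon> > 0"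
  obtains \<delta> where "\<delta> > 0"
    "\<And>\<gamma> \<gamma>'. \<gamma> \<in> \<Gamma> \<Longrightarrow> \<gamma>' \<in> \<Gamma> \<Longrightarrow> shadow \<epsilon> \<gamma> \<inter> shadow \<epsilon> \<gamma>' \<noteq> {} \<Longrightarrow> m \<gamma> \<le> m \<gamma>' \<Longrightarrow>
      shadow \<epsilon> \<gamma>' \<subseteq> shadow \<delta> \<gamma>"
proof -
  have e2: "\<epsilon>/2 > 0" using assms by simp
  obtain \<Phi> where \<Phi>: "finite \<Phi>" "\<Phi> \<subseteq> \<Gamma>"
    "\<And>\<gamma> \<gamma>' \<eta>. \<gamma> \<in> \<Gamma> \<Longrightarrow> \<gamma>' \<in> \<Gamma> \<Longrightarrow> \<eta> \<in> shadow \<epsilon> \<gamma> \<Longrightarrow> \<eta> \<in> shadow \<epsilon> \<gamma>' \<Longrightarrow>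
      inv \<gamma> \<circ> \<gamma>' \<in> \<Phi> \<or> \<gamma>' \<in> shadow (\<epsilon>/2) \<gamma> \<or> \<gamma> \<in> shadow (\<epsilon>/2) \<gamma>'"
    using shadow_cases[OF assms(3)] by metis
  obtain C where C: "\<And>\<gamma> \<eta>. \<gamma> \<in> \<Gamma> \<Longrightarrow> \<eta> \<in> shadow (\<epsilon>/2) \<gamma> \<Longrightarrow> \<bar>m \<eta> - m \<gamma> - m (inv \<gamma> \<circ> \<eta>)\<bar> \<le> C"
    using roughly_additive_shadow[OF assms(1) e2] by metis
  define \<Phi>' where "\<Phi>' = \<Phi> \<union> inv ` {\<gamma>\<in>\<Gamma>. m \<gamma> \<le> C}"
  have \<Phi>': "finite \<Phi>'" "\<Phi>' \<subseteq> \<Gamma>" using \<Phi>(1,2) assms(2) by (auto simp: \<Phi>'_def proper_def)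
  obtain \<delta>1 where \<delta>1: "\<delta>1 > 0" "\<And>\<gamma> \<phi>. \<gamma> \<in> \<Gamma> \<Longrightarrow> \<phi> \<in> \<Phi>' \<Longrightarrow> shadow \<epsilon> (\<gamma> \<circ> \<phi>) \<subseteq> shadow \<delta>1 \<gamma>"
    using shadow_comp_finite[OF \<Phi>' assms(3)] by metis
  obtain \<delta>2 where \<delta>2: "\<delta>2 > 0"
    "\<And>\<gamma> \<gamma>'. \<gamma> \<in> \<Gamma> \<Longrightarrow> \<gamma>' \<in> shadow (\<epsilon>/2) \<gamma> \<Longrightarrow> shadow (\<epsilon>/2) \<gamma>' \<subseteq> shadow \<delta>2 \<gamma>"
    using shadow_trans[OF e2] by metis
  show ?thesis
  proof (rule that[of "min \<delta>1 \<delta>2"])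
    fix \<gamma> \<gamma>'
    assume *: "\<gamma> \<in> \<Gamma>" "\<gamma>' \<in> \<Gamma>" "shadow \<epsilon> \<gamma> \<inter> shadow \<epsilon> \<gamma>' \<noteq> {}" "m \<gamma> \<le> m \<gamma>'"
    then obtain \<eta> where "\<eta> \<in> shadow \<epsilon> \<gamma>" "\<eta> \<in> shadow \<epsilon> \<gamma>'" by blast
    from \<Phi>(3)[OF *(1,2) this]
    consider "inv \<gamma> \<circ> \<gamma>' \<in> \<Phi>'" | "\<gamma>' \<in> shadow (\<epsilon>/2) \<gamma>"
    proof (elim disjE)
      assume "\<gamma> \<in> shadow (\<epsilon>/2) \<gamma>'"
      from C[OF *(2) this] *(4) have "m (inv \<gamma>' \<circ> \<gamma>) \<le> C" by linarith
      then have "inv (inv \<gamma>' \<circ> \<gamma>) \<in> \<Phi>'" using * by (simp add: \<Phi>'_def)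
      then show ?thesis using that(1) * by (simp add: inv_comp)
    qed (use that in \<open>auto simp: \<Phi>'_def\<close>)
    then show "shadow \<epsilon> \<gamma>' \<subseteq> shadow (min \<delta>1 \<delta>2) \<gamma>"
    proof cases
      case 1
      from \<delta>1(2)[OF *(1) this] have "shadow \<epsilon> \<gamma>' \<subseteq> shadow \<delta>1 \<gamma>" using * by simp
      then show ?thesis using shadow_mono[of "min \<delta>1 \<delta>2" \<delta>1 \<gamma>] by auto
    next
      case 2
      have "shadow \<epsilon> \<gamma>' \<subseteq> shadow (\<epsilon>/2) \<gamma>'" using assms(3) by (intro shadow_mono) simp
      also have "\<dots> \<subseteq> shadow \<delta>2 \<gamma>" by (rule \<delta>2(2)[OF *(1) 2])
      also have "\<dots> \<subseteq> shadow (min \<delta>1 \<delta>2) \<gamma>" by (intro shadow_mono) simp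
      finally show ?thesis .
    qed
  qed (use \<delta>1(1) \<delta>2(1) in auto)
qed

end

text \<open>\<open>F\<close> and \<open>e0\<close> are a finite displacing set and its margin.
  Inserting a suitable element of \<open>F\<close> aligns any two elements, at bounded cost in
  magnitude and multiplicity.\<close>

locale spread_compactification = convergence_compactification \<Gamma> d
  for \<Gamma> :: "('m::metric_space \<Rightarrow> 'm) set"
    and d :: "('m \<Rightarrow> 'm) + 'm \<Rightarrow> ('m \<Rightarrow> 'm) + 'm \<Rightarrow> real" +
  fixes F :: "('m \<Rightarrow> 'm) set" and e0 :: real
  assumes finite_F: "finite F" and F_sub: "F \<subseteq> \<Gamma>" and e0_pos: "e0 > 0"
    and spread: "a \<in> X \<Longrightarrow> q \<in> X \<Longrightarrow> \<exists>f\<in>F. d (sum_act f a) q > e0"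
begin

lemma spread_elem:
  assumes "\<gamma> \<in> \<Gamma>" "\<eta> \<in> \<Gamma>"
  shows "\<exists>f\<in>F. d (Inl (f \<circ> \<eta>)) (Inl (inv \<gamma>)) > e0"
  using spread[of "Inl \<eta>" "Inl (inv \<gamma>)"] assms by simp

text \<open>Conversely \<Gamma> is mapped into the shadow by
  \<open>\<gamma> \<circ> f \<eta> \<circ> \<eta>\<close>, where \<open>f \<eta> \<in> F\<close>
  aligns \<open>\<eta>\<close> with \<open>\<gamma>\<close>. The map is at most
  \<open>card F\<close> to one, since the product and the factor \<open>f \<eta>\<close> determine
  \<open>\<eta>\<close>.\<close>

lemma shadow_sum_lower:
  assumes "roughly_additive m" "\<epsilon> \<le> e0"
  obtains C where "C > 0"
    "\<And>s \<gamma>. 0 \<le> s \<Longrightarrow> s \<le> 2 \<Longrightarrow> (\<lambda>\<gamma>. exp (- s * m \<gamma>)) summable_on \<Gamma> \<Longrightarrow> \<gamma> \<in> \<Gamma> \<Longrightarrow>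
      exp (- s * m \<gamma>) * poincare m s \<le> C * infsum (\<lambda>\<eta>. exp (- s * m \<eta>)) (shadow \<epsilon> \<gamma>)"
proof -
  obtain C0 where C0: "\<And>\<gamma> \<eta>. \<gamma> \<in> \<Gamma> \<Longrightarrow> \<eta> \<in> \<Gamma> \<Longrightarrow> d (Inl \<eta>) (Inl (inv \<gamma>)) > e0 \<Longrightarrow>
    \<bar>m (\<gamma> \<circ> \<eta>) - m \<gamma> - m \<eta>\<bar> \<le> C0"
    using roughly_additive_comp[OF assms(1) e0_pos] by metis
  obtain C1 where C1: "\<And>\<gamma> \<phi>. \<gamma> \<in> \<Gamma> \<Longrightarrow> \<phi> \<in> F \<Longrightarrow> \<bar>m (\<phi> \<circ> \<gamma>) - m \<gamma>\<bar> \<le> C1"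
    using roughly_additive_left[OF assms(1) finite_F F_sub] by metis
  define C where "C = \<bar>C0\<bar> + \<bar>C1\<bar>"
  have "F \<noteq> {}" using spread_elem[OF id_in id_in] by auto
  then have card_F: "card F > 0" using finite_F by (simp add: card_gt_0_iff)
  show ?thesis
  proof (rule that[of "exp (2 * C) * real (card F)"])
    fix s \<gamma>
    assume s: "0 \<le> s" "s \<le> 2" and summ: "(\<lambda>\<gamma>. exp (- s * m \<gamma>)) summable_on \<Gamma>" and \<gamma>: "\<gamma> \<in> \<Gamma>"
    define W where "W = exp (2 * C) * real (card F) * infsum (\<lambda>\<eta>. exp (- s * m \<eta>)) (shadow \<epsilon> \<gamma>)"
    obtain f where f: "\<And>\<eta>. \<eta> \<in> \<Gamma> \<Longrightarrow> f \<eta> \<in> F" "\<And>\<eta>. \<eta> \<in> \<Gamma> \<Longrightarrow> d (Inl (f \<eta> \<circ> \<eta>)) (Inl (inv \<gamma>)) > e0"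
      using spread_elem[OF \<gamma>] by metis
    have f_in: "f \<eta> \<in> \<Gamma>" if "\<eta> \<in> \<Gamma>" for \<eta> using f(1)[OF that] F_sub by blast
    have sub: "shadow \<epsilon> \<gamma> \<subseteq> \<Gamma>" by (auto simp: shadow_def)
    have "(\<Sum>\<eta>\<in>E. exp (- s * m \<gamma>) * exp (- s * m \<eta>)) \<le> W" if E: "finite E" "E \<subseteq> \<Gamma>" for E
      unfolding W_def
    proof (rule sum_le_of_finite_to_one[where f = "\<lambda>\<eta>. \<gamma> \<circ> (f \<eta> \<circ> \<eta>)"])
      show "(\<lambda>\<eta>. \<gamma> \<circ> (f \<eta> \<circ> \<eta>)) ` E \<subseteq> shadow \<epsilon> \<gamma>"
      proof (rule image_subsetI)
        fix \<eta> assume "\<eta> \<in> E"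
        then have \<eta>: "\<eta> \<in> \<Gamma>" using E by blast
        show "\<gamma> \<circ> (f \<eta> \<circ> \<eta>) \<in> shadow \<epsilon> \<gamma>"
          using f(2)[OF \<eta>] assms(2) \<gamma> \<eta> f_in[OF \<eta>] by (simp add: shadow_comp_iff)
      qed
      show "(\<lambda>\<eta>. exp (- s * m \<eta>)) summable_on shadow \<epsilon> \<gamma>"
        using summable_on_subset_banach[OF summ sub] .
      fix \<eta> assume "\<eta> \<in> E"
      then have \<eta>: "\<eta> \<in> \<Gamma>" using E by blast
      have "exp (- s * m \<gamma>) * exp (- s * m \<eta>) = exp (- s * (m \<gamma> + m \<eta>))"
        by (simp add: algebra_simps exp_add[symmetric])
      also have "\<dots> \<le> exp (2 * C) * exp (- s * m (\<gamma> \<circ> (f \<eta> \<circ> \<eta>)))"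
        using C0[OF \<gamma> comp_in[OF f_in[OF \<eta>] \<eta>] f(2)[OF \<eta>]] C1[OF \<eta> f(1)[OF \<eta>]] s
        by (intro exp_le_const) (auto simp: C_def)
      finally show "exp (- s * m \<gamma>) * exp (- s * m \<eta>) \<le> \<dots>" .
    next
      fix b assume "b \<in> (\<lambda>\<eta>. \<gamma> \<circ> (f \<eta> \<circ> \<eta>)) ` E"
      have "{\<eta> \<in> E. \<gamma> \<circ> (f \<eta> \<circ> \<eta>) = b} \<subseteq> (\<lambda>h. inv h \<circ> (inv \<gamma> \<circ> b)) ` F"
      proof clarify
        fix \<eta> assume "\<eta> \<in> E"
        then have "\<eta> \<in> \<Gamma>" using E by blast
        then show "\<eta> \<in> (\<lambda>h. inv h \<circ> (inv \<gamma> \<circ> (\<gamma> \<circ> (f \<eta> \<circ> \<eta>)))) ` F"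
          using f(1) f_in \<gamma> by (intro image_eqI[of _ _ "f \<eta>"]) simp_all
      qed
      then show "card {\<eta> \<in> E. \<gamma> \<circ> (f \<eta> \<circ> \<eta>) = b} \<le> card F"
        using surj_card_le[OF finite_F] by blast
    qed (use E in auto)
    then have "infsum (\<lambda>\<eta>. exp (- s * m \<gamma>) * exp (- s * m \<eta>)) \<Gamma> \<le> W"
      by (intro infsum_le_finite_sums summable_on_cmult_right summ)
    then show "exp (- s * m \<gamma>) * poincare m s \<le>
        exp (2 * C) * real (card F) * infsum (\<lambda>\<eta>. exp (- s * m \<eta>)) (shadow \<epsilon> \<gamma>)"
      by (simp add: poincare_def W_def infsum_cmult_right')
  qed (use card_F in simp)
qed

text \<open>Each term is at most \<open>C\<close> times the proportion of the mass that its shadow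
  carries, and the proportions of disjoint shadows add up to at most one.\<close>

lemma disjoint_shadows_sum:
  assumes "roughly_additive m" "\<epsilon> \<le> e0"
  obtains C where "C > 0"
    "\<And>s J. 0 \<le> s \<Longrightarrow> s \<le> 2 \<Longrightarrow> (\<lambda>\<gamma>. exp (- s * m \<gamma>)) summable_on \<Gamma> \<Longrightarrow> finite J \<Longrightarrow> J \<subseteq> \<Gamma> \<Longrightarrow>
      (\<forall>\<gamma>\<in>J. \<forall>\<gamma>'\<in>J. \<gamma> \<noteq> \<gamma>' \<longrightarrow> shadow \<epsilon> \<gamma> \<inter> shadow \<epsilon> \<gamma>' = {}) \<Longrightarrow>
      (\<Sum>\<gamma>\<in>J. exp (- s * m \<gamma>)) \<le> C"
proof -
  obtain C where C: "C > 0"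
    "\<And>s \<gamma>. 0 \<le> s \<Longrightarrow> s \<le> 2 \<Longrightarrow> (\<lambda>\<gamma>. exp (- s * m \<gamma>)) summable_on \<Gamma> \<Longrightarrow> \<gamma> \<in> \<Gamma> \<Longrightarrow>
      exp (- s * m \<gamma>) * poincare m s \<le> C * infsum (\<lambda>\<eta>. exp (- s * m \<eta>)) (shadow \<epsilon> \<gamma>)"
    using shadow_sum_lower[OF assms] by metis
  show ?thesis
  proof (rule that[OF C(1)])
    fix s J
    assume s: "0 \<le> s" "s \<le> 2" and summ: "(\<lambda>\<gamma>. exp (- s * m \<gamma>)) summable_on \<Gamma>"
      and J: "finite J" "J \<subseteq> \<Gamma>"
      and disj: "\<forall>\<gamma>\<in>J. \<forall>\<gamma>'\<in>J. \<gamma> \<noteq> \<gamma>' \<longrightarrow> shadow \<epsilon> \<gamma> \<inter> shadow \<epsilon> \<gamma>' = {}"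
    have sub: "shadow \<epsilon> \<gamma> \<subseteq> \<Gamma>" for \<gamma> by (auto simp: shadow_def)
    have summ': "(\<lambda>\<gamma>. exp (- s * m \<gamma>)) summable_on A" if "A \<subseteq> \<Gamma>" for A
      using summable_on_subset_banach[OF summ that] .
    have "(\<Sum>\<gamma>\<in>J. exp (- s * m \<gamma>)) * poincare m s = (\<Sum>\<gamma>\<in>J. exp (- s * m \<gamma>) * poincare m s)"
      by (simp add: sum_distrib_right)
    also have "\<dots> \<le> (\<Sum>\<gamma>\<in>J. C * infsum (\<lambda>\<eta>. exp (- s * m \<eta>)) (shadow \<epsilon> \<gamma>))"
      using C(2)[OF s summ] J(2) by (intro sum_mono) blast
    also have "\<dots> = C * (\<Sum>\<gamma>\<in>J. infsum (\<lambda>\<eta>. exp (- s * m \<eta>)) (shadow \<epsilon> \<gamma>))"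
      by (simp add: sum_distrib_left)
    also have "(\<Sum>\<gamma>\<in>J. infsum (\<lambda>\<eta>. exp (- s * m \<eta>)) (shadow \<epsilon> \<gamma>)) =
        infsum (\<lambda>\<eta>. exp (- s * m \<eta>)) (\<Union>\<gamma>\<in>J. shadow \<epsilon> \<gamma>)"
      using disj by (intro sum_infsum J(1) summ' sub) auto
    also have "\<dots> \<le> poincare m s"
      unfolding poincare_def by (intro infsum_mono2 summ' summ) (auto simp: shadow_def)
    finally have "(\<Sum>\<gamma>\<in>J. exp (- s * m \<gamma>)) * poincare m s \<le> C * poincare m s"
      using C(1) by simp
    then show "(\<Sum>\<gamma>\<in>J. exp (- s * m \<gamma>)) \<le> C"
      using poincare_pos[OF summ] by simp
  qed
qed

end

lemma sum_UN_le:
  fixes f :: "'b \<Rightarrow> real"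
  assumes "finite J" "\<And>x. x \<in> J \<Longrightarrow> finite (A x)" "\<And>y. 0 \<le> f y"
  shows "sum f (\<Union>x\<in>J. A x) \<le> (\<Sum>x\<in>J. sum f (A x))"
  using assms(1,2)
proof (induction J rule: finite_induct)
  case (insert x J)
  have "sum f (A x \<union> (\<Union>x\<in>J. A x)) \<le> sum f (A x) + sum f (\<Union>x\<in>J. A x)"
    using insert sum.union_inter[of "A x" "\<Union>x\<in>J. A x" f]
      sum_nonneg[of "A x \<inter> (\<Union>x\<in>J. A x)" f] assms(3) by simp
  with insert show ?case by simp
qed simp

section \<open>The maximal inequality and the quadratic estimate\<close>

context spread_compactification
begin

text \<open>The covering selects disjoint shadows by means of \<open>m\<close>, but the sum over
  their centres is bounded through \<open>m0\<close> and \<open>m1\<close>: each of these has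
  bounded sums over disjoint shadows, and passing from \<open>m\<close> to the smaller of the two
  gains the factor \<open>exp (- c * R)\<close>.\<close>

lemma maximal_inequality:
  fixes t :: real
  assumes ra: "roughly_additive m0" "roughly_additive m1" and t: "0 < t" "t < 1"
    and m_def: "m = (\<lambda>\<gamma>. t * m0 \<gamma> + (1 - t) * m1 \<gamma>)"
    and "proper m" and \<epsilon>: "0 < \<epsilon>" "\<epsilon> \<le> e0"
  obtains C c where "C > 0" "c > 0"
    "\<And>R s E. 0 \<le> R \<Longrightarrow> 1 \<le> s \<Longrightarrow> s \<le> 2 \<Longrightarrow> (\<lambda>\<gamma>. exp (- s * m0 \<gamma>)) summable_on \<Gamma> \<Longrightarrow>
      (\<lambda>\<gamma>. exp (- s * m1 \<gamma>)) summable_on \<Gamma> \<Longrightarrow> (\<lambda>\<gamma>. exp (- s * m \<gamma>)) summable_on \<Gamma> \<Longrightarrow> finite E \<Longrightarrow>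
      (\<forall>\<eta>\<in>E. \<exists>\<gamma>\<in>\<Gamma>. \<eta> \<in> shadow \<epsilon> \<gamma> \<and> R < \<bar>m0 \<gamma> - m1 \<gamma>\<bar>) \<Longrightarrow>
      (\<Sum>\<eta>\<in>E. exp (- s * m \<eta>)) \<le> C * exp (- c * R) * poincare m s"
proof -
  have ra_m: "roughly_additive m"
    unfolding m_def by (rule roughly_additive_lincomb[OF ra])
  obtain \<delta> where \<delta>: "\<delta> > 0"
    "\<And>\<gamma> \<gamma>'. \<gamma> \<in> \<Gamma> \<Longrightarrow> \<gamma>' \<in> \<Gamma> \<Longrightarrow> shadow \<epsilon> \<gamma> \<inter> shadow \<epsilon> \<gamma>' \<noteq> {} \<Longrightarrow> m \<gamma> \<le> m \<gamma>' \<Longrightarrow>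
      shadow \<epsilon> \<gamma>' \<subseteq> shadow \<delta> \<gamma>"
    using shadow_engulf[OF ra_m \<open>proper m\<close> \<epsilon>(1)] by metis
  obtain C where C: "C > 0"
    "\<And>s \<gamma> E. 0 \<le> s \<Longrightarrow> s \<le> 2 \<Longrightarrow> (\<lambda>\<gamma>. exp (- s * m \<gamma>)) summable_on \<Gamma> \<Longrightarrow> \<gamma> \<in> \<Gamma> \<Longrightarrow> finite E \<Longrightarrow>
      E \<subseteq> shadow \<delta> \<gamma> \<Longrightarrow> (\<Sum>\<eta>\<in>E. exp (- s * m \<eta>)) \<le> C * exp (- s * m \<gamma>) * poincare m s"
    using shadow_sum_upper[OF ra_m \<delta>(1)] by metis
  obtain C0 where C0: "C0 > 0"
    "\<And>s J. 0 \<le> s \<Longrightarrow> s \<le> 2 \<Longrightarrow> (\<lambda>\<gamma>. exp (- s * m0 \<gamma>)) summable_on \<Gamma> \<Longrightarrow> finite J \<Longrightarrow> J \<subseteq> \<Gamma> \<Longrightarrow>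
      (\<forall>\<gamma>\<in>J. \<forall>\<gamma>'\<in>J. \<gamma> \<noteq> \<gamma>' \<longrightarrow> shadow \<epsilon> \<gamma> \<inter> shadow \<epsilon> \<gamma>' = {}) \<Longrightarrow>
      (\<Sum>\<gamma>\<in>J. exp (- s * m0 \<gamma>)) \<le> C0"
    using disjoint_shadows_sum[OF ra(1) \<epsilon>(2)] by metis
  obtain C1 where C1: "C1 > 0"
    "\<And>s J. 0 \<le> s \<Longrightarrow> s \<le> 2 \<Longrightarrow> (\<lambda>\<gamma>. exp (- s * m1 \<gamma>)) summable_on \<Gamma> \<Longrightarrow> finite J \<Longrightarrow> J \<subseteq> \<Gamma> \<Longrightarrow>
      (\<forall>\<gamma>\<in>J. \<forall>\<gamma>'\<in>J. \<gamma> \<noteq> \<gamma>' \<longrightarrow> shadow \<epsilon> \<gamma> \<inter> shadow \<epsilon> \<gamma>' = {}) \<Longrightarrow>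
      (\<Sum>\<gamma>\<in>J. exp (- s * m1 \<gamma>)) \<le> C1"
    using disjoint_shadows_sum[OF ra(2) \<epsilon>(2)] by metis
  define c where "c = min t (1 - t)"
  have c: "c > 0" "c \<le> t" "c \<le> 1 - t" using t by (auto simp: c_def)
  show ?thesis
  proof (rule that[of "C * (C0 + C1)" c])
    fix R s :: real and E
    assume R: "0 \<le> R" and s: "1 \<le> s" "s \<le> 2"
      and summ0: "(\<lambda>\<gamma>. exp (- s * m0 \<gamma>)) summable_on \<Gamma>"
      and summ1: "(\<lambda>\<gamma>. exp (- s * m1 \<gamma>)) summable_on \<Gamma>"
      and summ: "(\<lambda>\<gamma>. exp (- s * m \<gamma>)) summable_on \<Gamma>"
      and E: "finite E" "\<forall>\<eta>\<in>E. \<exists>\<gamma>\<in>\<Gamma>. \<eta> \<in> shadow \<epsilon> \<gamma> \<and> R < \<bar>m0 \<gamma> - m1 \<gamma>\<bar>"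
    have s0: "0 \<le> s" using s by simp
    obtain g where g: "\<And>\<eta>. \<eta> \<in> E \<Longrightarrow> g \<eta> \<in> \<Gamma>" "\<And>\<eta>. \<eta> \<in> E \<Longrightarrow> \<eta> \<in> shadow \<epsilon> (g \<eta>)"
      "\<And>\<eta>. \<eta> \<in> E \<Longrightarrow> R < \<bar>m0 (g \<eta>) - m1 (g \<eta>)\<bar>"
      using E(2) by metis
    have "\<exists>J\<subseteq>g ` E. (\<forall>x\<in>J. \<forall>y\<in>J. x \<noteq> y \<longrightarrow> shadow \<epsilon> x \<inter> shadow \<epsilon> y = {}) \<and>
        (\<Union>x\<in>g ` E. shadow \<epsilon> x) \<subseteq> (\<Union>x\<in>J. shadow \<delta> x)"
      by (rule vitali_finite[where rank = m]) (use E(1) g(1) \<delta>(2) in auto)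
    then obtain J where J: "J \<subseteq> g ` E" "(\<Union>x\<in>g ` E. shadow \<epsilon> x) \<subseteq> (\<Union>x\<in>J. shadow \<delta> x)"
      and disj: "\<forall>x\<in>J. \<forall>y\<in>J. x \<noteq> y \<longrightarrow> shadow \<epsilon> x \<inter> shadow \<epsilon> y = {}"
      by (elim exE conjE) (rule that; assumption)
    have J': "finite J" "J \<subseteq> \<Gamma>"
    proof -
      show "finite J" using finite_subset[OF J(1)] E(1) by simp
      show "J \<subseteq> \<Gamma>" using J(1) g(1) by auto
    qed
    have E_sub: "E \<subseteq> (\<Union>x\<in>J. E \<inter> shadow \<delta> x)" using g(2) J(2) by blast
    have dens: "exp (- s * m \<gamma>) \<le> exp (- c * R) * (exp (- s * m0 \<gamma>) + exp (- s * m1 \<gamma>))"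
      if "\<gamma> \<in> J" for \<gamma>
    proof -
      have u: "R < \<bar>m0 \<gamma> - m1 \<gamma>\<bar>" using that J(1) g(3) by blast
      have cR: "c * R \<le> s * (c * R)" using mult_right_mono[OF s(1), of "c * R"] c(1) R by simp
      \<comment> \<open>\<open>m = m1 + t * (m0 - m1) = m0 + (1 - t) * (m1 - m0)\<close>, so
        \<open>m\<close> exceeds the smaller of \<open>m0\<close> and \<open>m1\<close> by at least
        \<open>c\<close> times their distance.\<close>
      have "m0 \<gamma> + c * R \<le> m \<gamma> \<or> m1 \<gamma> + c * R \<le> m \<gamma>"
      proof (cases "m0 \<gamma> > m1 \<gamma>")
        case True
        then have "c * R \<le> t * (m0 \<gamma> - m1 \<gamma>)" using u c R by (intro mult_mono) auto
        then show ?thesis by (simp add: m_def algebra_simps)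
      next
        case False
        then have "c * R \<le> (1 - t) * (m1 \<gamma> - m0 \<gamma>)" using u c R by (intro mult_mono) auto
        then show ?thesis by (simp add: m_def algebra_simps)
      qed
      then obtain k where k: "k = m0 \<gamma> \<or> k = m1 \<gamma>" "k + c * R \<le> m \<gamma>" by blast
      have "s * (k + c * R) \<le> s * m \<gamma>" using k(2) s0 by (rule mult_left_mono)
      then have "- s * m \<gamma> \<le> - c * R + - s * k" using cR by (simp add: algebra_simps)
      then have "exp (- s * m \<gamma>) \<le> exp (- c * R) * exp (- s * k)"
        by (simp add: exp_add[symmetric])
      also have "\<dots> \<le> exp (- c * R) * (exp (- s * m0 \<gamma>) + exp (- s * m1 \<gamma>))"
        using k(1) by (intro mult_left_mono) auto
      finally show ?thesis .
    qed
    have P: "poincare m s > 0" by (rule poincare_pos[OF summ])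
    have "(\<Sum>\<eta>\<in>E. exp (- s * m \<eta>)) \<le> (\<Sum>\<eta>\<in>(\<Union>x\<in>J. E \<inter> shadow \<delta> x). exp (- s * m \<eta>))"
      using E_sub J'(1) E(1) by (intro sum_mono2) auto
    also have "\<dots> \<le> (\<Sum>x\<in>J. \<Sum>\<eta>\<in>E \<inter> shadow \<delta> x. exp (- s * m \<eta>))"
      using J'(1) E(1) by (intro sum_UN_le) auto
    also have "\<dots> \<le> (\<Sum>x\<in>J. C * exp (- s * m x) * poincare m s)"
      using E(1) J'(2) by (intro sum_mono C(2)[OF s0 s(2) summ]) auto
    also have "\<dots> \<le> (\<Sum>x\<in>J. C * (exp (- c * R) * (exp (- s * m0 x) + exp (- s * m1 x))) * poincare m s)"
      using C(1) P by (intro sum_mono mult_right_mono mult_left_mono dens) auto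
    also have "\<dots> = C * exp (- c * R) * poincare m s * ((\<Sum>x\<in>J. exp (- s * m0 x)) + (\<Sum>x\<in>J. exp (- s * m1 x)))"
      by (simp add: sum_distrib_left sum.distrib[symmetric] algebra_simps)
    also have "\<dots> \<le> C * exp (- c * R) * poincare m s * (C0 + C1)"
      using C(1) P C0(2)[OF s0 s(2) summ0 J' disj] C1(2)[OF s0 s(2) summ1 J' disj]
      by (intro mult_left_mono add_mono) auto
    finally show "(\<Sum>\<eta>\<in>E. exp (- s * m \<eta>)) \<le> C * (C0 + C1) * exp (- c * R) * poincare m s"
      by (simp add: mult_ac)
  qed (use C(1) C0(1) C1(1) c(1) in auto)
qed

text \<open>A finite partial sum is continuous in \<open>s\<close>, so the uniform bound survives as
  \<open>s\<close> decreases to \<open>1\<close>.\<close>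

lemma summable_at_one:
  assumes summ: "\<And>s. 1 < s \<Longrightarrow> s \<le> 2 \<Longrightarrow> (\<lambda>\<gamma>. exp (- s * m \<gamma>)) summable_on \<Gamma>"
    and bound: "\<And>s. 1 < s \<Longrightarrow> s \<le> 2 \<Longrightarrow> poincare m s \<le> K"
  shows "(\<lambda>\<gamma>. exp (- 1 * m \<gamma>)) summable_on \<Gamma>"
proof (rule nonneg_bdd_above_summable_on)
  show "bdd_above (sum (\<lambda>\<gamma>. exp (- 1 * m \<gamma>)) ` {E. E \<subseteq> \<Gamma> \<and> finite E})"
  proof (rule bdd_aboveI2)
    fix E assume "E \<in> {E. E \<subseteq> \<Gamma> \<and> finite E}"
    then have E: "E \<subseteq> \<Gamma>" "finite E" by auto
    define s where "s = (\<lambda>n. 1 + inverse (real (Suc n)))"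
    have "s \<longlonglongrightarrow> 1 + 0"
      unfolding s_def by (intro tendsto_intros LIMSEQ_inverse_real_of_nat)
    then have "(\<lambda>n. \<Sum>\<gamma>\<in>E. exp (- s n * m \<gamma>)) \<longlonglongrightarrow> (\<Sum>\<gamma>\<in>E. exp (- 1 * m \<gamma>))"
      by (intro tendsto_intros) simp
    moreover have "(\<Sum>\<gamma>\<in>E. exp (- s n * m \<gamma>)) \<le> K" for n
    proof -
      have s: "1 < s n" "s n \<le> 2" by (auto simp: s_def field_simps)
      have "(\<Sum>\<gamma>\<in>E. exp (- s n * m \<gamma>)) \<le> poincare m (s n)"
        unfolding poincare_def using E by (intro finite_sum_le_infsum summ s) auto
      with bound[OF s] show ?thesis by simp
    qed
    ultimately show "(\<Sum>\<gamma>\<in>E. exp (- 1 * m \<gamma>)) \<le> K"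
      by (intro LIMSEQ_le_const2) auto
  qed
qed simp

lemma discrepancy_bounded:
  fixes t :: real
  assumes ra: "roughly_additive m0" "roughly_additive m1" and t: "0 < t" "t < 1"
    and m_def: "m = (\<lambda>\<gamma>. t * m0 \<gamma> + (1 - t) * m1 \<gamma>)"
    and summ0: "\<And>s. 1 < s \<Longrightarrow> (\<lambda>\<gamma>. exp (- s * m0 \<gamma>)) summable_on \<Gamma>"
    and summ1: "\<And>s. 1 < s \<Longrightarrow> (\<lambda>\<gamma>. exp (- s * m1 \<gamma>)) summable_on \<Gamma>"
    and summ: "\<And>s. 1 < s \<Longrightarrow> (\<lambda>\<gamma>. exp (- s * m \<gamma>)) summable_on \<Gamma>"
    and div: "\<not> (\<lambda>\<gamma>. exp (- 1 * m \<gamma>)) summable_on \<Gamma>"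
  shows "\<exists>B. \<forall>\<gamma>\<in>\<Gamma>. \<bar>m0 \<gamma> - m1 \<gamma>\<bar> \<le> B"
proof (rule ccontr)
  assume unbounded: "\<not> ?thesis"
  define u where "u = (\<lambda>\<gamma>. 1 * m0 \<gamma> + (- 1) * m1 \<gamma>)"
  have u: "u \<gamma> = m0 \<gamma> - m1 \<gamma>" for \<gamma> by (simp add: u_def)
  have ra_u: "roughly_additive u"
    unfolding u_def by (rule roughly_additive_lincomb[OF ra])
  have ra_m: "roughly_additive m"
    unfolding m_def by (rule roughly_additive_lincomb[OF ra])
  have "proper m"
    unfolding proper_def using finite_sublevel_summable_exp[OF summ[of 2]] by simp
  obtain \<delta>0 where \<delta>0: "\<delta>0 > 0"
    "\<And>\<gamma> \<gamma>'. \<gamma> \<in> \<Gamma> \<Longrightarrow> \<gamma>' \<in> shadow e0 \<gamma> \<Longrightarrow> shadow e0 \<gamma>' \<subseteq> shadow \<delta>0 \<gamma>"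
    using shadow_trans[OF e0_pos] by metis
  \<comment> \<open>A single size for both memberships of a product \<open>w (a, b)\<close>: in the
    shadow of \<open>k a\<close>, of size \<open>e0\<close>, and by transitivity in that of
    \<open>a\<close>, of size \<open>\<delta>0\<close>. Comparing two shadows costs a factor of two,
    so \<open>G\<close> is defined with \<open>\<delta>/2\<close>.\<close>
  define \<delta> where "\<delta> = min \<delta>0 e0"
  have \<delta>: "\<delta> > 0" "\<delta> \<le> \<delta>0" "\<delta> \<le> e0" using \<delta>0(1) e0_pos by (auto simp: \<delta>_def)
  have \<epsilon>: "0 < \<delta>/2" "\<delta>/2 \<le> e0" using \<delta> by auto
  obtain C c where C: "C > 0" and c: "c > 0" and maximal:
    "\<And>R s E. 0 \<le> R \<Longrightarrow> 1 \<le> s \<Longrightarrow> s \<le> 2 \<Longrightarrow> (\<lambda>\<gamma>. exp (- s * m0 \<gamma>)) summable_on \<Gamma> \<Longrightarrow>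
      (\<lambda>\<gamma>. exp (- s * m1 \<gamma>)) summable_on \<Gamma> \<Longrightarrow> (\<lambda>\<gamma>. exp (- s * m \<gamma>)) summable_on \<Gamma> \<Longrightarrow> finite E \<Longrightarrow>
      (\<forall>\<eta>\<in>E. \<exists>\<gamma>\<in>\<Gamma>. \<eta> \<in> shadow (\<delta>/2) \<gamma> \<and> R < \<bar>m0 \<gamma> - m1 \<gamma>\<bar>) \<Longrightarrow>
      (\<Sum>\<eta>\<in>E. exp (- s * m \<eta>)) \<le> C * exp (- c * R) * poincare m s"
    using maximal_inequality[OF ra t m_def \<open>proper m\<close> \<epsilon>] by metis
  \<comment> \<open>Chosen so that the elements outside \<open>G\<close> carry at most a quarter of
    the mass.\<close>
  define R where "R = max 0 (ln (4 * C) / c)"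
  have R: "0 \<le> R" "C * exp (- c * R) \<le> 1/4"
  proof -
    have "ln (4 * C) \<le> c * R"
      using c by (simp add: R_def max_def field_simps)
    then have "4 * C \<le> exp (c * R)"
      using C by (metis exp_le_cancel_iff exp_ln zero_less_mult_iff zero_less_numeral)
    then show "C * exp (- c * R) \<le> 1/4" by (simp add: exp_minus field_simps)
  qed (simp add: R_def)
  define G where "G = {\<eta>\<in>\<Gamma>. \<forall>\<gamma>\<in>\<Gamma>. \<eta> \<in> shadow (\<delta>/2) \<gamma> \<longrightarrow> \<bar>u \<gamma>\<bar> \<le> R}"

  obtain Ca where Ca: "\<And>\<gamma> \<eta>. \<gamma> \<in> \<Gamma> \<Longrightarrow> \<eta> \<in> \<Gamma> \<Longrightarrow> d (Inl \<eta>) (Inl (inv \<gamma>)) > e0 \<Longrightarrow>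
    \<bar>u (\<gamma> \<circ> \<eta>) - u \<gamma> - u \<eta>\<bar> \<le> Ca"
    using roughly_additive_comp[OF ra_u e0_pos] by metis
  obtain Cb where Cb: "\<And>\<gamma> \<phi>. \<gamma> \<in> \<Gamma> \<Longrightarrow> \<phi> \<in> F \<Longrightarrow> \<bar>u (\<phi> \<circ> \<gamma>) - u \<gamma>\<bar> \<le> Cb"
    using roughly_additive_left[OF ra_u finite_F F_sub] by metis
  \<comment> \<open>\<open>Cb\<close> pays for the factor from \<open>F\<close> in front of
    \<open>\<zeta>\<close> and \<open>Ca\<close> for the composition with \<open>a\<close>; a jump
    above \<open>2 * R\<close> remains.\<close>
  obtain \<zeta> where \<zeta>: "\<zeta> \<in> \<Gamma>" "\<bar>u \<zeta>\<bar> > 2 * R + Ca + Cb"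
    using unbounded unfolding u by (metis not_le)
  define Z where "Z = (\<lambda>f. f \<circ> \<zeta>) ` F"
  have Z: "finite Z" "Z \<subseteq> \<Gamma>" using finite_F F_sub \<zeta>(1) by (auto simp: Z_def)
  have "\<exists>z\<in>Z. d (Inl z) (Inl (inv a)) > e0" if "a \<in> \<Gamma>" for a
    using spread_elem[OF that \<zeta>(1)] by (auto simp: Z_def)
  then obtain z where z: "\<And>a. a \<in> \<Gamma> \<Longrightarrow> z a \<in> Z" "\<And>a. a \<in> \<Gamma> \<Longrightarrow> d (Inl (z a)) (Inl (inv a)) > e0"
    by metis
  define k where "k = (\<lambda>a. a \<circ> z a)"
  have z_in: "z a \<in> \<Gamma>" and k_in: "k a \<in> \<Gamma>" if "a \<in> \<Gamma>" for a
    using z(1)[OF that] Z(2) that by (auto simp: k_def)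
  have k_shadow: "k a \<in> shadow e0 a" if "a \<in> \<Gamma>" for a
    using z(2)[OF that] that z_in[OF that] by (simp add: k_def shadow_comp_iff)
  have jump: "\<bar>u (k a) - u a\<bar> > 2 * R" if a: "a \<in> \<Gamma>" for a
  proof -
    obtain f where f: "f \<in> F" "z a = f \<circ> \<zeta>" using z(1)[OF a] by (auto simp: Z_def)
    have "\<bar>u (z a) - u \<zeta>\<bar> \<le> Cb" using Cb[OF \<zeta>(1) f(1)] f(2) by simp
    moreover have "\<bar>u (k a) - u a - u (z a)\<bar> \<le> Ca"
      using Ca[OF a z_in[OF a] z(2)[OF a]] by (simp add: k_def)
    ultimately show ?thesis using \<zeta>(2) by linarith
  qed
  have "\<exists>f\<in>F. d (Inl (f \<circ> b)) (Inl (inv (k a))) > e0" if "a \<in> \<Gamma>" "b \<in> \<Gamma>" for a b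
    using spread_elem[OF k_in[OF that(1)] that(2)] .
  then obtain f where f: "\<And>a b. a \<in> \<Gamma> \<Longrightarrow> b \<in> \<Gamma> \<Longrightarrow> f a b \<in> F"
    "\<And>a b. a \<in> \<Gamma> \<Longrightarrow> b \<in> \<Gamma> \<Longrightarrow> d (Inl (f a b \<circ> b)) (Inl (inv (k a))) > e0"
    by metis
  have f_in: "f a b \<in> \<Gamma>" if "a \<in> \<Gamma>" "b \<in> \<Gamma>" for a b using f(1)[OF that] F_sub by blast
  define w where "w = (\<lambda>(a, b). k a \<circ> (f a b \<circ> b))"
  have w_in: "w (a, b) \<in> \<Gamma>" if "a \<in> \<Gamma>" "b \<in> \<Gamma>" for a b
    using that k_in f_in by (simp add: w_def)
  have w_k: "w (a, b) \<in> shadow e0 (k a)" if "a \<in> \<Gamma>" "b \<in> \<Gamma>" for a b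
    using f(2)[OF that] k_in[OF that(1)] f_in[OF that] that by (simp add: w_def shadow_comp_iff)
  have w_k': "w (a, b) \<in> shadow \<delta> (k a)" if "a \<in> \<Gamma>" "b \<in> \<Gamma>" for a b
    using w_k[OF that] shadow_mono[OF \<delta>(3)] by blast
  have w_a: "w (a, b) \<in> shadow \<delta> a" if "a \<in> \<Gamma>" "b \<in> \<Gamma>" for a b
    using w_k[OF that] \<delta>0(2)[OF that(1) k_shadow[OF that(1)]] shadow_mono[OF \<delta>(2)] by blast

  obtain C1 where C1: "\<And>\<gamma> \<phi>. \<gamma> \<in> \<Gamma> \<Longrightarrow> \<phi> \<in> Z \<Longrightarrow> \<bar>m (\<gamma> \<circ> \<phi>) - m \<gamma>\<bar> \<le> C1"
    using roughly_additive_right[OF ra_m Z] by metis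
  obtain C2 where C2: "\<And>\<gamma> \<phi>. \<gamma> \<in> \<Gamma> \<Longrightarrow> \<phi> \<in> F \<Longrightarrow> \<bar>m (\<phi> \<circ> \<gamma>) - m \<gamma>\<bar> \<le> C2"
    using roughly_additive_left[OF ra_m finite_F F_sub] by metis
  obtain C3 where C3: "\<And>\<gamma> \<eta>. \<gamma> \<in> \<Gamma> \<Longrightarrow> \<eta> \<in> \<Gamma> \<Longrightarrow> d (Inl \<eta>) (Inl (inv \<gamma>)) > e0 \<Longrightarrow>
    \<bar>m (\<gamma> \<circ> \<eta>) - m \<gamma> - m \<eta>\<bar> \<le> C3"
    using roughly_additive_comp[OF ra_m e0_pos] by metis
  obtain C4 where C4: "\<And>\<gamma> \<eta>. \<gamma> \<in> \<Gamma> \<Longrightarrow> \<eta> \<in> shadow (\<delta>/2) \<gamma> \<Longrightarrow> \<bar>m \<eta> - m \<gamma> - m (inv \<gamma> \<circ> \<eta>)\<bar> \<le> C4"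
    using roughly_additive_shadow[OF ra_m \<epsilon>(1)] by metis
  obtain L where L: "L \<ge> 0" "\<And>\<gamma>. \<gamma> \<in> \<Gamma> \<Longrightarrow> m \<gamma> \<ge> - L"
    using proper_bounded_below[OF \<open>proper m\<close>] by metis
  have m_k: "\<bar>m (k a) - m a\<bar> \<le> C1" if "a \<in> \<Gamma>" for a
    using C1[OF that z(1)[OF that]] by (simp add: k_def)
  have m_w: "m (w (a, b)) \<le> m a + m b + (\<bar>C1\<bar> + \<bar>C2\<bar> + \<bar>C3\<bar>)" if "a \<in> \<Gamma>" "b \<in> \<Gamma>" for a b
    using C3[OF k_in[OF that(1)] comp_in[OF f_in[OF that] that(2)] f(2)[OF that]]
      C2[OF that(2) f(1)[OF that]] m_k[OF that(1)] by (simp add: w_def)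

  obtain \<Phi> where \<Phi>: "finite \<Phi>" "\<Phi> \<subseteq> \<Gamma>"
    "\<And>\<gamma> \<gamma>' \<eta>. \<gamma> \<in> \<Gamma> \<Longrightarrow> \<gamma>' \<in> \<Gamma> \<Longrightarrow> \<eta> \<in> shadow \<delta> \<gamma> \<Longrightarrow> \<eta> \<in> shadow \<delta> \<gamma>' \<Longrightarrow>
      inv \<gamma> \<circ> \<gamma>' \<in> \<Phi> \<or> \<gamma>' \<in> shadow (\<delta>/2) \<gamma> \<or> \<gamma> \<in> shadow (\<delta>/2) \<gamma>'"
    using shadow_cases[OF \<delta>(1)] by metis
  \<comment> \<open>The bound for \<open>m (inv a' \<circ> k a)\<close> when \<open>a'\<close> is in
    the shadow of \<open>a\<close> and \<open>k a\<close> in that of \<open>a'\<close>: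
    \<open>C4\<close> is spent once per shadow, \<open>C1\<close> compares \<open>k a\<close> with
    \<open>a\<close>, and \<open>- L\<close> bounds \<open>m (inv a \<circ> a')\<close> from
    below.\<close>
  define \<Omega> where "\<Omega> = {\<gamma>\<in>\<Gamma>. m \<gamma> \<le> C1 + L + 2 * C4}"
  have \<Omega>: "finite \<Omega>" using \<open>proper m\<close> by (simp add: \<Omega>_def proper_def)
  \<comment> \<open>The finitely many positions of \<open>a'\<close> relative to \<open>a\<close>,
    or relative to \<open>k a\<close>; the latter are translated by
    \<open>inv a = z a \<circ> inv (k a)\<close>.\<close>
  define \<Psi>0 where "\<Psi>0 = \<Phi> \<union> (\<lambda>(z, \<phi>). z \<circ> \<phi>) ` (Z \<times> \<Phi>) \<union> (\<lambda>(z, \<omega>). z \<circ> inv \<omega>) ` (Z \<times> \<Omega>)"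
  \<comment> \<open>Either of \<open>a\<close> and \<open>a'\<close> may be the longer one, hence
    the closure under inversion.\<close>
  define \<Psi> where "\<Psi> = \<Psi>0 \<union> inv ` \<Psi>0"
  have fin\<Psi>: "finite \<Psi>" using \<Phi>(1) Z(1) \<Omega> by (simp add: \<Psi>_def \<Psi>0_def)
  text \<open>If \<open>a'\<close> lay in the shadow of both \<open>a\<close> and \<open>k a\<close>, then \<open>u\<close> could not jump by more
    than \<open>2 * R\<close> between these two elements, since \<open>a'\<close> is in \<open>G\<close>.\<close>
  have ordered: "inv a \<circ> a' \<in> \<Psi>0"
    if a: "a \<in> \<Gamma>" "b \<in> \<Gamma>" "a' \<in> G" "b' \<in> \<Gamma>" "w (a, b) = w (a', b')" and sh: "a' \<in> shadow (\<delta>/2) a"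
    for a a' b b'
  proof -
    have a': "a' \<in> \<Gamma>" using a(3) by (simp add: G_def)
    have "w (a, b) \<in> shadow \<delta> (k a)" "w (a, b) \<in> shadow \<delta> a'"
      using w_k'[OF a(1,2)] w_a[OF a' a(4)] a(5) by simp_all
    from \<Phi>(3)[OF k_in[OF a(1)] a' this] show ?thesis
    proof (elim disjE)
      assume "inv (k a) \<circ> a' \<in> \<Phi>"
      then have "z a \<circ> (inv (k a) \<circ> a') \<in> \<Psi>0"
        using z(1)[OF a(1)] unfolding \<Psi>0_def by force
      moreover have "z a \<circ> (inv (k a) \<circ> a') = inv a \<circ> a'"
        using a(1) z_in[OF a(1)] by (simp add: k_def inv_comp comp_assoc)
      ultimately show ?thesis by simp
    next
      assume "a' \<in> shadow (\<delta>/2) (k a)"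
      then have "\<bar>u (k a)\<bar> \<le> R" "\<bar>u a\<bar> \<le> R"
        using a(1,3) sh k_in by (auto simp: G_def)
      with jump[OF a(1)] show ?thesis by linarith
    next
      assume "k a \<in> shadow (\<delta>/2) a'"
      from C4[OF a' this] C4[OF a(1) sh] m_k[OF a(1)] L(2)[of "inv a \<circ> a'"] a(1) a'
      have "m (inv a' \<circ> k a) \<le> C1 + L + 2 * C4" by simp
      then have "inv a' \<circ> k a \<in> \<Omega>" using a(1) a' k_in by (simp add: \<Omega>_def)
      then have "z a \<circ> inv (inv a' \<circ> k a) \<in> \<Psi>0"
        using z(1)[OF a(1)] unfolding \<Psi>0_def by force
      moreover have "z a \<circ> inv (inv a' \<circ> k a) = inv a \<circ> a'"
        using a(1) a' k_in[OF a(1)] z_in[OF a(1)] by (simp add: k_def inv_comp comp_assoc)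
      ultimately show ?thesis by simp
    qed
  qed
  have collision: "inv a \<circ> a' \<in> \<Psi>"
    if a: "a \<in> G" "b \<in> \<Gamma>" "a' \<in> G" "b' \<in> \<Gamma>" "w (a, b) = w (a', b')" for a a' b b'
  proof -
    have in_\<Gamma>: "a \<in> \<Gamma>" "a' \<in> \<Gamma>" using a by (auto simp: G_def)
    have "w (a, b) \<in> shadow \<delta> a" "w (a, b) \<in> shadow \<delta> a'"
      using w_a[OF in_\<Gamma>(1) a(2)] w_a[OF in_\<Gamma>(2) a(4)] a(5) by simp_all
    from \<Phi>(3)[OF in_\<Gamma> this] show ?thesis
    proof (elim disjE)
      assume "inv a \<circ> a' \<in> \<Phi>"
      then show ?thesis by (simp add: \<Psi>_def \<Psi>0_def)
    next
      assume "a' \<in> shadow (\<delta>/2) a"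
      from ordered[OF in_\<Gamma>(1) a(2,3,4,5) this] show ?thesis by (simp add: \<Psi>_def)
    next
      assume "a \<in> shadow (\<delta>/2) a'"
      from ordered[OF in_\<Gamma>(2) a(4,1,2) a(5)[symmetric] this]
      have "inv (inv a' \<circ> a) \<in> \<Psi>" by (simp add: \<Psi>_def)
      then show ?thesis using in_\<Gamma> by (simp add: inv_comp)
    qed
  qed

  \<comment> \<open>In the fibre of \<open>v\<close>, once one \<open>a\<close> is fixed, a pair
    \<open>(a', b')\<close> is recovered from \<open>inv a \<circ> a' \<in> \<Psi>\<close> and the
    aligning factor \<open>f a' b' \<in> F\<close>.\<close>
  define N where "N = card (\<Psi> \<times> F)"
  define K where "K = exp (2 * (\<bar>C1\<bar> + \<bar>C2\<bar> + \<bar>C3\<bar>)) * real N"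
  have "poincare m s \<le> 8 * K" if s: "1 < s" "s \<le> 2" for s
  proof -
    have P: "poincare m s > 0" by (rule poincare_pos[OF summ[OF s(1)]])
    have "\<exists>E. finite E \<and> E \<subseteq> \<Gamma> \<and> dist (\<Sum>\<gamma>\<in>E. exp (- s * m \<gamma>)) (poincare m s) \<le> poincare m s / 4"
      unfolding poincare_def
      by (rule infsum_finite_approximation[OF summ[OF s(1)]]) (use P in \<open>simp add: poincare_def\<close>)
    \<comment> \<open>A finite \<open>E\<close> with at least three quarters of the mass. At most
      one quarter is lost outside \<open>G\<close>, so \<open>E \<inter> G\<close> keeps one half;
      the products then give \<open>3/8 * P^2 \<le> K * P\<close>, which is stronger than the stated
      bound.\<close>
    then obtain E where E: "finite E" "E \<subseteq> \<Gamma>"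
      "dist (\<Sum>\<gamma>\<in>E. exp (- s * m \<gamma>)) (poincare m s) \<le> poincare m s / 4" by blast
    have sum_E: "(\<Sum>\<gamma>\<in>E. exp (- s * m \<gamma>)) \<ge> 3/4 * poincare m s"
      using E(3) unfolding dist_real_def by linarith
    have "(\<Sum>\<gamma>\<in>E - G. exp (- s * m \<gamma>)) \<le> C * exp (- c * R) * poincare m s"
    proof (rule maximal)
      show "\<forall>\<eta>\<in>E - G. \<exists>\<gamma>\<in>\<Gamma>. \<eta> \<in> shadow (\<delta>/2) \<gamma> \<and> R < \<bar>m0 \<gamma> - m1 \<gamma>\<bar>"
        using E(2) by (auto simp: G_def u not_le)
    qed (use R(1) s E(1) summ0 summ1 summ in auto)
    also have "\<dots> \<le> 1/4 * poincare m s"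
      using R(2) P by (intro mult_right_mono) auto
    also have "(\<Sum>\<gamma>\<in>E - G. exp (- s * m \<gamma>)) =
        (\<Sum>\<gamma>\<in>E. exp (- s * m \<gamma>)) - (\<Sum>\<gamma>\<in>E \<inter> G. exp (- s * m \<gamma>))"
      using sum.Int_Diff[OF E(1), of "\<lambda>\<gamma>. exp (- s * m \<gamma>)" G] by simp
    finally have sum_EG: "(\<Sum>\<gamma>\<in>E \<inter> G. exp (- s * m \<gamma>)) \<ge> 1/2 * poincare m s"
      using sum_E by linarith
    have "(1/2 * poincare m s) * (3/4 * poincare m s) \<le>
        (\<Sum>\<gamma>\<in>E \<inter> G. exp (- s * m \<gamma>)) * (\<Sum>\<gamma>\<in>E. exp (- s * m \<gamma>))"
      using sum_E sum_EG P by (intro mult_mono) (auto intro: sum_nonneg)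
    also have "\<dots> = (\<Sum>x\<in>(E \<inter> G) \<times> E. exp (- s * m (fst x)) * exp (- s * m (snd x)))"
      by (simp add: sum_product sum.cartesian_product case_prod_beta)
    also have "\<dots> \<le> exp (2 * (\<bar>C1\<bar> + \<bar>C2\<bar> + \<bar>C3\<bar>)) * real N * infsum (\<lambda>\<gamma>. exp (- s * m \<gamma>)) \<Gamma>"
    proof (rule sum_le_of_finite_to_one[where f = w])
      show "w ` ((E \<inter> G) \<times> E) \<subseteq> \<Gamma>" using E(2) w_in by auto
      fix x assume "x \<in> (E \<inter> G) \<times> E"
      then obtain a b where x: "x = (a, b)" "a \<in> \<Gamma>" "b \<in> \<Gamma>" using E(2) by auto
      have "exp (- s * m a) * exp (- s * m b) = exp (- s * (m a + m b))"
        by (simp add: algebra_simps exp_add[symmetric])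
      also have "\<dots> \<le> exp (2 * (\<bar>C1\<bar> + \<bar>C2\<bar> + \<bar>C3\<bar>)) * exp (- s * m (w (a, b)))"
        using m_w[OF x(2,3)] s by (intro exp_le_const) auto
      finally show "exp (- s * m (fst x)) * exp (- s * m (snd x)) \<le>
          exp (2 * (\<bar>C1\<bar> + \<bar>C2\<bar> + \<bar>C3\<bar>)) * exp (- s * m (w x))"
        using x by simp
    next
      fix v assume "v \<in> w ` ((E \<inter> G) \<times> E)"
      then obtain a b where ab: "a \<in> G" "b \<in> \<Gamma>" "v = w (a, b)" using E(2) by auto
      have a_in: "a \<in> \<Gamma>" using ab by (simp add: G_def)
      have "{x \<in> (E \<inter> G) \<times> E. w x = v} \<subseteq>
          (\<lambda>(\<psi>, h). (a \<circ> \<psi>, inv h \<circ> (inv (k (a \<circ> \<psi>)) \<circ> v))) ` (\<Psi> \<times> F)"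
      proof
        fix x assume "x \<in> {x \<in> (E \<inter> G) \<times> E. w x = v}"
        then obtain a' b' where x: "x = (a', b')" "a' \<in> G" "b' \<in> \<Gamma>" "w (a', b') = v"
          using E(2) by auto
        have a': "a' \<in> \<Gamma>" using x by (simp add: G_def)
        have "inv a \<circ> a' \<in> \<Psi>"
          using collision[OF ab(1,2) x(2,3)] ab(3) x(4) by simp
        moreover have "f a' b' \<in> F" by (rule f(1)[OF a' x(3)])
        moreover have "b' = inv (f a' b') \<circ> (inv (k a') \<circ> v)"
          using x(3,4) k_in[OF a'] f_in[OF a' x(3)] by (auto simp: w_def)
        ultimately show "x \<in> (\<lambda>(\<psi>, h). (a \<circ> \<psi>, inv h \<circ> (inv (k (a \<circ> \<psi>)) \<circ> v))) ` (\<Psi> \<times> F)"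
          using x(1) a_in by (intro image_eqI[of _ _ "(inv a \<circ> a', f a' b')"]) auto
      qed
      then show "card {x \<in> (E \<inter> G) \<times> E. w x = v} \<le> N"
        unfolding N_def using fin\<Psi> finite_F by (intro surj_card_le) auto
    qed (use E summ[OF s(1)] in auto)
    finally have "(3/8 * poincare m s) * poincare m s \<le> K * poincare m s"
      by (simp add: K_def poincare_def mult_ac)
    then have "3/8 * poincare m s \<le> K" using P by simp
    moreover have "0 \<le> K" by (simp add: K_def)
    ultimately show ?thesis by simp
  qed
  then have "(\<lambda>\<gamma>. exp (- 1 * m \<gamma>)) summable_on \<Gamma>"
    using summ by (intro summable_at_one) auto
  with div show False by blast
qed

end

section \<open>Critical exponents\<close>

text \<open>Where \<open>m\<close> is negative, the terms grow with \<open>s\<close>. Since a single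
  term is at most the sum \<open>S\<close>, however, \<open>- m \<gamma>\<close> is at most
  \<open>ln S / s\<close>, and the quotient of the two terms is bounded by \<open>K\<close>.\<close>

lemma summable_exp_mono:
  fixes m :: "'a \<Rightarrow> real"
  assumes summ: "(\<lambda>\<gamma>. exp (- s * m \<gamma>)) summable_on A" and s: "0 < s" "s \<le> s'"
  shows "(\<lambda>\<gamma>. exp (- s' * m \<gamma>)) summable_on A"
proof -
  define S where "S = infsum (\<lambda>\<gamma>. exp (- s * m \<gamma>)) A"
  define K where "K = exp ((s' - s) / s * ln S)"
  have "exp (- s' * m \<gamma>) \<le> K * exp (- s * m \<gamma>)" if "\<gamma> \<in> A" for \<gamma>
  proof -
    have "sum (\<lambda>\<gamma>. exp (- s * m \<gamma>)) {\<gamma>} \<le> S"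
      unfolding S_def using summ that by (intro finite_sum_le_infsum) auto
    then have le: "exp (- s * m \<gamma>) \<le> S" by simp
    then have "S > 0" using exp_gt_zero less_le_trans by blast
    then have "- s * m \<gamma> \<le> ln S" using le by (metis exp_le_cancel_iff exp_ln)
    then have "(s' - s) / s * (- s * m \<gamma>) \<le> (s' - s) / s * ln S"
      using s by (intro mult_left_mono) auto
    moreover have "(s' - s) / s * (- s * m \<gamma>) = - s' * m \<gamma> + s * m \<gamma>"
      using s(1) by (simp add: field_simps)
    ultimately have "- s' * m \<gamma> \<le> (s' - s) / s * ln S + - s * m \<gamma>" by simp
    then show ?thesis by (simp add: K_def exp_add[symmetric])
  qed
  then show ?thesis
    by (intro summable_on_comparison_test[OF summable_on_cmult_right[OF summ]]) auto
qed

lemma summable_above_critical_exponent: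
  fixes m :: "'a \<Rightarrow> real"
  assumes "critical_exponent A m < ereal s"
  shows "(\<lambda>\<gamma>. exp (- s * m \<gamma>)) summable_on A"
proof -
  obtain s' where "s' > 0" "(\<lambda>\<gamma>. exp (- s' * m \<gamma>)) summable_on A" "s' < s"
    using assms unfolding critical_exponent_def Inf_less_iff by auto
  then show ?thesis using summable_exp_mono[of s' m A s] by simp
qed

lemma critical_exponent_le_one:
  assumes "\<And>s. 1 < s \<Longrightarrow> (\<lambda>\<gamma>. exp (- s * m \<gamma>)) summable_on A"
  shows "critical_exponent A m \<le> 1"
proof (rule ccontr)
  assume "\<not> ?thesis"
  then obtain s where s: "1 < ereal s" "ereal s < critical_exponent A m"
    using ereal_dense2[of 1 "critical_exponent A m"] by (auto simp: not_le)
  have "1 < s" using s(1) by (simp add: one_ereal_def)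
  then have "critical_exponent A m \<le> ereal s"
    unfolding critical_exponent_def using assms[of s] by (intro Inf_lower) auto
  then show False using s(2) by simp
qed

lemma summable_exp_bounded_perturbation:
  fixes m m' :: "'a \<Rightarrow> real"
  assumes summ: "(\<lambda>\<gamma>. exp (- s * m \<gamma>)) summable_on A" and s: "0 \<le> s"
    and C: "\<And>\<gamma>. \<gamma> \<in> A \<Longrightarrow> \<bar>m \<gamma> - m' \<gamma>\<bar> \<le> C"
  shows "(\<lambda>\<gamma>. exp (- s * m' \<gamma>)) summable_on A"
proof -
  have "exp (- s * m' \<gamma>) \<le> exp (s * C) * exp (- s * m \<gamma>)" if "\<gamma> \<in> A" for \<gamma>
  proof -
    have "s * (m \<gamma> - m' \<gamma>) \<le> s * C"
      using C[OF that] s by (intro mult_left_mono) auto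
    then have "- s * m' \<gamma> \<le> s * C + - s * m \<gamma>" by (simp add: algebra_simps)
    then show ?thesis by (simp add: exp_add[symmetric])
  qed
  then show ?thesis
    by (intro summable_on_comparison_test[OF summable_on_cmult_right[OF summ]]) auto
qed

lemma critical_exponent_bounded_perturbation:
  fixes m m' :: "'a \<Rightarrow> real"
  assumes C: "\<And>\<gamma>. \<gamma> \<in> A \<Longrightarrow> \<bar>m \<gamma> - m' \<gamma>\<bar> \<le> C"
  shows "critical_exponent A m = critical_exponent A m'"
proof -
  have C': "\<And>\<gamma>. \<gamma> \<in> A \<Longrightarrow> \<bar>m' \<gamma> - m \<gamma>\<bar> \<le> C" using C by (simp add: abs_minus_commute)
  have "(\<lambda>\<gamma>. exp (- s * m \<gamma>)) summable_on A \<longleftrightarrow> (\<lambda>\<gamma>. exp (- s * m' \<gamma>)) summable_on A" if "s > 0" for s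
    using summable_exp_bounded_perturbation[of s m A m' C] summable_exp_bounded_perturbation[of s m' A m C]
      C C' that by auto
  then have "{ereal s |s. s > 0 \<and> (\<lambda>\<gamma>. exp (- s * m \<gamma>)) summable_on A} =
      {ereal s |s. s > 0 \<and> (\<lambda>\<gamma>. exp (- s * m' \<gamma>)) summable_on A}" by blast
  then show ?thesis by (simp only: critical_exponent_def)
qed

theorem theorem1p6:
  fixes \<Gamma> :: "('m::metric_space \<Rightarrow> 'm) set"
    and d :: "('m \<Rightarrow> 'm) + 'm \<Rightarrow> ('m \<Rightarrow> 'm) + 'm \<Rightarrow> real"
    and \<sigma>0 \<sigma>1 :: "('m \<Rightarrow> 'm) \<Rightarrow> 'm \<Rightarrow> real"
    and m0 m1 mt :: "('m \<Rightarrow> 'm) \<Rightarrow> real"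
    and t :: real
  assumes "compact (UNIV :: 'm set)"
    and "convergence_group \<Gamma>" and "nonelementary \<Gamma>"
    and "compatible_metric \<Gamma> d"
    and "expanding \<Gamma> d \<sigma>0" and "expanding \<Gamma> d \<sigma>1"
    and "0 < t" and "t < 1"
    and "magnitude \<Gamma> d \<sigma>0 m0" and "magnitude \<Gamma> d \<sigma>1 m1"
    and "magnitude \<Gamma> d (convex_comb t \<sigma>0 \<sigma>1) mt"
    and "critical_exponent \<Gamma> m0 = 1" and "critical_exponent \<Gamma> m1 = 1"
  shows "critical_exponent \<Gamma> mt \<le> 1 \<and>
    (\<not> (\<lambda>\<gamma>. exp (- real_of_ereal (critical_exponent \<Gamma> mt) * mt \<gamma>)) summable_on \<Gamma> \<longrightarrow>
       (critical_exponent \<Gamma> mt = 1 \<longleftrightarrow> (SUP \<gamma>\<in>\<Gamma>. ereal \<bar>m0 \<gamma> - m1 \<gamma>\<bar>) < \<infinity>))"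
proof -
  interpret convergence_compactification \<Gamma> d
  proof
    show "\<exists>p q r :: 'm. p \<noteq> q \<and> p \<noteq> r \<and> q \<noteq> r"
      using nonelementary_limit_point[OF assms(3)] by metis
  qed (use assms in auto)
  obtain \<kappa>0 where \<kappa>0: "quasi_cocycle \<kappa>0 \<sigma>0" using expanding_quasi_cocycle[OF assms(5)] by blast
  obtain \<kappa>1 where \<kappa>1: "quasi_cocycle \<kappa>1 \<sigma>1" using expanding_quasi_cocycle[OF assms(6)] by blast
  have ra: "roughly_additive m0" "roughly_additive m1"
    using magnitude_roughly_additive[OF \<kappa>0 assms(9)] magnitude_roughly_additive[OF \<kappa>1 assms(10)] .
  have summ0: "(\<lambda>\<gamma>. exp (- s * m0 \<gamma>)) summable_on \<Gamma>" if "1 < s" for s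
    using that assms(12) by (intro summable_above_critical_exponent) (simp add: one_ereal_def)
  have summ1: "(\<lambda>\<gamma>. exp (- s * m1 \<gamma>)) summable_on \<Gamma>" if "1 < s" for s
    using that assms(13) by (intro summable_above_critical_exponent) (simp add: one_ereal_def)
  define m where "m = (\<lambda>\<gamma>. t * m0 \<gamma> + (1 - t) * m1 \<gamma>)"
  have summ: "(\<lambda>\<gamma>. exp (- s * m \<gamma>)) summable_on \<Gamma>" if "1 < s" for s
  proof (rule summable_on_comparison_test)
    show "(\<lambda>\<gamma>. exp (- s * m0 \<gamma>) + exp (- s * m1 \<gamma>)) summable_on \<Gamma>"
      by (intro summable_on_add summ0 summ1 that)
    fix \<gamma>
    \<comment> \<open>A convex combination is at least the minimum, so each term is dominated by the
      sum of the two terms for \<open>m0\<close> and \<open>m1\<close>.\<close>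
    have "t * min (m0 \<gamma>) (m1 \<gamma>) + (1 - t) * min (m0 \<gamma>) (m1 \<gamma>) \<le> m \<gamma>"
      unfolding m_def using assms(7,8) by (intro add_mono mult_left_mono) auto
    then have "min (m0 \<gamma>) (m1 \<gamma>) \<le> m \<gamma>" by (simp add: algebra_simps)
    then have "exp (- s * m \<gamma>) \<le> exp (- s * min (m0 \<gamma>) (m1 \<gamma>))" using that by simp
    also have "\<dots> \<le> exp (- s * m0 \<gamma>) + exp (- s * m1 \<gamma>)" by (simp add: min_def)
    finally show "exp (- s * m \<gamma>) \<le> exp (- s * m0 \<gamma>) + exp (- s * m1 \<gamma>)" .
  qed simp
  have "magnitude \<Gamma> d (convex_comb t \<sigma>0 \<sigma>1) m"
    unfolding m_def using magnitude_convex_comb assms(7-10) by blast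
  then obtain C where C: "\<And>\<gamma>. \<gamma> \<in> \<Gamma> \<Longrightarrow> \<bar>m \<gamma> - mt \<gamma>\<bar> \<le> C"
    using magnitude_unique_up_to_bounded assms(11) by metis
  have ce_eq: "critical_exponent \<Gamma> m = critical_exponent \<Gamma> mt"
    using C by (rule critical_exponent_bounded_perturbation)
  have "critical_exponent \<Gamma> mt \<le> 1"
    using critical_exponent_le_one[of m \<Gamma>] summ ce_eq by simp
  moreover have "(SUP \<gamma>\<in>\<Gamma>. ereal \<bar>m0 \<gamma> - m1 \<gamma>\<bar>) < \<infinity>"
    if div: "\<not> (\<lambda>\<gamma>. exp (- real_of_ereal (critical_exponent \<Gamma> mt) * mt \<gamma>)) summable_on \<Gamma>"
      and one: "critical_exponent \<Gamma> mt = 1"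
  proof -
    have "proper m0"
      unfolding proper_def using finite_sublevel_summable_exp[OF summ0[of 2]] by simp
    then have "finite {\<gamma>\<in>\<Gamma>. m0 \<gamma> \<le> K}" for K by (simp add: proper_def)
    then obtain F e where F: "finite F" "F \<subseteq> \<Gamma>" "e > 0"
      "\<And>a q. a \<in> X \<Longrightarrow> q \<in> X \<Longrightarrow> \<exists>f\<in>F. d (sum_act f a) q > e"
      by (rule finite_set_displacing_every_point[OF assms(3) \<kappa>0 assms(9)]) (rule that; assumption)
    interpret spread_compactification \<Gamma> d F e
      by unfold_locales (use F in auto)
    \<comment> \<open>The given magnitude \<open>mt\<close> differs from the explicit one
      \<open>m\<close> by a bounded amount, so divergence at exponent one carries over.\<close>
    have "\<not> (\<lambda>\<gamma>. exp (- 1 * m \<gamma>)) summable_on \<Gamma>"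
      using summable_exp_bounded_perturbation[of 1 m \<Gamma> mt C] C div one by auto
    from discrepancy_bounded[OF ra assms(7,8) m_def summ0 summ1 summ this]
    obtain B where "\<And>\<gamma>. \<gamma> \<in> \<Gamma> \<Longrightarrow> \<bar>m0 \<gamma> - m1 \<gamma>\<bar> \<le> B" by blast
    then have "(SUP \<gamma>\<in>\<Gamma>. ereal \<bar>m0 \<gamma> - m1 \<gamma>\<bar>) \<le> ereal B" by (intro SUP_least) simp
    then show ?thesis by (rule le_less_trans) simp
  qed
  moreover have "critical_exponent \<Gamma> mt = 1"
    if fin: "(SUP \<gamma>\<in>\<Gamma>. ereal \<bar>m0 \<gamma> - m1 \<gamma>\<bar>) < \<infinity>"
  proof -
    obtain B where B: "(SUP \<gamma>\<in>\<Gamma>. ereal \<bar>m0 \<gamma> - m1 \<gamma>\<bar>) < ereal B"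
      using fin less_PInf_Ex_of_nat by auto
    have "\<bar>m0 \<gamma> - mt \<gamma>\<bar> \<le> B + C" if \<gamma>: "\<gamma> \<in> \<Gamma>" for \<gamma>
    proof -
      have "ereal \<bar>m0 \<gamma> - m1 \<gamma>\<bar> < ereal B"
        using B SUP_upper[OF \<gamma>, of "\<lambda>\<gamma>. ereal \<bar>m0 \<gamma> - m1 \<gamma>\<bar>"] by (rule le_less_trans[rotated])
      then have "\<bar>m0 \<gamma> - m1 \<gamma>\<bar> \<le> B" by simp
      moreover have "\<bar>m0 \<gamma> - m \<gamma>\<bar> \<le> \<bar>m0 \<gamma> - m1 \<gamma>\<bar>"
      proof -
        have "m0 \<gamma> - m \<gamma> = (1 - t) * (m0 \<gamma> - m1 \<gamma>)" by (simp add: m_def algebra_simps)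
        then have "\<bar>m0 \<gamma> - m \<gamma>\<bar> = (1 - t) * \<bar>m0 \<gamma> - m1 \<gamma>\<bar>"
          using assms(8) by (simp add: abs_mult)
        also have "\<dots> \<le> 1 * \<bar>m0 \<gamma> - m1 \<gamma>\<bar>"
          using assms(7) by (intro mult_right_mono) auto
        finally show ?thesis by simp
      qed
      ultimately show ?thesis using C[OF \<gamma>] by linarith
    qed
    then have "critical_exponent \<Gamma> m0 = critical_exponent \<Gamma> mt"
      by (rule critical_exponent_bounded_perturbation)
    then show ?thesis using assms(12) by simp
  qed
  ultimately show ?thesis by blast
qed

end
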